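(* Let $m=2$, $k\ge1$, and let $L$ be a homogeneous Lagrangian on the bundle $\mathcal{F}^k_{(2)}E$ of $k$-th order $2$-frames of a smooth manifold $E$. Let $\Theta_0$ be the class of $L\,d^2t$ and let $\Theta_2=(Pd)^2\Theta_0$ be the fundamental form of $L$ (a scalar $2$-form). Then $d\Theta_2=0$ if, and only if, $L$ is null.
   Context: Here $m=2$. $E$ is a smooth manifold of dimension $n$. For $k\ge1$, $\mathcal{F}^k_{(m)}E$ is the manifold of $k$-jets at $0$ of maps $\gamma$ from a neighbourhood of $0\in\mathbb{R}^m$ to $E$ which are immersions at $0$ (the bundle of $k$-th order $m$-frames, or regular $k$-th order $m$-velocities); $\tau_{k+1,k}:\mathcal{F}^{k+1}_{(m)}E\to\mathcal{F}^k_{(m)}E$ is the projection. Local coordinates $(u^\alpha)$ on $E$ give coordinates $u^\alpha_I$, $0\le|I|\le k$, on $\mathcal{F}^k_{(m)}E$, where $u^\alpha_I$ is the partial derivative $\partial^{|I|}\gamma^\alpha/\partial t^I$ at $0$. Here $I\in\mathbb{N}^m$ is a multi-index with entries $I(i)$, $|I|=\sum_i I(i)$, $I!=\prod_i I(i)!$, and $1_j$ is the multi-index with $1$ in position $j$ and $0$ elsewhere. Repeated indices are summed. Pull-backs by the projections between frame bundles are omitted: forms are identified with their pull-backs. Total derivatives: $\mathrm{T}_j=\sum_{|I|=0}^k u^\alpha_{I+1_j}\,\partial/\partial u^\alpha_I$, a vector field along $\tau_{k+1,k}$. For a form $\phi$ on $\mathcal{F}^k_{(m)}E$, $i_j\phi$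 is its contraction with $\mathrm{T}_j$ and $d_j\phi=i_jd\phi+d\,i_j\phi$ its Lie derivative; both are forms on $\mathcal{F}^{k+1}_{(m)}E$. The $d_j$ commute, and $d_I$ denotes the iterated operator. Vertical endomorphisms: $S^i=\sum_{|I|=0}^{k-1}(I(i)+1)\,\frac{\partial}{\partial u^\alpha_{I+1_i}}\otimes du^\alpha_I$ is a type $(1,1)$ tensor field on $\mathcal{F}^k_{(m)}E$. $S^i$ also denotes the contraction with forms, i.e. the degree-$0$ derivation which is zero on functions and satisfies $(S^i\phi)(X_1,\ldots,X_r)=\sum_a\phi(X_1,\ldots,S^iX_a,\ldots,X_r)$. The $S^i$ commute, and $S^I$ acting on forms is the iterated contraction. Fundamental vector fields: for $|K|\ge1$, $\Delta^K_j=S^K(\mathrm{T}_j)$ (with $S^K$ the composite tensor field), in coordinates $\Delta^K_j=\sum_{|I|=0}^{k-|K|}\frac{(I+K)!}{I!}u^\alpha_{I+1_j}\,\partial/\partial u^\alpha_{I+K}$ on $\mathcal{F}^k_{(m)}E$; $d^K_j$ is the Lie derivative along $\Delta^K_j$, with $d^i_j=d^{1_i}_j$. A Lagrangian is a smooth function $L$ on $\mathcal{F}^k_{(m)}E$. It is homogeneous if $d^i_jL=\delta^i_jL$ for all $i,j$ and $d^I_jL=0$ for all $j$ and all $|I|\ge2$. Its Hilbert forms are the $1$-forms $\vartheta^i=\sum_{|I|=0}^k\frac{(-1)^{|I|}}{I!\,(|I|+1)}d_IS^{I+1_i}dL$ on $\mathcal{F}^{2k-1}_{(m)}E$; its Euler-Lagrange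 form is $\varepsilon=dL-d_i\vartheta^i$ on $\mathcal{F}^{2k}_{(m)}E$, in coordinates $\varepsilon=\sum_{|I|=0}^k(-1)^{|I|}d_I\big(\partial L/\partial u^\alpha_I\big)du^\alpha$. $L$ is null if $\varepsilon=0$. Vector-valued forms: $\Omega^{r,s}_k=\Omega^r(\mathcal{F}^k_{(m)}E)\otimes\bigwedge^s\mathbb{R}^{m*}$. With $(dt^i)$ the standard basis of $\mathbb{R}^{m*}$, an element is written $\Phi=\phi_{i_1\cdots i_s}\otimes dt^{i_1}\wedge\cdots\wedge dt^{i_s}$ with scalar $r$-forms $\phi_{i_1\cdots i_s}$ completely skew in their indices. $\overline{\Omega}^{0,s}_k$ is the quotient of $\Omega^{0,s}_k$ by the constant functions. Put $d^mt=dt^1\wedge\cdots\wedge dt^m$. The operator $d$ acts componentwise (and is well defined on $\overline{\Omega}^{0,s}_k$). The operator $P$ on $\Omega^{r,s}_k$ ($r\ge1$), with values in $\Omega^{r,s-1}_{(r+1)k-1}$, is $$P\Phi=P^j_{(s)}(\phi_{i_1\cdots i_s})\otimes\Big\{\tfrac{\partial}{\partial t^j}\lrcorner\,(dt^{i_1}\wedge\cdots\wedge dt^{i_s})\Big\},\qquad P^j_{(s)}=\sum_{|J|=0}^{rk-1}\frac{(-1)^{|J|}(m-s)!\,|J|!}{r^{|J|+1}(m-s+|J|+1)!\,J!}\,d_JS^{J+1_j},$$ where $\lrcorner$ denotes contraction. $\Theta_0\in\overline{\Omega}^{0,m}_k$ is the class of $L\,d^mt$. The form $\Theta_m=(Pd)^m\Theta_0$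 takes values in $\bigwedge^0\mathbb{R}^{m*}=\mathbb{R}$, so is a scalar $m$-form, called the fundamental form of $L$. *)

theory Defs
  imports "HOL-Analysis.Analysis"
begin

section \<open>Smooth maps and smooth manifolds\<close>

fun Ck_on :: "nat \<Rightarrow> 'a::real_normed_vector set \<Rightarrow> ('a \<Rightarrow> 'b::real_normed_vector) \<Rightarrow> bool" where
  "Ck_on 0 S f \<longleftrightarrow> continuous_on S f"
| "Ck_on (Suc l) S f \<longleftrightarrow>
     (\<forall>x\<in>S. f differentiable (at x)) \<and> (\<forall>v. Ck_on l S (\<lambda>x. frechet_derivative f (at x) v))"

definition smooth_on :: "'a::real_normed_vector set \<Rightarrow> ('a \<Rightarrow> 'b::real_normed_vector) \<Rightarrow> bool" where
  "smooth_on S f \<longleftrightarrow> (\<forall>l. Ck_on l S f)"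

text \<open>A chart is a pair of its domain and its coordinate map (whose values outside the domain
  are irrelevant).\<close>

type_synonym ('e, 'n) chart = "'e set \<times> ('e \<Rightarrow> real^'n)"

definition is_chart :: "('e::topological_space, 'n::finite) chart \<Rightarrow> bool" where
  "is_chart c \<longleftrightarrow> (case c of (U, x) \<Rightarrow>
     open U \<and> open (x ` U) \<and> homeomorphism U (x ` U) x (inv_into U x))"

text \<open>The manifold is the whole type, which in the theorem is Hausdorff and second countable;
  its dimension is the cardinality of the index type.\<close>

definition smooth_atlas :: "('e::topological_space, 'n::finite) chart set \<Rightarrow> bool" where
  "smooth_atlas A \<longleftrightarrow>
     (\<forall>c\<in>A. is_chart c) \<and> (\<Union>(U, x)\<in>A. U) = UNIV \<and>
     (\<forall>(U, x)\<in>A. \<forall>(V, y)\<in>A. smooth_on (x ` (U \<inter> V)) (y \<circ> inv_into U x))"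

section \<open>Multi-indices\<close>

text \<open>A multi-index is an element of \<^typ>\<open>nat^2\<close>; the multi-index \<open>1\<^sub>j\<close> is \<open>axis j 1\<close>.\<close>

definition mlen :: "nat^2 \<Rightarrow> nat" where
  "mlen I = (\<Sum>i\<in>UNIV. I $ i)"

definition mfact :: "nat^2 \<Rightarrow> nat" where
  "mfact I = (\<Prod>i\<in>UNIV. fact (I $ i))"

definition iter_multi :: "(2 \<Rightarrow> 'a \<Rightarrow> 'a) \<Rightarrow> nat^2 \<Rightarrow> 'a \<Rightarrow> 'a" where
  "iter_multi D I = ((D 1) ^^ (I $ 1)) \<circ> ((D 2) ^^ (I $ 2))"

section \<open>The frame bundles of a manifold\<close>

definition partial :: "2 \<Rightarrow> (real^2 \<Rightarrow> 'b::real_normed_vector) \<Rightarrow> real^2 \<Rightarrow> 'b" where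
  "partial j f t = frechet_derivative f (at t) (axis j 1)"

definition jet_coord :: "('e, 'n::finite) chart \<Rightarrow> nat^2 \<Rightarrow> (real^2 \<Rightarrow> 'e) \<Rightarrow> real^'n" where
  "jet_coord c I \<gamma> = iter_multi partial I (snd c \<circ> \<gamma>) 0"

text \<open>Maps defined near 0 are represented by total functions; only their germs at 0 are used.\<close>

definition smooth_near_0 :: "('e::topological_space, 'n::finite) chart set \<Rightarrow> (real^2 \<Rightarrow> 'e) \<Rightarrow> bool" where
  "smooth_near_0 A \<gamma> \<longleftrightarrow>
     (\<exists>(U, x)\<in>A. \<exists>N. open N \<and> 0 \<in> N \<and> \<gamma> ` N \<subseteq> U \<and> smooth_on N (x \<circ> \<gamma>))"

definition immersion_at_0 :: "('e::topological_space, 'n::finite) chart set \<Rightarrow> (real^2 \<Rightarrow> 'e) \<Rightarrow> bool" where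
  "immersion_at_0 A \<gamma> \<longleftrightarrow> smooth_near_0 A \<gamma> \<and>
     (\<forall>(U, x)\<in>A. \<gamma> 0 \<in> U \<longrightarrow> inj (frechet_derivative (x \<circ> \<gamma>) (at 0)))"

definition jet :: "('e::topological_space, 'n::finite) chart set \<Rightarrow> nat \<Rightarrow> (real^2 \<Rightarrow> 'e) \<Rightarrow> (real^2 \<Rightarrow> 'e) set" where
  "jet A k \<gamma> = {\<gamma>'. smooth_near_0 A \<gamma>' \<and> \<gamma>' 0 = \<gamma> 0 \<and>
     (\<forall>c\<in>A. \<gamma> 0 \<in> fst c \<longrightarrow> (\<forall>I. mlen I \<le> k \<longrightarrow> jet_coord c I \<gamma>' = jet_coord c I \<gamma>))}"

definition frame_bundle :: "('e::topological_space, 'n::finite) chart set \<Rightarrow> nat \<Rightarrow> (real^2 \<Rightarrow> 'e) set set" where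
  "frame_bundle A k = jet A k ` {\<gamma>. immersion_at_0 A \<gamma>}"

section \<open>Coordinates on the frame bundles\<close>

text \<open>A point \<open>p\<close> lists all jet coordinates, \<open>u\<^sup>\<alpha>\<^sub>I = p I $ \<alpha>\<close>, without a bound on
  the order of \<open>I\<close>. A function or form on the bundle of order \<open>k\<close> is identified with its
  pull-back, which depends only on the components with \<open>mlen I \<le> k\<close> of the point and of the
  tangent vectors. Constant tangent vectors have the same type as points. The function type
  carries the product topology.\<close>

type_synonym 'n point = "nat^2 \<Rightarrow> real^'n"

definition shift :: "'n::finite point \<Rightarrow> 'n point \<Rightarrow> real \<Rightarrow> 'n point" where
  "shift p v s = (\<lambda>I. p I + s *\<^sub>R v I)"

definition frame_chart_dom :: "('e, 'n::finite) chart \<Rightarrow> 'n point set" where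
  "frame_chart_dom c = {p. p 0 \<in> snd c ` fst c \<and>
     (\<forall>a b. a *\<^sub>R p (axis 1 1) + b *\<^sub>R p (axis 2 1) = 0 \<longrightarrow> a = 0 \<and> b = 0)}"

definition local_rep ::
  "('e::topological_space, 'n::finite) chart set \<Rightarrow> nat \<Rightarrow> ((real^2 \<Rightarrow> 'e) set \<Rightarrow> real)
     \<Rightarrow> ('e, 'n) chart \<Rightarrow> 'n point \<Rightarrow> real" where
  "local_rep A k L c p = L (THE z. z \<in> frame_bundle A k \<and>
     (\<forall>\<gamma>\<in>z. \<gamma> 0 \<in> fst c \<and> (\<forall>I. mlen I \<le> k \<longrightarrow> jet_coord c I \<gamma> = p I)))"

definition dir_deriv :: "'n::finite point \<Rightarrow> ('n point \<Rightarrow> real) \<Rightarrow> 'n point \<Rightarrow> real" where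
  "dir_deriv v F p = deriv (\<lambda>s. F (shift p v s)) 0"

text \<open>All iterated directional derivatives exist and are continuous. For functions of finitely
  many coordinates, the only ones it is used for, this is the usual notion of smoothness.\<close>

definition point_smooth_on :: "'n::finite point set \<Rightarrow> ('n point \<Rightarrow> real) \<Rightarrow> bool" where
  "point_smooth_on W F \<longleftrightarrow> (\<forall>vs. continuous_on W (foldr dir_deriv vs F) \<and>
     (\<forall>v. \<forall>p\<in>W. (\<lambda>s. foldr dir_deriv vs F (shift p v s)) differentiable (at 0)))"

definition lagrangian ::
  "('e::topological_space, 'n::finite) chart set \<Rightarrow> nat \<Rightarrow> ((real^2 \<Rightarrow> 'e) set \<Rightarrow> real) \<Rightarrow> bool" where
  "lagrangian A k L \<longleftrightarrow> (\<forall>c\<in>A. point_smooth_on (frame_chart_dom c) (local_rep A k L c))"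

section \<open>Scalar forms in coordinates\<close>

text \<open>A form takes a point and a list of tangent vectors; an \<open>r\<close>-form vanishes on lists of
  length other than \<open>r\<close>.\<close>

type_synonym 'n form = "'n point \<Rightarrow> 'n point list \<Rightarrow> real"

definition fun_form :: "('n::finite point \<Rightarrow> real) \<Rightarrow> 'n form" where
  "fun_form F p vs = (if vs = [] then F p else 0)"

definition ext_d :: "'n::finite form \<Rightarrow> 'n form" where
  "ext_d \<phi> p vs = (\<Sum>a<length vs.
     (-1) ^ a * dir_deriv (vs ! a) (\<lambda>q. \<phi> q (take a vs @ drop (Suc a) vs)) p)"

definition contract :: "('n::finite point \<Rightarrow> 'n point) \<Rightarrow> 'n form \<Rightarrow> 'n form" where
  "contract X \<phi> p vs = \<phi> p (X p # vs)"

definition lie :: "('n::finite point \<Rightarrow> 'n point) \<Rightarrow> 'n form \<Rightarrow> 'n form" where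
  "lie X \<phi> = (\<lambda>p vs. contract X (ext_d \<phi>) p vs + ext_d (contract X \<phi>) p vs)"

definition total :: "2 \<Rightarrow> 'n::finite point \<Rightarrow> 'n point" where
  "total j p = (\<lambda>I. p (I + axis j 1))"

definition d_multi :: "nat^2 \<Rightarrow> 'n::finite form \<Rightarrow> 'n form" where
  "d_multi = iter_multi (\<lambda>j. lie (total j))"

text \<open>The component at \<open>I + 1\<^sub>i\<close> of the image of \<open>v\<close> is \<open>(I(i) + 1) v\<^sub>I\<close>; the components
  at indices \<open>I\<close> with \<open>I(i) = 0\<close> vanish because of the factor \<open>I $ i\<close>.\<close>

definition vert_endo :: "2 \<Rightarrow> 'n::finite point \<Rightarrow> 'n point" where
  "vert_endo i v = (\<lambda>I. real (I $ i) *\<^sub>R v (I - axis i 1))"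

definition vert_contract :: "2 \<Rightarrow> 'n::finite form \<Rightarrow> 'n form" where
  "vert_contract i \<phi> p vs = (\<Sum>a<length vs. \<phi> p (vs[a := vert_endo i (vs ! a)]))"

text \<open>On forms this iterates the contractions, which differs from contraction with the composite
  tensor field as soon as the degree exceeds 1.\<close>

definition vert_contract_multi :: "nat^2 \<Rightarrow> 'n::finite form \<Rightarrow> 'n form" where
  "vert_contract_multi = iter_multi vert_contract"

definition fundamental_vf :: "nat^2 \<Rightarrow> 2 \<Rightarrow> 'n::finite point \<Rightarrow> 'n point" where
  "fundamental_vf K j p = iter_multi vert_endo K (total j p)"

definition homogeneous ::
  "('e::topological_space, 'n::finite) chart set \<Rightarrow> nat \<Rightarrow> ((real^2 \<Rightarrow> 'e) set \<Rightarrow> real) \<Rightarrow> bool" where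
  "homogeneous A k L \<longleftrightarrow> (\<forall>c\<in>A. \<forall>p\<in>frame_chart_dom c.
     (\<forall>i j. lie (fundamental_vf (axis i 1) j) (fun_form (local_rep A k L c)) p []
              = (if i = j then local_rep A k L c p else 0)) \<and>
     (\<forall>I j. mlen I \<ge> 2 \<longrightarrow> lie (fundamental_vf I j) (fun_form (local_rep A k L c)) p [] = 0))"

definition hilbert_form :: "nat \<Rightarrow> ('n::finite point \<Rightarrow> real) \<Rightarrow> 2 \<Rightarrow> 'n form" where
  "hilbert_form k F i p vs = (\<Sum>I | mlen I \<le> k.
     (-1) ^ mlen I / (real (mfact I) * (real (mlen I) + 1))
       * d_multi I (vert_contract_multi (I + axis i 1) (ext_d (fun_form F))) p vs)"

definition euler_lagrange_form :: "nat \<Rightarrow> ('n::finite point \<Rightarrow> real) \<Rightarrow> 'n form" where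
  "euler_lagrange_form k F p vs =
     ext_d (fun_form F) p vs - (\<Sum>i\<in>UNIV. lie (total i) (hilbert_form k F i) p vs)"

section \<open>Vector-valued forms and the fundamental form\<close>

text \<open>An element of \<open>\<Omega>\<^sup>r\<^sup>,\<^sup>s\<close> is stored as the alternating \<open>s\<close>-linear map from
  \<open>\<real>\<^sup>2\<close> to scalar \<open>r\<close>-forms that it defines, given on lists of length \<open>s\<close>. Contraction with the
  basis vector \<open>\<partial>/\<partial>t\<^sup>j\<close> then inserts it as the first argument.\<close>

type_synonym 'n vform = "(real^2) list \<Rightarrow> 'n form"

definition d2t :: "(real^2) list \<Rightarrow> real" where
  "d2t ws = (case ws of [v, w] \<Rightarrow> v $ 1 * w $ 2 - v $ 2 * w $ 1 | _ \<Rightarrow> 0)"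

definition vext_d :: "'n::finite vform \<Rightarrow> 'n vform" where
  "vext_d \<Phi> = (\<lambda>ws. ext_d (\<Phi> ws))"

definition P_scalar :: "nat \<Rightarrow> nat \<Rightarrow> nat \<Rightarrow> 2 \<Rightarrow> 'n::finite form \<Rightarrow> 'n form" where
  "P_scalar k r s j \<phi> p vs = (\<Sum>J | mlen J \<le> r * k - 1.
     (-1) ^ mlen J * fact (2 - s) * fact (mlen J)
       / (real r ^ (mlen J + 1) * fact (2 - s + mlen J + 1) * real (mfact J))
       * d_multi J (vert_contract_multi (J + axis j 1) \<phi>) p vs)"

definition P_op :: "nat \<Rightarrow> nat \<Rightarrow> nat \<Rightarrow> 'n::finite vform \<Rightarrow> 'n vform" where
  "P_op k r s \<Phi> ws p vs = (\<Sum>j\<in>UNIV. P_scalar k r s j (\<Phi> (axis j 1 # ws)) p vs)"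

text \<open>Classes modulo constants: since \<open>\<And>\<^sup>2\<real>\<^sup>2\<^sup>*\<close> is spanned by \<open>d2t\<close>, the class of
  \<open>F d2t\<close> consists of the forms \<open>(F + C) d2t\<close> with \<open>C\<close> constant. The operator \<open>d\<close> takes the
  same value on all elements of a class.\<close>

definition Theta0 :: "('n::finite point \<Rightarrow> real) \<Rightarrow> 'n vform set" where
  "Theta0 F = {\<lambda>ws. fun_form (\<lambda>p. (F p + C) * d2t ws) | C. True}"

definition d_class :: "'n::finite vform set \<Rightarrow> 'n vform" where
  "d_class X = the_elem (vext_d ` X)"

lemma d_class_Theta0: "d_class (Theta0 F) = vext_d (\<lambda>ws. fun_form (\<lambda>p. F p * d2t ws))"
proof -
  have dd: "dir_deriv v (\<lambda>q. G q + c) p = dir_deriv v G p" for v c p and G :: "'a point \<Rightarrow> real"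
  proof -
    have 1: "((\<lambda>s. G (shift p v s) + c) has_field_derivative D) (at 0)"
      if "((\<lambda>s. G (shift p v s)) has_field_derivative D) (at 0)" for D
      using DERIV_add[OF that DERIV_const[of c]] by simp
    have 2: "((\<lambda>s. G (shift p v s)) has_field_derivative D) (at 0)"
      if "((\<lambda>s. G (shift p v s) + c) has_field_derivative D) (at 0)" for D
      using DERIV_add[OF that DERIV_const[of "- c"]] by simp
    have "((\<lambda>s. G (shift p v s) + c) has_field_derivative D) (at 0) \<longleftrightarrow>
          ((\<lambda>s. G (shift p v s)) has_field_derivative D) (at 0)" for D
      using 1 2 by blast
    then show ?thesis by (simp add: dir_deriv_def deriv_def)
  qed
  have eq: "vext_d (\<lambda>ws. fun_form (\<lambda>p. (F p + C) * d2t ws)) = vext_d (\<lambda>ws. fun_form (\<lambda>p. F p * d2t ws))"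
    for C
  proof (intro ext)
    fix ws p vs
    have "dir_deriv v (\<lambda>q. fun_form (\<lambda>p. (F p + C) * d2t ws) q us) p
        = dir_deriv v (\<lambda>q. fun_form (\<lambda>p. F p * d2t ws) q us) p" for v us
      using dd[of v "\<lambda>q. F q * d2t ws" "C * d2t ws" p]
      by (cases "us = []") (simp_all add: fun_form_def distrib_right)
    then show "vext_d (\<lambda>ws. fun_form (\<lambda>p. (F p + C) * d2t ws)) ws p vs
        = vext_d (\<lambda>ws. fun_form (\<lambda>p. F p * d2t ws)) ws p vs"
      by (simp add: vext_d_def ext_d_def)
  qed
  have "Theta0 F = range (\<lambda>C ws. fun_form (\<lambda>p. (F p + C) * d2t ws))"
    by (auto simp: Theta0_def)
  then have "vext_d ` Theta0 F = {vext_d (\<lambda>ws. fun_form (\<lambda>p. F p * d2t ws))}"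
    by (simp add: image_image eq)
  then show ?thesis by (simp add: d_class_def)
qed

definition Theta1 :: "nat \<Rightarrow> ('n::finite point \<Rightarrow> real) \<Rightarrow> 'n vform" where
  "Theta1 k F = P_op k 1 2 (d_class (Theta0 F))"

text \<open>\<open>Theta1\<close> lives on the bundle of order \<open>2 * k - 1\<close>, which fixes the first argument here.\<close>

definition Theta2 :: "nat \<Rightarrow> ('n::finite point \<Rightarrow> real) \<Rightarrow> 'n vform" where
  "Theta2 k F = P_op (2 * k - 1) 2 1 (vext_d (Theta1 k F))"

section \<open>Global notions\<close>

text \<open>A form on a frame bundle of the manifold is given by its representatives in the charts
  of the atlas.\<close>

definition form_eq_zero ::
  "('e, 'n::finite) chart set \<Rightarrow> (('e, 'n) chart \<Rightarrow> 'n form) \<Rightarrow> bool" where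
  "form_eq_zero A \<omega> \<longleftrightarrow> (\<forall>c\<in>A. \<forall>p\<in>frame_chart_dom c. \<forall>vs. \<omega> c p vs = 0)"

definition fundamental_form ::
  "('e::topological_space, 'n::finite) chart set \<Rightarrow> nat \<Rightarrow> ((real^2 \<Rightarrow> 'e) set \<Rightarrow> real)
     \<Rightarrow> ('e, 'n) chart \<Rightarrow> 'n form" where
  "fundamental_form A k L c = Theta2 k (local_rep A k L c) []"

definition null_lagrangian ::
  "('e::topological_space, 'n::finite) chart set \<Rightarrow> nat \<Rightarrow> ((real^2 \<Rightarrow> 'e) set \<Rightarrow> real) \<Rightarrow> bool" where
  "null_lagrangian A k L \<longleftrightarrow>
     form_eq_zero A (\<lambda>c. euler_lagrange_form k (local_rep A k L c))"

end

theory Submission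
  imports Defs "HOL-Library.Function_Algebras"
begin

text \<open>In a chart all vector fields of the problem are linear in the jet coordinates: the total
derivatives \<open>T\<^sub>j\<close> shift the multi-index, the vertical endomorphisms \<open>S\<^sup>i\<close> are constant, and the
fundamental fields are \<open>\<Delta>\<^sup>K\<^sub>j = S\<^sup>K T\<^sub>j\<close>. For linear maps \<open>A\<close> and \<open>B\<close> the Lie derivatives and
contractions obey commutation rules that only involve the composites \<open>A B\<close> and \<open>B A\<close>, so the
whole calculus follows from \<open>T\<^sub>i T\<^sub>j = T\<^sub>j T\<^sub>i\<close>, \<open>S\<^sup>i S\<^sup>j = S\<^sup>j S\<^sup>i\<close> and
\<open>T\<^sub>j S\<^sup>i - S\<^sup>i T\<^sub>j = \<delta>\<^sup>i\<^sub>j\<close>. On smooth \<open>r\<close>-forms the last relation becomes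
\<open>S\<^sup>i d\<^sub>j - d\<^sub>j S\<^sup>i = r \<delta>\<^sup>i\<^sub>j\<close>. Forms that are set to zero outside the chart domain turn identities
on the domain into equations in a vector space of forms.

This commutator, together with the nilpotency of the \<open>S\<^sup>i\<close>, is enough for two telescoping sums.
Let \<open>P\<close> be the homotopy operator. For an \<open>r\<close>-form \<open>\<phi>\<close> with \<open>r \<ge> 1\<close> the first gives
\<open>P\<^sup>i d\<^sub>i \<phi> = \<phi>\<close>; for \<open>r\<close>-forms \<open>\<phi>\<^sub>1, \<phi>\<^sub>2\<close> with \<open>d\<^sub>1 \<phi>\<^sub>2 = d\<^sub>2 \<phi>\<^sub>1\<close> the second gives
\<open>d\<^sub>j (P\<^sup>i \<phi>\<^sub>i) = \<phi>\<^sub>j\<close> (lemmas \<open>homotopy_0\<close> and \<open>homotopy_1\<close>).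

If \<open>L\<close> is null, then \<open>dL = d\<^sub>i \<theta>\<^sup>i\<close>, hence \<open>d\<^sub>1 (d\<theta>\<^sup>1) + d\<^sub>2 (d\<theta>\<^sup>2) = 0\<close>. Since \<open>\<Theta>\<^sub>2\<close> is
\<open>P\<^sup>2 d\<theta>\<^sup>1 - P\<^sup>1 d\<theta>\<^sup>2\<close>, the second homotopy identity shows that \<open>d\<^sub>1 \<Theta>\<^sub>2 = - d\<theta>\<^sup>2\<close> and
\<open>d\<^sub>2 \<Theta>\<^sub>2 = d\<theta>\<^sup>1\<close>. So \<open>d\<^sub>j d\<Theta>\<^sub>2 = d d\<^sub>j \<Theta>\<^sub>2 = 0\<close>, and \<open>d\<Theta>\<^sub>2 = P\<^sup>j d\<^sub>j d\<Theta>\<^sub>2 = 0\<close> by the first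
(lemma \<open>closed_if_null\<close>).

For the converse, homogeneity gives \<open>\<theta>\<^sup>i(\<Delta>\<^sup>K\<^sub>j) = 0\<close> for \<open>|K| \<ge> 1\<close> and \<open>\<theta>\<^sup>i(T\<^sub>j) = \<delta>\<^sup>i\<^sub>j L\<close>, so
\<open>d\<theta>\<^sup>i\<close> vanishes on a pair \<open>(\<Delta>\<^sup>M\<^sub>1, \<Delta>\<^sup>N\<^sub>2)\<close> as soon as \<open>|M| + |N| \<ge> 2\<close>. Only the terms without
total derivatives survive when \<open>\<Theta>\<^sub>2\<close> is evaluated on \<open>(T\<^sub>1, T\<^sub>2)\<close>, and they add up to \<open>- L\<close>
(lemma \<open>contract2_\<Theta>\<close>). If \<open>d\<Theta>\<^sub>2 = 0\<close>, the Cartan formula and this evaluation write \<open>dL\<close> as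
\<open>d\<^sub>1 \<zeta>\<^sub>2 - d\<^sub>2 \<zeta>\<^sub>1\<close>, where \<open>\<zeta>\<^sub>j\<close> is the contraction of \<open>\<Theta>\<^sub>2\<close> with \<open>T\<^sub>j\<close>. The Euler operator
annihilates images of total derivatives, and it maps \<open>dL\<close> to the Euler-Lagrange form
(lemma \<open>null_if_closed\<close>).\<close>

section \<open>Forms as vectors of a function space\<close>

instantiation "fun" :: (type, real_vector) real_vector
begin

definition "scaleR_fun c f = (\<lambda>x. c *\<^sub>R f x)"

instance
  by standard (simp_all add: scaleR_fun_def fun_eq_iff algebra_simps)

end

lemma scaleR_fun_apply: "(c *\<^sub>R f) x = c *\<^sub>R f x"
  by (simp add: scaleR_fun_def)

lemma sum_fun_apply: "(\<Sum>a\<in>X. f a) x = (\<Sum>a\<in>X. f a x)"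
  for f :: "'b \<Rightarrow> 'c \<Rightarrow> 'd::comm_monoid_add"
  by (induction X rule: infinite_finite_induct) (auto simp: plus_fun_apply)

lemmas fun_apply = plus_fun_apply zero_fun_apply scaleR_fun_apply minus_apply uminus_apply

text \<open>As rewrite rules these equations would eta-expand sums of forms wherever they occur; they are
used only to evaluate an equation at a point.\<close>

declare plus_fun_apply [simp del] zero_fun_apply [simp del] minus_apply [simp del] uminus_apply [simp del]

lemma shift_eq: "shift p v s = p + s *\<^sub>R v"
  by (simp add: shift_def fun_eq_iff fun_apply)

section \<open>Directional derivatives on an open set of points\<close>

text \<open>The derivatives are peeled off from the inside, so that closure under sums and products is
an induction on the order.\<close>

fun diff_on :: "nat \<Rightarrow> 'n::finite point set \<Rightarrow> ('n point \<Rightarrow> real) \<Rightarrow> bool" where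
  "diff_on 0 W f \<longleftrightarrow> continuous_on W f"
| "diff_on (Suc l) W f \<longleftrightarrow> continuous_on W f \<and>
     (\<forall>v. \<forall>p\<in>W. (\<lambda>s. f (shift p v s)) differentiable (at 0)) \<and>
     (\<forall>v. diff_on l W (dir_deriv v f))"

definition smooth_fun :: "'n::finite point set \<Rightarrow> ('n point \<Rightarrow> real) \<Rightarrow> bool" where
  "smooth_fun W f \<longleftrightarrow> (\<forall>l. diff_on l W f)"

lemma diff_on_point_smooth:
  assumes "point_smooth_on W f"
  shows "diff_on l W (foldr dir_deriv vs f)"
proof (induction l arbitrary: vs)
  case 0
  show ?case using assms by (simp add: point_smooth_on_def)
next
  case (Suc l)
  have "diff_on l W (dir_deriv v (foldr dir_deriv vs f))" for v
    using Suc[of "v # vs"] by simp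
  then show ?case using assms by (simp add: point_smooth_on_def)
qed

lemma smooth_fun_point_smooth: "point_smooth_on W f \<Longrightarrow> smooth_fun W f"
  using diff_on_point_smooth[where vs = "[]"] by (auto simp: smooth_fun_def)

locale jet_domain =
  fixes W :: "'n::finite point set"
  assumes open_W: "open W"
begin

lemma continuous_shift: "continuous_on UNIV (\<lambda>s. shift p v s)"
proof (rule continuous_on_coordinatewise_then_product)
  show "continuous_on UNIV (\<lambda>s. shift p v s I)" for I
    unfolding shift_def by (intro continuous_intros)
qed

lemma continuous_shift2: "continuous_on UNIV (\<lambda>z. shift (shift p v (fst z)) w (snd z))"
proof (rule continuous_on_coordinatewise_then_product)
  show "continuous_on UNIV (\<lambda>z. shift (shift p v (fst z)) w (snd z) I)" for I
    unfolding shift_def by (intro continuous_intros)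
qed

lemma eventually_shift:
  assumes "p \<in> W"
  shows "eventually (\<lambda>s. shift p v s \<in> W) (nhds 0)"
proof -
  have "open ((\<lambda>s. shift p v s) -` W)"
    by (rule open_vimage[OF open_W continuous_shift])
  moreover have "0 \<in> (\<lambda>s. shift p v s) -` W" using assms by (simp add: shift_def)
  ultimately show ?thesis
    unfolding eventually_nhds by blast
qed

lemma dir_deriv_cong:
  assumes "\<And>q. q \<in> W \<Longrightarrow> f q = g q" "p \<in> W"
  shows "dir_deriv v f p = dir_deriv v g p"
  unfolding dir_deriv_def
  using eventually_shift[OF assms(2), of v]
  by (intro deriv_cong_ev) (auto elim!: eventually_mono simp: assms(1))

lemma differentiable_shift_cong:
  fixes f g :: "'n point \<Rightarrow> real"
  assumes "\<And>q. q \<in> W \<Longrightarrow> f q = g q" "p \<in> W" "(\<lambda>s. f (shift p v s)) differentiable (at 0)"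
  shows "(\<lambda>s. g (shift p v s)) differentiable (at 0)"
proof -
  obtain D where "((\<lambda>s. f (shift p v s)) has_field_derivative D) (at 0)"
    using assms(3) by (auto simp: real_differentiable_def)
  moreover have "eventually (\<lambda>s. f (shift p v s) = g (shift p v s)) (nhds 0)"
    using eventually_shift[OF assms(2), of v] by (rule eventually_mono) (rule assms(1))
  ultimately have "((\<lambda>s. g (shift p v s)) has_field_derivative D) (at 0)"
    using DERIV_cong_ev[OF refl _ refl] by metis
  then show ?thesis by (auto simp: real_differentiable_def)
qed

lemma diff_on_cong:
  assumes "\<And>q. q \<in> W \<Longrightarrow> f q = g q" "diff_on l W f"
  shows "diff_on l W g"
  using assms
proof (induction l arbitrary: f g)
  case 0
  then show ?case using continuous_on_cong by fastforce
next
  case (Suc l)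
  have "continuous_on W g" using Suc.prems continuous_on_cong[of W W f g] by simp
  moreover have "(\<lambda>s. g (shift p v s)) differentiable (at 0)" if "p \<in> W" for p v
    using differentiable_shift_cong[of f g p v] Suc.prems that by simp
  moreover have "diff_on l W (dir_deriv v g)" for v
    using Suc.IH[of "dir_deriv v f" "dir_deriv v g"] dir_deriv_cong[of f g] Suc.prems by simp
  ultimately show ?case by simp
qed

lemma smooth_fun_cong: "(\<And>q. q \<in> W \<Longrightarrow> f q = g q) \<Longrightarrow> smooth_fun W f \<Longrightarrow> smooth_fun W g"
  unfolding smooth_fun_def using diff_on_cong by blast

lemma smooth_fun_continuous: "smooth_fun W f \<Longrightarrow> continuous_on W f"
  unfolding smooth_fun_def using diff_on.simps(1) by blast

lemma smooth_fun_dir_deriv: "smooth_fun W f \<Longrightarrow> smooth_fun W (dir_deriv v f)"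
  unfolding smooth_fun_def using diff_on.simps(2) by blast

lemma has_dir_deriv_Suc:
  assumes "diff_on (Suc l) W f" "p \<in> W"
  shows "((\<lambda>s. f (shift p v s)) has_field_derivative dir_deriv v f p) (at 0)"
proof -
  have "(\<lambda>s. f (shift p v s)) differentiable (at 0)" using assms by simp
  then show ?thesis unfolding dir_deriv_def
    by (auto simp: real_differentiable_def DERIV_imp_deriv)
qed

lemma has_dir_deriv:
  assumes "smooth_fun W f" "p \<in> W"
  shows "((\<lambda>s. f (shift p v s)) has_field_derivative dir_deriv v f p) (at 0)"
  using assms(1) unfolding smooth_fun_def by (intro has_dir_deriv_Suc[where l = 0] assms(2)) blast

lemma has_dir_deriv_at:
  assumes "smooth_fun W f" "shift p v s0 \<in> W"
  shows "((\<lambda>s. f (shift p v s)) has_field_derivative dir_deriv v f (shift p v s0)) (at s0)"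
proof -
  have *: "shift (shift p v s0) v s = shift p v (s0 + s)" for s
    by (simp add: shift_def fun_eq_iff algebra_simps)
  have "((\<lambda>s. f (shift p v (s0 + s))) has_field_derivative dir_deriv v f (shift p v s0)) (at 0)"
    using has_dir_deriv[OF assms, of v] unfolding * .
  then show ?thesis using DERIV_at_within_shift[of "\<lambda>s. f (shift p v s)" _ s0 0 UNIV]
    by (simp add: add.commute)
qed

lemma dir_derivI:
  "((\<lambda>s. f (shift p v s)) has_field_derivative d) (at 0) \<Longrightarrow> dir_deriv v f p = d"
  unfolding dir_deriv_def by (rule DERIV_imp_deriv)

lemma dir_deriv_add:
  "smooth_fun W f \<Longrightarrow> smooth_fun W g \<Longrightarrow> p \<in> W \<Longrightarrow>
    dir_deriv v (\<lambda>q. f q + g q) p = dir_deriv v f p + dir_deriv v g p"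
  by (intro dir_derivI DERIV_add has_dir_deriv)

lemma dir_deriv_cmult:
  "smooth_fun W f \<Longrightarrow> p \<in> W \<Longrightarrow> dir_deriv v (\<lambda>q. c * f q) p = c * dir_deriv v f p"
  by (intro dir_derivI DERIV_cmult has_dir_deriv)

lemma diff_on_Suc: "diff_on (Suc l) W f \<Longrightarrow> diff_on l W f"
  by (induction l arbitrary: f) auto

lemma diff_on_add: "diff_on l W f \<Longrightarrow> diff_on l W g \<Longrightarrow> diff_on l W (\<lambda>p. f p + g p)"
proof (induction l arbitrary: f g)
  case 0
  then show ?case by (auto intro: continuous_intros)
next
  case (Suc l)
  have der: "((\<lambda>s. f (shift p v s) + g (shift p v s)) has_field_derivative
      dir_deriv v f p + dir_deriv v g p) (at 0)" if "p \<in> W" for p v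
    using Suc.prems that by (intro DERIV_add has_dir_deriv_Suc)
  have "diff_on l W (dir_deriv v (\<lambda>p. f p + g p))" for v
    by (rule diff_on_cong[OF _ Suc.IH[of "dir_deriv v f" "dir_deriv v g"]])
       (use Suc.prems dir_derivI[OF der] in auto)
  then show ?case
    using Suc.prems der by (auto intro: continuous_intros simp: real_differentiable_def)
qed

lemma diff_on_mult: "diff_on l W f \<Longrightarrow> diff_on l W g \<Longrightarrow> diff_on l W (\<lambda>p. f p * g p)"
proof (induction l arbitrary: f g)
  case 0
  then show ?case by (auto intro: continuous_intros)
next
  case (Suc l)
  have der: "((\<lambda>s. f (shift p v s) * g (shift p v s)) has_field_derivative
      dir_deriv v f p * g p + dir_deriv v g p * f p) (at 0)" if "p \<in> W" for p v
    using DERIV_mult[OF has_dir_deriv_Suc[OF Suc.prems(1) that] has_dir_deriv_Suc[OF Suc.prems(2) that], of v]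
    by (simp add: shift_def)
  have fg: "diff_on l W f" "diff_on l W g" using Suc.prems by (auto intro: diff_on_Suc)
  have "diff_on l W (dir_deriv v (\<lambda>p. f p * g p))" for v
    by (rule diff_on_cong[OF _ diff_on_add[OF Suc.IH[of "dir_deriv v f" g] Suc.IH[of "dir_deriv v g" f]]])
       (use Suc.prems fg dir_derivI[OF der] in auto)
  then show ?case
    using Suc.prems der by (auto intro: continuous_intros simp: real_differentiable_def)
qed

lemma diff_on_const: "diff_on l W (\<lambda>p. c)"
  by (induction l arbitrary: c) (auto simp: dir_deriv_def[abs_def])

lemma smooth_fun_add: "smooth_fun W f \<Longrightarrow> smooth_fun W g \<Longrightarrow> smooth_fun W (\<lambda>p. f p + g p)"
  by (simp add: smooth_fun_def diff_on_add)

lemma smooth_fun_mult: "smooth_fun W f \<Longrightarrow> smooth_fun W g \<Longrightarrow> smooth_fun W (\<lambda>p. f p * g p)"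
  by (simp add: smooth_fun_def diff_on_mult)

lemma smooth_fun_const: "smooth_fun W (\<lambda>p. c)"
  by (simp add: smooth_fun_def diff_on_const)

lemma smooth_fun_sum: "(\<And>a. a \<in> X \<Longrightarrow> smooth_fun W (f a)) \<Longrightarrow> smooth_fun W (\<lambda>p. \<Sum>a\<in>X. f a p)"
  by (induction X rule: infinite_finite_induct) (auto intro: smooth_fun_add smooth_fun_const)

lemma dir_deriv_scale_dir:
  assumes "smooth_fun W f" "p \<in> W"
  shows "dir_deriv (c *\<^sub>R v) f p = c * dir_deriv v f p"
proof (rule dir_derivI)
  have "((\<lambda>s. f (shift p v (c * s))) has_field_derivative dir_deriv v f p * c) (at 0)"
    by (rule DERIV_chain2[where f = "\<lambda>x. f (shift p v x)" and g = "\<lambda>s. c * s"])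
       (use has_dir_deriv[OF assms, of v] in \<open>auto intro!: derivative_eq_intros\<close>)
  then show "((\<lambda>s. f (shift p (c *\<^sub>R v) s)) has_field_derivative c * dir_deriv v f p) (at 0)"
    by (simp add: shift_eq mult.commute)
qed

lemma parallelogram:
  assumes "p \<in> W"
  obtains d where "d > 0" "\<And>s t. \<bar>s\<bar> < d \<Longrightarrow> \<bar>t\<bar> < d \<Longrightarrow> shift (shift p v s) w t \<in> W"
proof -
  have "open ((\<lambda>z. shift (shift p v (fst z)) w (snd z)) -` W)"
    by (rule open_vimage[OF open_W continuous_shift2])
  moreover have "(0, 0) \<in> (\<lambda>z. shift (shift p v (fst z)) w (snd z)) -` W"
    using assms by (simp add: shift_def)
  ultimately obtain e where e: "e > 0"
    "\<And>z. dist z (0, 0) < e \<Longrightarrow> z \<in> (\<lambda>z. shift (shift p v (fst z)) w (snd z)) -` W"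
    unfolding open_dist by blast
  show ?thesis
  proof (rule that[of "e / 2"])
    fix s t :: real assume "\<bar>s\<bar> < e / 2" "\<bar>t\<bar> < e / 2"
    moreover have "dist (s, t) (0, 0) \<le> \<bar>s\<bar> + \<bar>t\<bar>"
      by (simp add: dist_Pair_Pair sqrt_sum_squares_le_sum_abs)
    ultimately have "dist (s, t) (0, 0) < e" by linarith
    from e(2)[OF this] show "shift (shift p v s) w t \<in> W" by simp
  qed (use e in simp)
qed

lemma continuous_parallelogram:
  assumes "smooth_fun W f" "p \<in> W"
    and "\<And>h. 0 < h \<Longrightarrow> h < d \<Longrightarrow> \<bar>a h\<bar> \<le> h \<and> \<bar>b h\<bar> \<le> h" "d > 0"
  shows "((\<lambda>h. f (shift (shift p v (a h)) w (b h))) \<longlongrightarrow> f p) (at_right 0)"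
proof -
  let ?g = "\<lambda>z. shift (shift p v (fst z)) w (snd z)"
  have ev: "eventually (\<lambda>h. \<bar>a h\<bar> \<le> h \<and> \<bar>b h\<bar> \<le> h) (at_right 0)"
    using eventually_at_right_real[OF assms(4)] by (rule eventually_mono) (simp add: assms(3))
  have id0: "((\<lambda>h::real. h) \<longlongrightarrow> 0) (at_right 0)" by (rule tendsto_ident_at)
  have "(a \<longlongrightarrow> 0) (at_right 0)"
    by (rule Lim_null_comparison[OF _ id0]) (use ev in \<open>auto elim: eventually_mono\<close>)
  moreover have "(b \<longlongrightarrow> 0) (at_right 0)"
    by (rule Lim_null_comparison[OF _ id0]) (use ev in \<open>auto elim: eventually_mono\<close>)
  ultimately have lim: "((\<lambda>h. (a h, b h)) \<longlongrightarrow> (0, 0)) (at_right 0)" by (rule tendsto_Pair)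
  have "isCont ?g (0, 0)" using continuous_shift2[of p v w] by (simp add: continuous_on_eq_continuous_at)
  then have "((\<lambda>h. ?g (a h, b h)) \<longlongrightarrow> ?g (0, 0)) (at_right 0)"
    by (rule isCont_tendsto_compose[OF _ lim])
  moreover have "isCont f p"
    using smooth_fun_continuous[OF assms(1)] assms(2) open_W
    by (simp add: continuous_on_eq_continuous_at)
  moreover have "?g (0, 0) = p" by (simp add: shift_def)
  ultimately show ?thesis using isCont_tendsto_compose[of p f "\<lambda>h. ?g (a h, b h)" "at_right 0"] by simp
qed

text \<open>Additivity in the direction is first order calculus along the two sides of a small
parallelogram: by the mean value theorem the second side contributes a value of
\<^term>\<open>dir_deriv w f\<close> at a point that tends to \<open>p\<close>.\<close>

lemma dir_deriv_add_dir:
  assumes f: "smooth_fun W f" and p: "p \<in> W"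
  shows "dir_deriv (v + w) f p = dir_deriv v f p + dir_deriv w f p"
proof -
  obtain d where d: "d > 0" "\<And>s t. \<bar>s\<bar> < d \<Longrightarrow> \<bar>t\<bar> < d \<Longrightarrow> shift (shift p v s) w t \<in> W"
    using parallelogram[OF p] by metis
  have "\<exists>t. \<bar>t\<bar> \<le> h \<and> (f (shift (shift p v h) w h) - f (shift p v h)) / h
      = dir_deriv w f (shift (shift p v h) w t)" if h: "0 < h" "h < d" for h
  proof -
    have "\<exists>t. 0 < t \<and> t < h \<and> f (shift (shift p v h) w h) - f (shift (shift p v h) w 0)
        = (h - 0) * dir_deriv w f (shift (shift p v h) w t)"
      by (rule MVT2) (use h d(2) in \<open>auto intro!: has_dir_deriv_at f\<close>)
    then show ?thesis using h by (force simp: shift_def)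
  qed
  then obtain b where b: "\<And>h. 0 < h \<Longrightarrow> h < d \<Longrightarrow> \<bar>b h\<bar> \<le> h \<and>
      (f (shift (shift p v h) w h) - f (shift p v h)) / h = dir_deriv w f (shift (shift p v h) w (b h))"
    by metis
  have "((\<lambda>h. dir_deriv w f (shift (shift p v h) w (b h))) \<longlongrightarrow> dir_deriv w f p) (at_right 0)"
    by (rule continuous_parallelogram[where d = d]) (use f p b d in \<open>auto simp: smooth_fun_dir_deriv\<close>)
  moreover have "eventually (\<lambda>h. dir_deriv w f (shift (shift p v h) w (b h))
      = (f (shift (shift p v h) w h) - f (shift p v h)) / h) (at_right 0)"
    using eventually_at_right_real[OF d(1)] by (rule eventually_mono) (simp add: b)
  ultimately have l1: "((\<lambda>h. (f (shift (shift p v h) w h) - f (shift p v h)) / h)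
      \<longlongrightarrow> dir_deriv w f p) (at_right 0)"
    by (rule Lim_transform_eventually)
  have quot: "((\<lambda>h. (f (shift p u h) - f p) / h) \<longlongrightarrow> dir_deriv u f p) (at_right 0)" for u
    using has_dir_deriv[OF f p, of u]
    by (auto simp: has_field_derivative_iff shift_def intro: filterlim_mono at_le)
  have "((\<lambda>h. (f (shift (shift p v h) w h) - f (shift p v h)) / h + (f (shift p v h) - f p) / h)
      \<longlongrightarrow> dir_deriv w f p + dir_deriv v f p) (at_right 0)"
    by (intro tendsto_add l1 quot)
  moreover have "(\<lambda>h. (f (shift (shift p v h) w h) - f (shift p v h)) / h + (f (shift p v h) - f p) / h)
      = (\<lambda>h. (f (shift p (v + w) h) - f p) / h)"
    by (rule ext) (simp add: shift_eq algebra_simps flip: add_divide_distrib)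
  ultimately have "((\<lambda>h. (f (shift p (v + w) h) - f p) / h)
      \<longlongrightarrow> dir_deriv w f p + dir_deriv v f p) (at_right 0)" by simp
  from tendsto_unique[OF _ this quot] show ?thesis by simp
qed

text \<open>Two applications of the mean value theorem to the second difference of \<open>f\<close> over a
parallelogram. The second difference is symmetric in the two sides, which yields the symmetry
of second derivatives.\<close>

lemma mixed_difference:
  assumes f: "smooth_fun W f" and h: "0 < h" "h < d"
    and d: "\<And>s t. \<bar>s\<bar> < d \<Longrightarrow> \<bar>t\<bar> < d \<Longrightarrow> shift (shift p v s) w t \<in> W"
  shows "\<exists>s t. \<bar>s\<bar> \<le> h \<and> \<bar>t\<bar> \<le> h \<and>
    f (shift (shift p v h) w h) - f (shift p w h) - f (shift p v h) + f p
      = h * h * dir_deriv w (dir_deriv v f) (shift (shift p v s) w t)"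
proof -
  have sw: "shift (shift p v s) w t = shift (shift p w t) v s" for s t
    by (simp add: shift_def fun_eq_iff algebra_simps)
  have sh0 [simp]: "shift q u 0 = q" for q u :: "'n point" by (simp add: shift_def)
  have der: "((\<lambda>s. f (shift (shift p v s) w t)) has_field_derivative
      dir_deriv v f (shift (shift p v s) w t)) (at s)" if "\<bar>s\<bar> < d" "\<bar>t\<bar> < d" for s t
    unfolding sw by (rule has_dir_deriv_at[OF f]) (use d[OF that] sw in auto)
  have "\<exists>s. 0 < s \<and> s < h \<and>
      (f (shift (shift p v h) w h) - f (shift (shift p v h) w 0))
       - (f (shift (shift p v 0) w h) - f (shift (shift p v 0) w 0))
      = (h - 0) * (dir_deriv v f (shift (shift p v s) w h) - dir_deriv v f (shift (shift p v s) w 0))"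
    by (rule MVT2[of 0 h "\<lambda>s. f (shift (shift p v s) w h) - f (shift (shift p v s) w 0)"])
       (use h in \<open>auto intro!: DERIV_diff der simp del: sh0\<close>)
  then obtain s where s: "0 < s" "s < h"
    "f (shift (shift p v h) w h) - f (shift p w h) - f (shift p v h) + f p
      = h * (dir_deriv v f (shift (shift p v s) w h) - dir_deriv v f (shift (shift p v s) w 0))"
    by (auto simp: algebra_simps)
  have "\<exists>t. 0 < t \<and> t < h \<and>
      dir_deriv v f (shift (shift p v s) w h) - dir_deriv v f (shift (shift p v s) w 0)
      = (h - 0) * dir_deriv w (dir_deriv v f) (shift (shift p v s) w t)"
    by (rule MVT2) (use h s d in \<open>auto intro!: has_dir_deriv_at smooth_fun_dir_deriv f\<close>)
  then obtain t where "0 < t" "t < h"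
      "dir_deriv v f (shift (shift p v s) w h) - dir_deriv v f (shift (shift p v s) w 0)
      = h * dir_deriv w (dir_deriv v f) (shift (shift p v s) w t)" by auto
  then show ?thesis using s by (intro exI[of _ s] exI[of _ t]) simp
qed

lemma dir_deriv_commute:
  assumes f: "smooth_fun W f" and p: "p \<in> W"
  shows "dir_deriv v (dir_deriv w f) p = dir_deriv w (dir_deriv v f) p"
proof -
  have lim: "((\<lambda>h. (f (shift (shift p v h) w h) - f (shift p w h) - f (shift p v h) + f p) / (h * h))
      \<longlongrightarrow> dir_deriv w (dir_deriv v f) p) (at_right 0)" for v w
  proof -
    obtain d where d: "d > 0" "\<And>s t. \<bar>s\<bar> < d \<Longrightarrow> \<bar>t\<bar> < d \<Longrightarrow> shift (shift p v s) w t \<in> W"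
      using parallelogram[OF p] by metis
    have "\<exists>s t. \<bar>s\<bar> \<le> h \<and> \<bar>t\<bar> \<le> h \<and>
        (f (shift (shift p v h) w h) - f (shift p w h) - f (shift p v h) + f p) / (h * h)
        = dir_deriv w (dir_deriv v f) (shift (shift p v s) w t)" if "0 < h" "h < d" for h
      using mixed_difference[OF f that d(2)] that by (auto simp: field_simps)
    then obtain a b where ab: "\<And>h. 0 < h \<Longrightarrow> h < d \<Longrightarrow> \<bar>a h\<bar> \<le> h \<and> \<bar>b h\<bar> \<le> h \<and>
        (f (shift (shift p v h) w h) - f (shift p w h) - f (shift p v h) + f p) / (h * h)
        = dir_deriv w (dir_deriv v f) (shift (shift p v (a h)) w (b h))"
      by metis
    have "((\<lambda>h. dir_deriv w (dir_deriv v f) (shift (shift p v (a h)) w (b h)))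
        \<longlongrightarrow> dir_deriv w (dir_deriv v f) p) (at_right 0)"
      by (rule continuous_parallelogram[where d = d])
         (use f p ab d in \<open>auto simp: smooth_fun_dir_deriv\<close>)
    moreover have "eventually (\<lambda>h. dir_deriv w (dir_deriv v f) (shift (shift p v (a h)) w (b h))
        = (f (shift (shift p v h) w h) - f (shift p w h) - f (shift p v h) + f p) / (h * h)) (at_right 0)"
      using eventually_at_right_real[OF d(1)] by (rule eventually_mono) (simp add: ab)
    ultimately show ?thesis by (rule Lim_transform_eventually)
  qed
  have "(\<lambda>h. (f (shift (shift p v h) w h) - f (shift p w h) - f (shift p v h) + f p) / (h * h))
      = (\<lambda>h. (f (shift (shift p w h) v h) - f (shift p v h) - f (shift p w h) + f p) / (h * h))"
    by (rule ext) (simp add: shift_eq algebra_simps)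
  with tendsto_unique[OF _ lim[of v w]] lim[of w v] show ?thesis by simp
qed

end

section \<open>Smooth forms and their exterior derivative\<close>

text \<open>Equality of jets of order \<open>N\<close>.\<close>

definition agree :: "nat \<Rightarrow> 'n::finite point \<Rightarrow> 'n point \<Rightarrow> bool" where
  "agree N p q \<longleftrightarrow> (\<forall>I. mlen I \<le> N \<longrightarrow> p I = q I)"

text \<open>Contraction with a constant vector field. The exterior derivative, the Lie derivatives and
the vertical contractions all satisfy a recursion of the shape
\<open>op \<phi> p (x # vs) = \<dots> \<plusminus> op (insert_vec x \<phi>) p vs\<close>, and identities between them are proved by
induction on the list of arguments with the help of these recursions.\<close>

definition insert_vec :: "'n::finite point \<Rightarrow> 'n form \<Rightarrow> 'n form" where
  "insert_vec x \<phi> = (\<lambda>p vs. \<phi> p (x # vs))"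

lemma insert_vec_simps [simp]:
  "insert_vec x (\<phi> + \<psi>) = insert_vec x \<phi> + insert_vec x \<psi>"
  "insert_vec x (c *\<^sub>R \<phi>) = c *\<^sub>R insert_vec x \<phi>"
  "insert_vec x 0 = 0"
  by (simp_all add: insert_vec_def fun_eq_iff fun_apply)

text \<open>Linear maps that lower the order of jets by at most \<open>e\<close>: a function of the \<open>N\<close>-jet of
\<open>A p\<close> is a function of the \<open>(N + e)\<close>-jet of \<open>p\<close>.\<close>

definition jet_map :: "nat \<Rightarrow> ('n::finite point \<Rightarrow> 'n point) \<Rightarrow> bool" where
  "jet_map e A \<longleftrightarrow> linear A \<and> continuous_on UNIV A \<and>
     (\<forall>N p q. agree (N + e) p q \<longrightarrow> agree N (A p) (A q))"

lemma mlen_eq: "mlen I = I $ 1 + I $ 2"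
  by (simp add: mlen_def sum_2)

lemma finite_mlen_le [simp]: "finite {I. mlen I \<le> N}"
proof (rule finite_subset)
  show "{I. mlen I \<le> N} \<subseteq> (\<lambda>(a, b). \<chi> i. if i = 1 then a else b) ` ({..N} \<times> {..N})"
  proof
    fix I :: "nat^2" assume "I \<in> {I. mlen I \<le> N}"
    then have "(I $ 1, I $ 2) \<in> {..N} \<times> {..N}" by (simp add: mlen_eq)
    moreover have "I = (\<lambda>(a, b). \<chi> i. if i = 1 then a else b) (I $ 1, I $ 2)"
      by (simp add: vec_eq_iff forall_2)
    ultimately show "I \<in> (\<lambda>(a, b). \<chi> i. if i = 1 then a else b) ` ({..N} \<times> {..N})" by blast
  qed
qed simp

lemma ext_d_Nil [simp]: "ext_d \<phi> p [] = 0"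
  by (simp add: ext_d_def)

lemma ext_d_Cons:
  "ext_d \<phi> p (x # vs) = dir_deriv x (\<lambda>q. \<phi> q vs) p - ext_d (insert_vec x \<phi>) p vs"
  by (simp add: ext_d_def insert_vec_def sum.lessThan_Suc_shift sum_negf del: sum.lessThan_Suc)

lemma vert_contract_Nil [simp]: "vert_contract i \<phi> p [] = 0"
  by (simp add: vert_contract_def)

lemma vert_contract_Cons:
  "vert_contract i \<phi> p (x # vs) = \<phi> p (vert_endo i x # vs) + vert_contract i (insert_vec x \<phi>) p vs"
  by (simp add: vert_contract_def insert_vec_def sum.lessThan_Suc_shift del: sum.lessThan_Suc)

lemma insert_vec_vert_contract:
  "insert_vec x (vert_contract i \<phi>)
     = insert_vec (vert_endo i x) \<phi> + vert_contract i (insert_vec x \<phi>)"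
  by (simp add: fun_eq_iff fun_apply insert_vec_def[of x "vert_contract i \<phi>"] insert_vec_def[of "vert_endo i x"] vert_contract_Cons)

lemma vert_contract_add: "vert_contract i (\<phi> + \<psi>) = vert_contract i \<phi> + vert_contract i \<psi>"
  by (simp add: fun_eq_iff fun_apply vert_contract_def sum.distrib)

lemma vert_contract_scale: "vert_contract i (c *\<^sub>R \<phi>) = c *\<^sub>R vert_contract i \<phi>"
  by (simp add: fun_eq_iff fun_apply vert_contract_def sum_distrib_left)

lemma contract_add: "contract A (\<phi> + \<psi>) = contract A \<phi> + contract A \<psi>"
  by (simp add: fun_eq_iff fun_apply contract_def)

lemma contract_scale: "contract A (c *\<^sub>R \<phi>) = c *\<^sub>R contract A \<phi>"
  by (simp add: fun_eq_iff fun_apply contract_def)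

context jet_domain
begin

text \<open>Smooth forms of order \<open>N\<close>, of mixed degree, extended by zero outside \<open>W\<close>. The condition on
a slot combines additivity and homogeneity; exchanging neighbours generates all permutations.\<close>

definition form :: "nat \<Rightarrow> 'n form \<Rightarrow> bool" where
  "form N \<phi> \<longleftrightarrow>
     (\<forall>p vs. p \<notin> W \<longrightarrow> \<phi> p vs = 0) \<and>
     (\<forall>vs. smooth_fun W (\<lambda>p. \<phi> p vs)) \<and>
     (\<forall>p q vs ws. p \<in> W \<longrightarrow> q \<in> W \<longrightarrow> agree N p q \<longrightarrow> list_all2 (agree N) vs ws \<longrightarrow> \<phi> p vs = \<phi> q ws) \<and>
     (\<forall>p us x y c vs. \<phi> p (us @ (x + c *\<^sub>R y) # vs) = \<phi> p (us @ x # vs) + c * \<phi> p (us @ y # vs)) \<and>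
     (\<forall>p us x y vs. \<phi> p (us @ x # y # vs) = - \<phi> p (us @ y # x # vs))"

lemma form_outside: "form N \<phi> \<Longrightarrow> p \<notin> W \<Longrightarrow> \<phi> p vs = 0"
  and form_smooth: "form N \<phi> \<Longrightarrow> smooth_fun W (\<lambda>p. \<phi> p vs)"
  and form_agree: "form N \<phi> \<Longrightarrow> p \<in> W \<Longrightarrow> q \<in> W \<Longrightarrow> agree N p q \<Longrightarrow> list_all2 (agree N) vs ws
     \<Longrightarrow> \<phi> p vs = \<phi> q ws"
  and form_slot: "form N \<phi> \<Longrightarrow> \<phi> p (us @ (x + c *\<^sub>R y) # vs) = \<phi> p (us @ x # vs) + c * \<phi> p (us @ y # vs)"
  and form_swap: "form N \<phi> \<Longrightarrow> \<phi> p (us @ x # y # vs) = - \<phi> p (us @ y # x # vs)"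
  unfolding form_def by blast+

lemma form_slot1: "form N \<phi> \<Longrightarrow> \<phi> p ((x + c *\<^sub>R y) # vs) = \<phi> p (x # vs) + c * \<phi> p (y # vs)"
  using form_slot[where us = "[]"] by simp

lemma form_slot1_add: "form N \<phi> \<Longrightarrow> \<phi> p ((x + y) # vs) = \<phi> p (x # vs) + \<phi> p (y # vs)"
  using form_slot1[where c = 1] by simp

lemma form_slot_zero: "form N \<phi> \<Longrightarrow> \<phi> p (us @ 0 # vs) = 0"
  using form_slot[of N \<phi> p us 0 1 0 vs] by simp

lemma form_swap1: "form N \<phi> \<Longrightarrow> \<phi> p (x # y # vs) = - \<phi> p (y # x # vs)"
  using form_swap[where us = "[]"] by simp

lemma form_slot1_sum:
  assumes "form N \<phi>"
  shows "\<phi> p ((\<Sum>a\<in>X. c a *\<^sub>R y a) # vs) = (\<Sum>a\<in>X. c a * \<phi> p (y a # vs))"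
proof (induction X rule: infinite_finite_induct)
  case (insert a X)
  have "\<phi> p ((\<Sum>a\<in>insert a X. c a *\<^sub>R y a) # vs)
      = \<phi> p (((\<Sum>a\<in>X. c a *\<^sub>R y a) + c a *\<^sub>R y a) # vs)"
    unfolding sum.insert[OF insert.hyps] by (subst add.commute) (rule refl)
  then show ?case
    unfolding form_slot1[OF assms] sum.insert[OF insert.hyps] insert.IH by (simp only: add.commute)
qed (use form_slot_zero[OF assms, of p "[]"] in simp_all)

lemma agree_refl [simp]: "agree N p p"
  by (simp add: agree_def)

lemma agree_list_refl [simp]: "list_all2 (agree N) vs vs"
  by (simp add: list_all2_refl)

lemma agree_mono: "agree N p q \<Longrightarrow> M \<le> N \<Longrightarrow> agree M p q"
  by (auto simp: agree_def)

lemma formI: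
  assumes "\<And>p vs. p \<notin> W \<Longrightarrow> \<phi> p vs = 0"
    and "\<And>vs. smooth_fun W (\<lambda>p. \<phi> p vs)"
    and "\<And>p q vs ws. p \<in> W \<Longrightarrow> q \<in> W \<Longrightarrow> agree N p q \<Longrightarrow> list_all2 (agree N) vs ws \<Longrightarrow> \<phi> p vs = \<phi> q ws"
    and "\<And>p us x y c vs. \<phi> p (us @ (x + c *\<^sub>R y) # vs) = \<phi> p (us @ x # vs) + c * \<phi> p (us @ y # vs)"
    and "\<And>p us x y vs. \<phi> p (us @ x # y # vs) = - \<phi> p (us @ y # x # vs)"
  shows "form N \<phi>"
  unfolding form_def by (intro conjI allI impI assms)

lemma form_mono:
  assumes "form M \<phi>" "M \<le> N"
  shows "form N \<phi>"
proof (rule formI)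
  show "\<phi> p vs = \<phi> q ws" if "p \<in> W" "q \<in> W" "agree N p q" "list_all2 (agree N) vs ws" for p q vs ws
  proof (rule form_agree[OF assms(1) that(1,2)])
    show "agree M p q" using that(3) assms(2) by (rule agree_mono)
    show "list_all2 (agree M) vs ws" using that(4) by (rule list_all2_mono) (rule agree_mono[OF _ assms(2)])
  qed
qed (rule form_outside[OF assms(1)] form_smooth[OF assms(1)] form_slot[OF assms(1)] form_swap[OF assms(1)]; assumption?)+

lemma form_insert_vec:
  assumes "form N \<phi>"
  shows "form N (insert_vec x \<phi>)"
proof (rule formI)
  show "insert_vec x \<phi> p vs = insert_vec x \<phi> q ws"
    if "p \<in> W" "q \<in> W" "agree N p q" "list_all2 (agree N) vs ws" for p q vs ws
    using form_agree[OF assms that(1-3), of "x # vs" "x # ws"] that(4) by (simp add: insert_vec_def)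
  show "insert_vec x \<phi> p (us @ y # z # vs) = - insert_vec x \<phi> p (us @ z # y # vs)" for p us y z vs
    using form_swap[OF assms, of p "x # us" y z vs] by (simp add: insert_vec_def)
  show "insert_vec x \<phi> p (us @ (y + c *\<^sub>R z) # vs)
      = insert_vec x \<phi> p (us @ y # vs) + c * insert_vec x \<phi> p (us @ z # vs)" for p us y c z vs
    using form_slot[OF assms, of p "x # us" y c z vs] by (simp add: insert_vec_def)
qed (simp_all add: insert_vec_def form_outside[OF assms] form_smooth[OF assms])

lemma form_zero: "form N 0"
  by (simp add: form_def smooth_fun_const zero_fun_apply)

lemma form_add:
  assumes "form N \<phi>" "form N \<psi>"
  shows "form N (\<phi> + \<psi>)"
proof (rule formI)
  show "(\<phi> + \<psi>) p vs = (\<phi> + \<psi>) q ws"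
    if "p \<in> W" "q \<in> W" "agree N p q" "list_all2 (agree N) vs ws" for p q vs ws
    using form_agree[OF assms(1) that] form_agree[OF assms(2) that] by (simp add: fun_apply)
  show "(\<phi> + \<psi>) p (us @ x # y # vs) = - (\<phi> + \<psi>) p (us @ y # x # vs)" for p us x y vs
    using form_swap[OF assms(1), of p us x y vs] form_swap[OF assms(2), of p us x y vs] by (simp add: fun_apply)
qed (simp_all add: fun_apply form_outside[OF assms(1)] form_outside[OF assms(2)] form_smooth[OF assms(1)]
    form_smooth[OF assms(2)] smooth_fun_add form_slot[OF assms(1)] form_slot[OF assms(2)] distrib_left)

lemma form_scale:
  assumes "form N \<phi>"
  shows "form N (c *\<^sub>R \<phi>)"
proof (rule formI)
  show "(c *\<^sub>R \<phi>) p vs = (c *\<^sub>R \<phi>) q ws"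
    if "p \<in> W" "q \<in> W" "agree N p q" "list_all2 (agree N) vs ws" for p q vs ws
    using form_agree[OF assms that] by (simp add: fun_apply)
  show "(c *\<^sub>R \<phi>) p (us @ x # y # vs) = - (c *\<^sub>R \<phi>) p (us @ y # x # vs)" for p us x y vs
    using form_swap[OF assms, of p us x y vs] by (simp add: fun_apply)
qed (simp_all add: fun_apply form_outside[OF assms] form_smooth[OF assms] smooth_fun_mult smooth_fun_const
    form_slot[OF assms] distrib_left)

definition dirD :: "'n point \<Rightarrow> 'n form \<Rightarrow> 'n form" where
  "dirD x \<phi> = (\<lambda>p vs. if p \<in> W then dir_deriv x (\<lambda>q. \<phi> q vs) p else 0)"

lemma dirD_add: "form N \<phi> \<Longrightarrow> form M \<psi> \<Longrightarrow> dirD x (\<phi> + \<psi>) = dirD x \<phi> + dirD x \<psi>"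
  by (simp add: fun_eq_iff fun_apply dirD_def dir_deriv_add form_smooth)

lemma dirD_scale: "form N \<phi> \<Longrightarrow> dirD x (c *\<^sub>R \<phi>) = c *\<^sub>R dirD x \<phi>"
  by (simp add: fun_eq_iff fun_apply dirD_def dir_deriv_cmult form_smooth)

lemma dirD_diff:
  assumes "form N \<phi>" "form M \<psi>"
  shows "dirD x (\<phi> - \<psi>) = dirD x \<phi> - dirD x \<psi>"
  using dirD_add[OF assms(1) form_scale[OF assms(2), of "-1"], of x]
  unfolding dirD_scale[OF assms(2)] by simp

lemma insert_vec_dirD: "insert_vec y (dirD x \<phi>) = dirD x (insert_vec y \<phi>)"
  by (simp add: fun_eq_iff fun_apply dirD_def insert_vec_def)

lemma dirD_dir: "form N \<phi> \<Longrightarrow> dirD (x + c *\<^sub>R y) \<phi> = dirD x \<phi> + c *\<^sub>R dirD y \<phi>"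
  by (simp add: fun_eq_iff fun_apply dirD_def dir_deriv_add_dir dir_deriv_scale_dir form_smooth)

lemma dirD_commute: "form N \<phi> \<Longrightarrow> dirD x (dirD y \<phi>) = dirD y (dirD x \<phi>)"
proof -
  assume f: "form N \<phi>"
  have "dir_deriv x (\<lambda>q. if q \<in> W then dir_deriv y (\<lambda>q. \<phi> q vs) q else 0) p
      = dir_deriv x (dir_deriv y (\<lambda>q. \<phi> q vs)) p" if "p \<in> W" for x y p vs
    by (rule dir_deriv_cong) (use that in auto)
  then show ?thesis
    by (simp add: fun_eq_iff fun_apply dirD_def dir_deriv_commute form_smooth[OF f])
qed

lemma smooth_cut: "smooth_fun W f \<Longrightarrow> smooth_fun W (\<lambda>p. if p \<in> W then f p else 0)"
  by (rule smooth_fun_cong[of f]) auto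

lemma dirD_agree:
  assumes f: "form N \<phi>" and "p \<in> W" "q \<in> W" "agree N p q" "list_all2 (agree N) vs ws" "agree N x y"
  shows "dirD x \<phi> p vs = dirD y \<phi> q ws"
proof -
  have "dir_deriv x (\<lambda>q. \<phi> q vs) p = dir_deriv y (\<lambda>q. \<phi> q ws) q"
    unfolding dir_deriv_def
  proof (rule deriv_cong_ev)
    have "eventually (\<lambda>s. shift p x s \<in> W \<and> shift q y s \<in> W) (nhds 0)"
      by (intro eventually_conj eventually_shift assms)
    then show "\<forall>\<^sub>F s in nhds 0. \<phi> (shift p x s) vs = \<phi> (shift q y s) ws"
    proof (rule eventually_mono)
      fix s assume "shift p x s \<in> W \<and> shift q y s \<in> W"
      moreover have "agree N (shift p x s) (shift q y s)"
        using assms by (simp add: agree_def shift_def)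
      ultimately show "\<phi> (shift p x s) vs = \<phi> (shift q y s) ws"
        using form_agree[OF f] assms(5) by blast
    qed
  qed (simp add: fun_apply)
  then show ?thesis using assms by (simp add: dirD_def)
qed

lemma form_dirD:
  assumes f: "form N \<phi>"
  shows "form N (dirD x \<phi>)"
proof (rule formI)
  show "smooth_fun W (\<lambda>p. dirD x \<phi> p vs)" for vs
    unfolding dirD_def by (intro smooth_cut smooth_fun_dir_deriv form_smooth[OF f])
  show "dirD x \<phi> p (us @ (y + c *\<^sub>R z) # vs) = dirD x \<phi> p (us @ y # vs) + c * dirD x \<phi> p (us @ z # vs)"
    for p us y c z vs
    using form_smooth[OF f]
    by (simp add: dirD_def form_slot[OF f] dir_deriv_add dir_deriv_cmult smooth_fun_mult smooth_fun_const)
  show "dirD x \<phi> p (us @ y # z # vs) = - dirD x \<phi> p (us @ z # y # vs)" for p us y z vs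
  proof -
    have "dir_deriv x (\<lambda>q. \<phi> q (us @ y # z # vs)) p = - dir_deriv x (\<lambda>q. \<phi> q (us @ z # y # vs)) p"
      if "p \<in> W"
      unfolding form_swap[OF f, of _ us y z]
      using dir_deriv_cmult[OF form_smooth[OF f] that, of x "-1" "us @ z # y # vs"] by simp
    then show ?thesis by (simp add: dirD_def)
  qed
  show "dirD x \<phi> p vs = dirD x \<phi> q ws"
    if "p \<in> W" "q \<in> W" "agree N p q" "list_all2 (agree N) vs ws" for p q vs ws
    using that by (rule dirD_agree[OF f]) simp
qed (simp add: dirD_def)

definition ext_deriv :: "'n form \<Rightarrow> 'n form" where
  "ext_deriv \<phi> = (\<lambda>p vs. if p \<in> W then ext_d \<phi> p vs else 0)"

lemma ext_deriv_Nil [simp]: "ext_deriv \<phi> p [] = 0"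
  by (simp add: ext_deriv_def)

lemma ext_deriv_Cons: "ext_deriv \<phi> p (x # vs) = dirD x \<phi> p vs - ext_deriv (insert_vec x \<phi>) p vs"
  by (simp add: ext_deriv_def dirD_def ext_d_Cons)

lemma insert_vec_ext_deriv: "insert_vec x (ext_deriv \<phi>) = dirD x \<phi> - ext_deriv (insert_vec x \<phi>)"
  by (simp add: fun_eq_iff fun_apply insert_vec_def[of x "ext_deriv \<phi>"] ext_deriv_Cons)

lemma ext_deriv_add:
  assumes "form N \<phi>" "form M \<psi>"
  shows "ext_deriv (\<phi> + \<psi>) = ext_deriv \<phi> + ext_deriv \<psi>"
proof -
  have "ext_deriv (\<phi> + \<psi>) p vs = ext_deriv \<phi> p vs + ext_deriv \<psi> p vs" for p vs
    using assms
  proof (induction vs arbitrary: \<phi> \<psi>)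
    case (Cons x vs)
    show ?case using Cons.prems Cons.IH[OF Cons.prems[THEN form_insert_vec]]
      by (simp add: ext_deriv_Cons dirD_add) (simp add: fun_apply)
  qed (simp add: fun_apply)
  then show ?thesis by (simp add: fun_eq_iff fun_apply)
qed

lemma ext_deriv_scale:
  assumes "form N \<phi>"
  shows "ext_deriv (c *\<^sub>R \<phi>) = c *\<^sub>R ext_deriv \<phi>"
proof -
  have "ext_deriv (c *\<^sub>R \<phi>) p vs = c * ext_deriv \<phi> p vs" for p vs
    using assms
  proof (induction vs arbitrary: \<phi>)
    case (Cons x vs)
    show ?case using Cons.prems Cons.IH[OF Cons.prems[THEN form_insert_vec]]
      by (simp add: ext_deriv_Cons dirD_scale) (simp add: fun_apply right_diff_distrib)
  qed (simp add: fun_apply)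
  then show ?thesis by (simp add: fun_eq_iff fun_apply)
qed

lemma ext_deriv_diff:
  assumes "form N \<phi>" "form M \<psi>"
  shows "ext_deriv (\<phi> - \<psi>) = ext_deriv \<phi> - ext_deriv \<psi>"
  using ext_deriv_add[OF assms(1) form_scale[OF assms(2), of "-1"]]
  unfolding ext_deriv_scale[OF assms(2)] by simp

lemma ext_deriv_minus: "form N \<phi> \<Longrightarrow> ext_deriv (- \<phi>) = - ext_deriv \<phi>"
  using ext_deriv_scale[of N \<phi> "-1"] by simp

lemma insert_vec_agree:
  assumes "form N \<phi>" "agree N x y"
  shows "insert_vec x \<phi> = insert_vec y \<phi>"
proof (intro ext)
  fix p vs show "insert_vec x \<phi> p vs = insert_vec y \<phi> p vs"
    using form_agree[OF assms(1), of p p "x # vs" "y # vs"] assms(2) form_outside[OF assms(1)]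
    by (cases "p \<in> W") (simp_all add: insert_vec_def)
qed

lemma insert_vec_slot: "form N \<phi> \<Longrightarrow> insert_vec (x + c *\<^sub>R y) \<phi> = insert_vec x \<phi> + c *\<^sub>R insert_vec y \<phi>"
  by (simp add: fun_eq_iff fun_apply insert_vec_def form_slot1)

lemma insert_vec_swap: "form N \<phi> \<Longrightarrow> insert_vec x (insert_vec y \<phi>) = - insert_vec y (insert_vec x \<phi>)"
  by (simp add: fun_eq_iff fun_apply insert_vec_def form_swap1[of N \<phi> _ x y])

lemma form_ext_deriv:
  assumes "form N \<phi>"
  shows "form N (ext_deriv \<phi>)"
proof (rule formI)
  show "ext_deriv \<phi> p vs = 0" if "p \<notin> W" for p vs using that by (simp add: ext_deriv_def)
  show "smooth_fun W (\<lambda>p. ext_deriv \<phi> p vs)" for vs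
    using assms
  proof (induction vs arbitrary: \<phi>)
    case (Cons x vs)
    have "smooth_fun W (\<lambda>p. dirD x \<phi> p vs + (-1) * ext_deriv (insert_vec x \<phi>) p vs)"
      using Cons by (intro smooth_fun_add smooth_fun_mult smooth_fun_const)
        (auto intro: form_smooth form_dirD form_insert_vec)
    then show ?case by (simp add: ext_deriv_Cons)
  qed (simp add: smooth_fun_const)
  show "ext_deriv \<phi> p vs = ext_deriv \<phi> q ws"
    if "p \<in> W" "q \<in> W" "agree N p q" "list_all2 (agree N) vs ws" for p q vs ws
    using assms that
  proof (induction vs arbitrary: \<phi> ws)
    case (Cons x vs)
    then obtain y ws' where ws: "ws = y # ws'" "agree N x y" "list_all2 (agree N) vs ws'"
      by (auto simp: list_all2_Cons1)
    then show ?case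
      using Cons.IH[of "insert_vec x \<phi>" ws'] Cons.prems dirD_agree[of N \<phi> p q vs ws' x y]
        insert_vec_agree[of N \<phi> x y]
      by (simp add: ext_deriv_Cons form_insert_vec)
  qed simp
  show "ext_deriv \<phi> p (us @ (x + c *\<^sub>R y) # vs) = ext_deriv \<phi> p (us @ x # vs) + c * ext_deriv \<phi> p (us @ y # vs)"
    for p us x y c vs
    using assms
  proof (induction us arbitrary: \<phi>)
    case Nil
    then show ?case
      by (simp add: ext_deriv_Cons dirD_dir insert_vec_slot ext_deriv_add[OF form_insert_vec form_scale[OF form_insert_vec]]
        ext_deriv_scale[OF form_insert_vec]) (simp add: fun_apply right_diff_distrib)
  next
    case (Cons u us)
    show ?case using Cons.IH[OF form_insert_vec[OF Cons.prems]] form_slot[OF form_dirD[OF Cons.prems]]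
      by (simp add: ext_deriv_Cons right_diff_distrib)
  qed
  show "ext_deriv \<phi> p (us @ x # y # vs) = - ext_deriv \<phi> p (us @ y # x # vs)" for p us x y vs
    using assms
  proof (induction us arbitrary: \<phi>)
    case Nil
    have "ext_deriv (insert_vec y (insert_vec x \<phi>)) = - ext_deriv (insert_vec x (insert_vec y \<phi>))"
      unfolding insert_vec_swap[OF Nil, of y x] by (rule ext_deriv_minus[OF form_insert_vec[OF form_insert_vec[OF Nil]]])
    then show ?case
      by (simp add: ext_deriv_Cons flip: insert_vec_dirD) (simp add: insert_vec_def uminus_apply)
  next
    case (Cons u us)
    show ?case using Cons.IH[OF form_insert_vec[OF Cons.prems]] form_swap[OF form_dirD[OF Cons.prems], of _ _ us x y]
      by (simp add: ext_deriv_Cons)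
  qed
qed

lemma ext_deriv_dirD:
  assumes "form N \<phi>"
  shows "ext_deriv (dirD x \<phi>) = dirD x (ext_deriv \<phi>)"
proof -
  have "ext_deriv (dirD x \<phi>) p vs = dirD x (ext_deriv \<phi>) p vs" for p vs
    using assms
  proof (induction vs arbitrary: \<phi>)
    case Nil
    show ?case by (simp add: dirD_def dir_deriv_def)
  next
    case (Cons y vs)
    have f: "form N \<phi>" by fact
    have "dirD x (ext_deriv \<phi>) p (y # vs) = insert_vec y (dirD x (ext_deriv \<phi>)) p vs"
      by (simp add: insert_vec_def)
    also have "\<dots> = dirD x (dirD y \<phi>) p vs - dirD x (ext_deriv (insert_vec y \<phi>)) p vs"
      by (simp add: insert_vec_dirD insert_vec_ext_deriv
        dirD_diff[OF form_dirD[OF f] form_ext_deriv[OF form_insert_vec[OF f]]]) (simp add: fun_apply)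
    finally show ?case using Cons.IH[OF form_insert_vec[OF f, of y]] dirD_commute[OF f, of x y]
      by (simp add: ext_deriv_Cons insert_vec_dirD)
  qed
  then show ?thesis by (simp add: fun_eq_iff fun_apply)
qed

text \<open>By the recursion for the exterior derivative, the value on \<open>x # vs\<close> is the commutator of
\<open>d\<close> with the derivative along \<open>x\<close>, which vanishes, plus the value of \<open>d d\<close> of a form with
one argument fewer.\<close>

lemma ext_deriv_ext_deriv:
  assumes "form N \<phi>"
  shows "ext_deriv (ext_deriv \<phi>) = 0"
proof -
  have "ext_deriv (ext_deriv \<phi>) p vs = 0" for p vs
    using assms
  proof (induction vs arbitrary: \<phi>)
    case (Cons x vs)
    have f: "form N \<phi>" by fact
    have "ext_deriv (dirD x \<phi> - ext_deriv (insert_vec x \<phi>)) p vs = dirD x (ext_deriv \<phi>) p vs"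
      using Cons.IH[OF form_insert_vec[OF f, of x]]
      by (simp add: ext_deriv_diff[OF form_dirD[OF f] form_ext_deriv[OF form_insert_vec[OF f]]] ext_deriv_dirD[OF f])
        (simp add: fun_apply)
    then show ?case by (simp add: ext_deriv_Cons[of "ext_deriv \<phi>"] insert_vec_ext_deriv)
  qed (simp add: fun_apply)
  then show ?thesis by (simp add: fun_eq_iff fun_apply)
qed

section \<open>Contraction with linear vector fields\<close>

text \<open>The coordinates of a linear map have constant directional derivatives.\<close>

lemma smooth_coord:
  assumes A: "jet_map e A"
  shows "smooth_fun W (\<lambda>p. A p I $ a)"
proof -
  have lin: "A (shift p v s) = A p + s *\<^sub>R A v" for p v s
    using A by (simp add: jet_map_def shift_eq linear_add linear_scale)
  have der: "((\<lambda>s. A (shift p v s) I $ a) has_field_derivative A v I $ a) (at 0)" for p v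
    unfolding lin fun_apply vector_add_component vector_scaleR_component
    by (auto intro!: derivative_eq_intros)
  have "continuous_on UNIV (\<lambda>p. A p I $ a)"
    by (rule bounded_linear.continuous_on[OF bounded_linear_vec_nth])
       (use A in \<open>auto simp: jet_map_def intro: continuous_on_product_then_coordinatewise\<close>)
  then have "continuous_on W (\<lambda>p. A p I $ a)" by (rule continuous_on_subset) simp
  moreover have "dir_deriv v (\<lambda>p. A p I $ a) = (\<lambda>p. A v I $ a)" for v
    by (rule ext) (rule dir_derivI[OF der])
  moreover have "(\<lambda>s. A (shift p v s) I $ a) differentiable (at 0)" for p v
    using der unfolding real_differentiable_def by blast
  ultimately have "diff_on l W (\<lambda>p. A p I $ a)" for l
    by (cases l) (simp_all add: diff_on_const)
  then show ?thesis by (simp add: smooth_fun_def)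
qed

definition basis_vec :: "(nat^2) \<times> 'n \<Rightarrow> 'n point" where
  "basis_vec z = (\<lambda>J. if J = fst z then axis (snd z) 1 else 0)"

text \<open>A form of order \<open>N\<close> sees only finitely many coordinates of its argument. This reduces the
smoothness of \<open>p \<mapsto> \<phi> p (A p # vs)\<close> to that of finitely many products.\<close>

lemma form_expand_slot:
  assumes "form N \<phi>"
  shows "\<phi> p (x # vs) = (\<Sum>z\<in>{I. mlen I \<le> N} \<times> UNIV. x (fst z) $ snd z * \<phi> p (basis_vec z # vs))"
proof -
  let ?X = "{I. mlen I \<le> N} \<times> (UNIV :: 'n set)"
  have "agree N x (\<Sum>z\<in>?X. x (fst z) $ snd z *\<^sub>R basis_vec z)"
    unfolding agree_def
  proof (intro allI impI)
    fix I assume I: "mlen I \<le> N"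
    have inner: "(\<Sum>a\<in>UNIV. x J $ a *\<^sub>R basis_vec (J, a) I) = (if J = I then x I else 0)" for J
      using basis_expansion[of "x I"] by (auto simp: basis_vec_def scalar_mult_eq_scaleR)
    have "(\<Sum>z\<in>?X. x (fst z) $ snd z *\<^sub>R basis_vec z) I
        = (\<Sum>z\<in>?X. x (fst z) $ snd z *\<^sub>R basis_vec z I)"
      unfolding sum_fun_apply scaleR_fun_apply ..
    also have "\<dots> = (\<Sum>J | mlen J \<le> N. \<Sum>a\<in>UNIV. x J $ a *\<^sub>R basis_vec (J, a) I)"
      unfolding sum.cartesian_product by (simp only: case_prod_unfold prod.collapse)
    also have "\<dots> = x I"
      unfolding inner using I by (subst sum.delta) simp_all
    finally show "x I = (\<Sum>z\<in>?X. x (fst z) $ snd z *\<^sub>R basis_vec z) I" by simp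
  qed
  then have eq: "insert_vec x \<phi> = insert_vec (\<Sum>z\<in>?X. x (fst z) $ snd z *\<^sub>R basis_vec z) \<phi>"
    by (rule insert_vec_agree[OF assms])
  have "\<phi> p (x # vs) = insert_vec x \<phi> p vs" by (simp only: insert_vec_def)
  also have "\<dots> = \<phi> p ((\<Sum>z\<in>?X. x (fst z) $ snd z *\<^sub>R basis_vec z) # vs)"
    unfolding eq by (simp only: insert_vec_def)
  also have "\<dots> = (\<Sum>z\<in>?X. x (fst z) $ snd z * \<phi> p (basis_vec z # vs))"
    by (rule form_slot1_sum[OF assms])
  finally show ?thesis .
qed

text \<open>The product rule, where linearity of the slot makes the dependence of \<open>\<phi> q (A q # vs)\<close> on the
inserted vector exactly affine along a line.\<close>

lemma dir_deriv_contract: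
  assumes f: "form N \<phi>" and A: "jet_map e A" and p: "p \<in> W"
  shows "((\<lambda>s. contract A \<phi> (shift p x s) vs) has_field_derivative
      dirD x \<phi> p (A p # vs) + \<phi> p (A x # vs)) (at 0)"
proof -
  have "contract A \<phi> (shift p x s) vs
      = \<phi> (shift p x s) (A p # vs) + s * \<phi> (shift p x s) (A x # vs)" for s
    using A by (simp add: contract_def shift_eq jet_map_def linear_add linear_scale form_slot1[OF f])
  moreover have "((\<lambda>s. \<phi> (shift p x s) (A p # vs) + s * \<phi> (shift p x s) (A x # vs)) has_field_derivative
      dir_deriv x (\<lambda>q. \<phi> q (A p # vs)) p + \<phi> p (A x # vs)) (at 0)"
    using has_dir_deriv[OF form_smooth[OF f, of "A p # vs"] p, of x]
      has_dir_deriv[OF form_smooth[OF f, of "A x # vs"] p, of x]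
    by (auto intro!: derivative_eq_intros simp: shift_eq)
  ultimately show ?thesis using p by (simp add: dirD_def)
qed

lemma dirD_contract:
  assumes "form N \<phi>" "jet_map e A"
  shows "dirD x (contract A \<phi>) p vs = dirD x \<phi> p (A p # vs) + \<phi> p (A x # vs)"
  using dir_derivI[OF dir_deriv_contract[OF assms]] form_outside[OF assms(1)]
  by (cases "p \<in> W") (simp_all add: dirD_def)

lemma insert_vec_contract:
  "form N \<phi> \<Longrightarrow> insert_vec x (contract A \<phi>) = - contract A (insert_vec x \<phi>)"
  by (simp add: fun_eq_iff fun_apply insert_vec_def contract_def form_swap1[of N \<phi> _ _ x])

lemma form_contract:
  assumes f: "form N \<phi>" and A: "jet_map e A"
  shows "form (N + e) (contract A \<phi>)"
proof (rule formI)
  show "contract A \<phi> p vs = 0" if "p \<notin> W" for p vs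
    using form_outside[OF f that] by (simp add: contract_def)
  show "smooth_fun W (\<lambda>p. contract A \<phi> p vs)" for vs
    unfolding contract_def
    by (rule smooth_fun_cong[OF form_expand_slot[OF f, symmetric]])
       (intro smooth_fun_sum smooth_fun_mult smooth_coord[OF A] form_smooth[OF f])
  show "contract A \<phi> p (us @ (x + c *\<^sub>R y) # vs) = contract A \<phi> p (us @ x # vs) + c * contract A \<phi> p (us @ y # vs)"
    for p us x c y vs
    using form_slot[OF f, of p "A p # us" x c y vs] by (simp add: contract_def)
  show "contract A \<phi> p (us @ x # y # vs) = - contract A \<phi> p (us @ y # x # vs)" for p us x y vs
    using form_swap[OF f, of p "A p # us" x y vs] by (simp add: contract_def)
  show "contract A \<phi> p vs = contract A \<phi> q ws"
    if "p \<in> W" "q \<in> W" "agree (N + e) p q" "list_all2 (agree (N + e)) vs ws" for p q vs ws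
    unfolding contract_def
  proof (rule form_agree[OF f that(1,2)])
    show "agree N p q" using that(3) by (rule agree_mono) simp
    have "list_all2 (agree N) vs ws"
      using that(4) by (rule list_all2_mono) (erule agree_mono, simp)
    then show "list_all2 (agree N) (A p # vs) (A q # ws)"
      using A that by (simp add: jet_map_def)
  qed
qed

section \<open>Lie derivatives along linear vector fields\<close>

definition Lie :: "('n point \<Rightarrow> 'n point) \<Rightarrow> 'n form \<Rightarrow> 'n form" where
  "Lie A \<phi> = contract A (ext_deriv \<phi>) + ext_deriv (contract A \<phi>)"

lemma Lie_eq_lie: "Lie A \<phi> p vs = (if p \<in> W then lie A \<phi> p vs else 0)"
  unfolding Lie_def fun_apply lie_def ext_deriv_def by (simp add: contract_def[of A "\<lambda>p vs. if p \<in> W then _ p vs else _"] contract_def[of A "ext_d \<phi>"])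

lemma form_Lie: "form N \<phi> \<Longrightarrow> jet_map e A \<Longrightarrow> form (N + e) (Lie A \<phi>)"
  unfolding Lie_def by (intro form_add form_ext_deriv form_contract)

lemma Lie_add:
  assumes "form N \<phi>" "form M \<psi>" "jet_map e A"
  shows "Lie A (\<phi> + \<psi>) = Lie A \<phi> + Lie A \<psi>"
  by (simp add: Lie_def contract_add ext_deriv_add[OF assms(1,2)]
    ext_deriv_add[OF form_contract[OF assms(1,3)] form_contract[OF assms(2,3)]])

lemma Lie_scale:
  assumes "form N \<phi>" "jet_map e A"
  shows "Lie A (c *\<^sub>R \<phi>) = c *\<^sub>R Lie A \<phi>"
  by (simp add: Lie_def contract_scale ext_deriv_scale[OF assms(1)] ext_deriv_scale[OF form_contract[OF assms]]
    scaleR_right_distrib)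

lemma Lie_minus: "form N \<phi> \<Longrightarrow> jet_map e A \<Longrightarrow> Lie A (- \<phi>) = - Lie A \<phi>"
  using Lie_scale[of N \<phi> e A "-1"] by simp

lemma Lie_Nil: "Lie A \<phi> p [] = dirD (A p) \<phi> p []"
  by (simp add: Lie_def fun_apply contract_def[of _ "ext_deriv \<phi>"] ext_deriv_Cons)

text \<open>The derivatives of \<open>\<phi>\<close> along \<open>x\<close> cancel between the two terms of the Cartan formula; what
remains of them is the term produced by differentiating the linear field \<open>A\<close> along \<open>x\<close>.\<close>

lemma Lie_Cons:
  assumes f: "form N \<phi>" and A: "jet_map e A"
  shows "Lie A \<phi> p (x # vs) = \<phi> p (A x # vs) + Lie A (insert_vec x \<phi>) p vs"
proof -
  have "ext_deriv \<phi> p (A p # x # vs) = - (dirD x \<phi> p (A p # vs) - ext_deriv (insert_vec x \<phi>) p (A p # vs))"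
    unfolding form_swap1[OF form_ext_deriv[OF f], of p "A p"] by (simp add: ext_deriv_Cons[of \<phi> p x])
  moreover have "ext_deriv (contract A \<phi>) p (x # vs)
      = dirD x \<phi> p (A p # vs) + \<phi> p (A x # vs) + ext_deriv (contract A (insert_vec x \<phi>)) p vs"
    by (simp add: ext_deriv_Cons dirD_contract[OF f A] insert_vec_contract[OF f]
      ext_deriv_minus[OF form_contract[OF form_insert_vec[OF f] A]]) (simp add: fun_apply)
  ultimately show ?thesis by (simp add: Lie_def fun_apply contract_def[of A "ext_deriv _"])
qed

lemma insert_vec_Lie:
  assumes "form N \<phi>" "jet_map e A"
  shows "insert_vec x (Lie A \<phi>) = insert_vec (A x) \<phi> + Lie A (insert_vec x \<phi>)"
  by (simp add: fun_eq_iff fun_apply insert_vec_def[of _ "Lie A \<phi>"] insert_vec_def[of "A x"] Lie_Cons[OF assms])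

lemma ext_deriv_Lie:
  assumes "form N \<phi>" "jet_map e A"
  shows "ext_deriv (Lie A \<phi>) = Lie A (ext_deriv \<phi>)"
  by (simp add: Lie_def ext_deriv_add[OF form_contract[OF form_ext_deriv[OF assms(1)] assms(2)]
       form_ext_deriv[OF form_contract[OF assms]]] ext_deriv_ext_deriv[OF form_contract[OF assms]] ext_deriv_ext_deriv[OF assms(1)])
     (simp add: fun_eq_iff fun_apply contract_def)

text \<open>Both orders produce the same terms from the recursion; only the term in which both maps act on
one argument and the one in which a linear field is differentiated see the order of \<open>A\<close> and
\<open>B\<close>.\<close>

lemma Lie_commute:
  assumes "form N \<phi>" "jet_map e A" "jet_map e' B" and AB: "\<And>x. A (B x) = B (A x)"
  shows "Lie A (Lie B \<phi>) = Lie B (Lie A \<phi>)"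
proof -
  have "Lie A (Lie B \<phi>) p vs = Lie B (Lie A \<phi>) p vs" for p vs
    using assms(1)
  proof (induction vs arbitrary: \<phi>)
    case Nil
    have base: "Lie A (Lie B \<phi>) p [] = dirD (A p) (dirD (B p) \<phi>) p [] + dirD (B (A p)) \<phi> p []"
      if A: "jet_map e A" and B: "jet_map e' B" for A B e e'
    proof -
      have "Lie B \<phi> q [] = contract B (ext_deriv \<phi>) q []" for q
        by (simp add: Lie_def fun_apply)
      then have "Lie A (Lie B \<phi>) p [] = dirD (A p) (contract B (ext_deriv \<phi>)) p []"
        by (simp add: Lie_Nil[of A] dirD_def)
      also have "\<dots> = dirD (A p) (ext_deriv \<phi>) p [B p] + ext_deriv \<phi> p [B (A p)]"
        by (rule dirD_contract[OF form_ext_deriv[OF Nil] B])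
      also have "dirD (A p) (ext_deriv \<phi>) p [B p] = dirD (A p) (dirD (B p) \<phi>) p []"
        by (simp add: dirD_def[of _ "ext_deriv \<phi>"] dirD_def[of _ "dirD _ _"] ext_deriv_Cons)
      finally show ?thesis by (simp add: ext_deriv_Cons)
    qed
    show ?case using base[OF assms(2,3)] base[OF assms(3,2)] dirD_commute[OF Nil] AB by simp
  next
    case (Cons x vs)
    have f: "form N \<phi>" by fact
    have step: "Lie A (Lie B \<phi>) p (x # vs) = \<phi> p (B (A x) # vs) + Lie B (insert_vec (A x) \<phi>) p vs
        + Lie A (insert_vec (B x) \<phi>) p vs + Lie A (Lie B (insert_vec x \<phi>)) p vs"
      if A: "jet_map e A" and B: "jet_map e' B" for A B e e'
      by (simp add: Lie_Cons[OF form_Lie[OF f B] A] Lie_Cons[OF f B] insert_vec_Lie[OF f B]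
        Lie_add[OF form_insert_vec[OF f] form_Lie[OF form_insert_vec[OF f] B] A]) (simp add: fun_apply)
    show ?case using step[OF assms(2,3)] step[OF assms(3,2)] Cons.IH[OF form_insert_vec[OF f, of x]] AB
      by simp
  qed
  then show ?thesis by (simp add: fun_eq_iff fun_apply)
qed

text \<open>The commutator of \<open>i\<^sub>A\<close> and the Lie derivative along \<open>B\<close> is contraction with the bracket of
the two linear fields, which is the linear field \<open>B A - A B\<close>.\<close>

lemma contract_Lie:
  assumes "form N \<phi>" "jet_map e A" "jet_map e' B"
  shows "contract A (Lie B \<phi>) p vs
    = Lie B (contract A \<phi>) p vs + \<phi> p (B (A p) # vs) - \<phi> p (A (B p) # vs)"
proof -
  have "Lie B (contract A \<phi>) p vs = Lie B (insert_vec (A p) \<phi>) p vs + \<phi> p (A (B p) # vs)"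
    using assms(1)
  proof (induction vs arbitrary: \<phi>)
    case Nil
    show ?case by (simp add: Lie_Nil dirD_contract[OF Nil assms(2)]) (simp add: dirD_def insert_vec_def)
  next
    case (Cons y vs)
    have f: "form N \<phi>" by fact
    have "Lie B (insert_vec y (contract A \<phi>)) p vs = - Lie B (contract A (insert_vec y \<phi>)) p vs"
      by (simp add: insert_vec_contract[OF f] Lie_minus[OF form_contract[OF form_insert_vec[OF f] assms(2)] assms(3)])
        (simp add: fun_apply)
    moreover have "Lie B (insert_vec y (insert_vec (A p) \<phi>)) p vs = - Lie B (insert_vec (A p) (insert_vec y \<phi>)) p vs"
      unfolding insert_vec_swap[OF f, of y "A p"]
      by (simp add: Lie_minus[OF form_insert_vec[OF form_insert_vec[OF f]] assms(3)]) (simp add: fun_apply)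
    ultimately show ?case
      using Cons.IH[OF form_insert_vec[OF f, of y]] form_swap1[OF f, of p y "A (B p)" vs]
      by (simp add: Lie_Cons[OF form_contract[OF f assms(2)] assms(3)]
        Lie_Cons[OF form_insert_vec[OF f] assms(3)]) (simp add: contract_def insert_vec_def)
  qed
  then show ?thesis by (simp add: contract_def[of A "Lie B \<phi>"] Lie_Cons[OF assms(1,3)])
qed

end

section \<open>Total derivatives and vertical endomorphisms\<close>

text \<open>Keeps the multi-index \<^term>\<open>axis j 1\<close> in normal form.\<close>

declare One_nat_def [simp del]

lemma mlen_add_axis [simp]: "mlen (I + axis j 1) = Suc (mlen I)"
  using exhaust_2[of j] by (auto simp: mlen_eq axis_def)

lemma mlen_zero [simp]: "mlen 0 = 0"
  by (simp add: mlen_eq)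

lemma mlen_axis [simp]: "mlen (axis j 1) = 1"
  using mlen_add_axis[of 0 j] by (simp add: One_nat_def)

lemma mlen_add: "mlen (I + J) = mlen I + mlen J"
  by (simp add: mlen_eq)

lemma mlen_diff_axis_le: "mlen (I - axis i 1) \<le> mlen I"
  by (auto simp: mlen_eq)

lemma add_diff_axis [simp]: "I + axis j 1 - axis j 1 = (I :: nat^2)"
  by (simp add: vec_eq_iff)

lemma diff_add_axis: "I $ j \<noteq> 0 \<Longrightarrow> I - axis j 1 + axis j 1 = (I :: nat^2)"
  by (auto simp: vec_eq_iff axis_def)

lemma diff_add_axis_other: "i \<noteq> j \<Longrightarrow> I - axis j 1 + axis i 1 = I + axis i 1 - (axis j 1 :: nat^2)"
  by (auto simp: vec_eq_iff axis_def)

lemma add_axis_nth: "(I + axis j 1) $ i = I $ i + (if i = j then 1 else 0)" for I :: "nat^2"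
  by (simp add: axis_def)

lemma jet_map_linear: "jet_map e A \<Longrightarrow> linear A"
  by (simp add: jet_map_def)

lemma jet_map_comp:
  fixes A B :: "'n::finite point \<Rightarrow> 'n point"
  assumes "jet_map e A" "jet_map e' B"
  shows "jet_map (e + e') (A \<circ> B)"
  unfolding jet_map_def
proof (intro conjI allI impI)
  show "linear (A \<circ> B)" using assms by (auto simp: jet_map_def intro: linear_compose)
  show "continuous_on UNIV (A \<circ> B)"
    using assms unfolding jet_map_def by (intro continuous_on_compose) (auto intro: continuous_on_subset)
  fix N and p q :: "'n point" assume "agree (N + (e + e')) p q"
  then have "agree ((N + e) + e') p q" by (simp add: add.assoc)
  then have "agree (N + e) (B p) (B q)" using assms(2) unfolding jet_map_def by blast
  then show "agree N ((A \<circ> B) p) ((A \<circ> B) q)" using assms(1) unfolding jet_map_def by simp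
qed

lemma jet_map_total: "jet_map 1 (total j)"
  unfolding jet_map_def
proof (intro conjI allI impI)
  show "linear (total j)" by (rule linearI) (simp_all add: total_def fun_eq_iff fun_apply)
  show "continuous_on UNIV (total j)"
    by (rule continuous_on_coordinatewise_then_product)
       (auto simp: total_def intro: continuous_on_product_then_coordinatewise continuous_on_id)
qed (simp add: agree_def total_def)

lemma jet_map_vert_endo: "jet_map 0 (vert_endo i)"
  unfolding jet_map_def
proof (intro conjI allI impI)
  show "linear (vert_endo i)"
    by (rule linearI) (simp_all add: vert_endo_def fun_eq_iff fun_apply scaleR_right_distrib)
  show "continuous_on UNIV (vert_endo i)"
    by (rule continuous_on_coordinatewise_then_product)
       (unfold vert_endo_def, intro continuous_on_scaleR continuous_on_const
         continuous_on_product_then_coordinatewise[OF continuous_on_id])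
next
  fix N p q assume "agree (N + 0) p q"
  then have "p (I - axis i 1) = q (I - axis i 1)" if "mlen I \<le> N" for I
    using order_trans[OF mlen_diff_axis_le that] by (simp add: agree_def)
  then show "agree N (vert_endo i p) (vert_endo i q)" by (simp add: agree_def vert_endo_def)
qed

lemma total_commute: "total i (total j p) = total j (total i p)"
  by (simp add: total_def add_ac)

lemma vert_endo_commute: "vert_endo i (vert_endo j p) = vert_endo j (vert_endo i p)"
proof (cases "i = j")
  case False
  have "I - axis i 1 - axis j 1 = (I - axis j 1 - axis i 1 :: nat^2)" for I
    by (simp add: vec_eq_iff add.commute)
  with False show ?thesis
    by (auto simp: vert_endo_def fun_eq_iff axis_def mult.commute)
qed simp

text \<open>The canonical commutation relation of the problem: the component at \<open>I\<close> of the left side has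
the factor \<open>(I + 1\<^sub>j)(i)\<close>, on the right side it is \<open>I(i)\<close>.\<close>

lemma total_vert_endo:
  "total j (vert_endo i p) = vert_endo i (total j p) + (if i = j then p else 0)"
proof (intro ext)
  fix I
  show "total j (vert_endo i p) I = (vert_endo i (total j p) + (if i = j then p else 0)) I"
  proof (cases "i = j")
    case True
    then show ?thesis
      by (cases "I $ j = 0")
         (simp_all add: total_def vert_endo_def fun_apply diff_add_axis scaleR_left_distrib add_axis_nth)
  next
    case False
    then have "(axis j 1 :: nat^2) $ i = 0" by (simp add: axis_def)
    then show ?thesis
      using False by (simp add: total_def vert_endo_def fun_apply diff_add_axis_other[OF False[symmetric]])
  qed
qed

section \<open>Contraction with the vertical endomorphisms\<close>

lemma vert_contract_commute: "vert_contract i (vert_contract j \<phi>) = vert_contract j (vert_contract i \<phi>)"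
proof -
  have "vert_contract i (vert_contract j \<phi>) p vs = vert_contract j (vert_contract i \<phi>) p vs" for p vs
  proof (induction vs arbitrary: \<phi>)
    case (Cons x vs)
    then show ?case
      by (simp add: vert_contract_Cons insert_vec_vert_contract vert_contract_add vert_endo_commute[of i j])
        (simp add: fun_apply)
  qed simp
  then show ?thesis by (simp add: fun_eq_iff)
qed

text \<open>Contraction with the derivation \<open>S\<^sup>i\<close>: the slot filled by \<open>A\<close> is one of those on which
\<open>S\<^sup>i\<close> acts.\<close>

lemma contract_vert_contract:
  "contract A (vert_contract i \<phi>) = contract (vert_endo i \<circ> A) \<phi> + vert_contract i (contract A \<phi>)"
  by (simp add: fun_eq_iff fun_apply contract_def[of _ \<phi>] contract_def[of A "vert_contract i \<phi>"] vert_contract_Cons)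
     (simp add: vert_contract_def insert_vec_def contract_def)

definition of_degree :: "nat \<Rightarrow> 'n::finite form \<Rightarrow> bool" where
  "of_degree r \<phi> \<longleftrightarrow> (\<forall>p vs. length vs \<noteq> r \<longrightarrow> \<phi> p vs = 0)"

lemma of_degreeD: "of_degree r \<phi> \<Longrightarrow> length vs \<noteq> r \<Longrightarrow> \<phi> p vs = 0"
  by (simp add: of_degree_def)

lemma of_degree_add: "of_degree r \<phi> \<Longrightarrow> of_degree r \<psi> \<Longrightarrow> of_degree r (\<phi> + \<psi>)"
  and of_degree_scale: "of_degree r \<phi> \<Longrightarrow> of_degree r (c *\<^sub>R \<phi>)"
  and of_degree_zero: "of_degree r 0"
  by (simp_all add: of_degree_def fun_apply)

lemma of_degree_contract: "of_degree (Suc r) \<phi> \<Longrightarrow> of_degree r (contract A \<phi>)"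
  by (simp add: of_degree_def contract_def)

lemma contract_degree_0: "of_degree 0 \<phi> \<Longrightarrow> contract A \<phi> = 0"
  by (simp add: of_degree_def contract_def fun_eq_iff fun_apply)

lemma vert_contract_degree_0: "of_degree 0 \<phi> \<Longrightarrow> vert_contract i \<phi> = 0"
proof (intro ext)
  fix p vs assume "of_degree 0 \<phi>"
  then show "vert_contract i \<phi> p vs = 0 p vs"
    by (cases vs) (simp_all add: of_degree_def vert_contract_def fun_apply del: list_update.simps)
qed

lemma of_degree_vert_contract: "of_degree r \<phi> \<Longrightarrow> of_degree r (vert_contract i \<phi>)"
  by (simp add: of_degree_def vert_contract_def)

context jet_domain
begin

lemma of_degree_ext_deriv: "of_degree r \<phi> \<Longrightarrow> of_degree (Suc r) (ext_deriv \<phi>)"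
proof -
  assume \<phi>: "of_degree r \<phi>"
  have "ext_deriv \<phi> p vs = 0" if "length vs \<noteq> Suc r" for p vs
  proof -
    have "dir_deriv v (\<lambda>q. \<phi> q (take a vs @ drop (Suc a) vs)) p = 0" if "a < length vs" for v a
    proof -
      have "length (take a vs @ drop (Suc a) vs) \<noteq> r" using that \<open>length vs \<noteq> Suc r\<close> by auto
      then show ?thesis using of_degreeD[OF \<phi>] by (simp add: dir_deriv_def)
    qed
    then show ?thesis by (simp add: ext_deriv_def ext_d_def)
  qed
  then show ?thesis by (simp add: of_degree_def)
qed

lemma of_degree_Lie:
  assumes "of_degree r \<phi>"
  shows "of_degree r (Lie A \<phi>)"
proof (cases r)
  case 0
  have "ext_deriv 0 = 0" by (simp add: fun_eq_iff fun_apply ext_deriv_def ext_d_def dir_deriv_def)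
  with 0 show ?thesis using assms of_degree_contract[OF of_degree_ext_deriv[OF assms], of A]
    by (simp add: Lie_def contract_degree_0)
next
  case (Suc r')
  then show ?thesis unfolding Lie_def
    using assms by (auto intro!: of_degree_add of_degree_contract of_degree_ext_deriv)
qed

lemma form_vert_contract:
  assumes "form N \<phi>"
  shows "form N (vert_contract i \<phi>)"
proof (rule formI)
  note lin = jet_map_linear[OF jet_map_vert_endo]
  show "vert_contract i \<phi> p vs = 0" if "p \<notin> W" for p vs
    using form_outside[OF assms that] by (simp add: vert_contract_def)
  show "smooth_fun W (\<lambda>p. vert_contract i \<phi> p vs)" for vs
    unfolding vert_contract_def by (intro smooth_fun_sum form_smooth[OF assms])
  show "vert_contract i \<phi> p vs = vert_contract i \<phi> q ws"
    if "p \<in> W" "q \<in> W" "agree N p q" and vw: "list_all2 (agree N) vs ws" for p q vs ws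
    unfolding vert_contract_def
  proof (rule sum.cong)
    show "{..<length vs} = {..<length ws}" using list_all2_lengthD[OF vw] by simp
    fix a assume "a \<in> {..<length ws}"
    then have "agree (N + 0) (vs ! a) (ws ! a)" using vw by (simp add: list_all2_conv_all_nth)
    then have "agree N (vert_endo i (vs ! a)) (vert_endo i (ws ! a))"
      using jet_map_vert_endo[of i] unfolding jet_map_def by blast
    then show "\<phi> p (vs[a := vert_endo i (vs ! a)]) = \<phi> q (ws[a := vert_endo i (ws ! a)])"
      using that by (intro form_agree[OF assms]) (simp_all add: list_all2_update_cong)
  qed
  show "vert_contract i \<phi> p (us @ (x + c *\<^sub>R y) # vs)
      = vert_contract i \<phi> p (us @ x # vs) + c * vert_contract i \<phi> p (us @ y # vs)" for p us x c y vs
    using assms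
  proof (induction us arbitrary: \<phi>)
    case Nil
    then show ?case
      by (simp add: vert_contract_Cons linear_add[OF lin] linear_scale[OF lin] form_slot1
        insert_vec_slot vert_contract_add vert_contract_scale) (simp add: fun_apply distrib_left)
  next
    case (Cons u us)
    show ?case
      using Cons.IH[OF form_insert_vec[OF Cons.prems]] form_slot[OF Cons.prems, of p "vert_endo i u # us" x c y vs]
      by (simp add: vert_contract_Cons distrib_left)
  qed
  show "vert_contract i \<phi> p (us @ x # y # vs) = - vert_contract i \<phi> p (us @ y # x # vs)" for p us x y vs
    using assms
  proof (induction us arbitrary: \<phi>)
    case Nil
    have "vert_contract i (insert_vec y (insert_vec x \<phi>)) = - vert_contract i (insert_vec x (insert_vec y \<phi>))"
      unfolding insert_vec_swap[OF Nil, of y x]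
      using vert_contract_scale[of i "-1" "insert_vec x (insert_vec y \<phi>)"] by simp
    then show ?case
      using form_swap1[OF Nil, of p "vert_endo i x" y vs] form_swap1[OF Nil, of p x "vert_endo i y" vs]
      by (simp add: vert_contract_Cons) (simp add: fun_apply insert_vec_def)
  next
    case (Cons u us)
    show ?case
      using Cons.IH[OF form_insert_vec[OF Cons.prems]] form_swap[OF Cons.prems, of p "vert_endo i u # us" x y vs]
      by (simp add: vert_contract_Cons)
  qed
qed

text \<open>The relation \<open>S\<^sup>i d\<^sub>j - d\<^sub>j S\<^sup>i = r \<delta>\<^sup>i\<^sub>j\<close> on forms of degree \<open>r\<close>: each of the \<open>r\<close> arguments
contributes the commutator of the two linear maps.\<close>

lemma vert_contract_Lie_total:
  assumes "form N \<phi>" "of_degree r \<phi>"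
  shows "vert_contract i (Lie (total j) \<phi>)
    = Lie (total j) (vert_contract i \<phi>) + (if i = j then real r else 0) *\<^sub>R \<phi>"
proof -
  note T = jet_map_total[of j]
  have "vert_contract i (Lie (total j) \<phi>) p vs
    = Lie (total j) (vert_contract i \<phi>) p vs + (if i = j then real (length vs) else 0) * \<phi> p vs" for p vs
    using assms(1)
  proof (induction vs arbitrary: \<phi>)
    case Nil
    have "dir_deriv v (\<lambda>q. vert_contract i \<phi> q []) p = 0" for v by (simp add: dir_deriv_def)
    then show ?case by (simp add: Lie_Nil dirD_def)
  next
    case (Cons x vs)
    have f: "form N \<phi>" by fact
    have iv: "insert_vec x \<phi> p vs = \<phi> p (x # vs)" by (simp only: insert_vec_def)
    have "\<phi> p (total j (vert_endo i x) # vs)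
        = \<phi> p (vert_endo i (total j x) # vs) + (if i = j then \<phi> p (x # vs) else 0)"
      using form_slot_zero[OF f, of p "[]" vs] by (simp add: total_vert_endo form_slot1_add[OF f])
    then show ?case
      using Cons.IH[OF form_insert_vec[OF f, of x]]
      by (simp add: vert_contract_Cons Lie_Cons[OF f T] Lie_Cons[OF form_vert_contract[OF f] T]
          insert_vec_Lie[OF f T] insert_vec_vert_contract vert_contract_add
          Lie_add[OF form_insert_vec[OF f] form_vert_contract[OF form_insert_vec[OF f]] T])
        (auto simp: fun_apply iv algebra_simps)
  qed
  then show ?thesis
    using of_degreeD[OF assms(2)] by (auto simp: fun_eq_iff fun_apply)
qed

section \<open>Nilpotency of the vertical contractions\<close>

definition zero_below :: "nat \<Rightarrow> 'n point \<Rightarrow> bool" where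
  "zero_below m x \<longleftrightarrow> (\<forall>I. mlen I < m \<longrightarrow> x I = 0)"

text \<open>If \<open>m\<close> vertical contractions have acted on an \<open>r\<close>-form of order \<open>N\<close>, then each of its terms
has distributed \<open>m\<close> endomorphisms over the \<open>r\<close> arguments. An argument on which more than \<open>N\<close>
of them act has vanishing \<open>N\<close>-jet. The list \<open>ms\<close> counts how many have already acted on each
argument.\<close>

definition vanishes_by_weight :: "nat \<Rightarrow> nat \<Rightarrow> 'n form \<Rightarrow> bool" where
  "vanishes_by_weight N m \<phi> \<longleftrightarrow> (\<forall>p ms vs. list_all2 zero_below ms vs \<longrightarrow> length vs * N < sum_list ms + m \<longrightarrow> \<phi> p vs = 0)"

lemma zero_below_vert_endo: "zero_below m x \<Longrightarrow> zero_below (Suc m) (vert_endo i x)"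
proof -
  assume zero_below: "zero_below m x"
  have "I $ i = 0 \<or> x (I - axis i 1) = 0" if "mlen I < Suc m" for I
  proof (cases "I $ i = 0")
    case False
    then have "Suc (mlen (I - axis i 1)) = mlen I"
      using mlen_add_axis[of "I - axis i 1" i] by (simp add: diff_add_axis)
    then show ?thesis using zero_below that by (simp add: zero_below_def)
  qed simp
  then show ?thesis by (auto simp: zero_below_def vert_endo_def)
qed

text \<open>By the pigeonhole principle one argument has a weight above \<open>N\<close>, and it can be replaced by
zero.\<close>

lemma vanishes_by_weight_form:
  assumes "form N \<phi>"
  shows "vanishes_by_weight N 0 \<phi>"
  unfolding vanishes_by_weight_def
proof (intro allI impI)
  fix p ms vs assume zero_below: "list_all2 zero_below ms vs" and "length vs * N < sum_list ms + 0"
  then have len: "length ms = length vs" and gt: "length ms * N < sum_list ms"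
    by (auto dest: list_all2_lengthD)
  have "\<exists>a<length ms. N < ms ! a"
  proof (rule ccontr)
    assume "\<not> ?thesis"
    then have "sum_list ms \<le> length ms * N"
      using sum_bounded_above[of "{0..<length ms}" "\<lambda>a. ms ! a" N]
      by (fastforce simp: sum_list_sum_nth not_less)
    with gt show False by simp
  qed
  then obtain a where a: "a < length vs" "N < ms ! a" using len by auto
  show "\<phi> p vs = 0"
  proof (cases "p \<in> W")
    case True
    have "list_all2 (agree N) vs (vs[a := 0])"
      using a zero_below by (auto simp: list_all2_conv_all_nth nth_list_update agree_def zero_below_def fun_apply)
    then have "\<phi> p vs = \<phi> p (vs[a := 0])"
      by (rule form_agree[OF assms True True agree_refl])
    also have "\<dots> = 0"
      using a form_slot_zero[OF assms] by (simp add: upd_conv_take_nth_drop)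
    finally show ?thesis .
  qed (rule form_outside[OF assms])
qed

lemma vanishes_by_weight_vert_contract:
  assumes "vanishes_by_weight N m \<phi>"
  shows "vanishes_by_weight N (Suc m) (vert_contract i \<phi>)"
  unfolding vanishes_by_weight_def vert_contract_def
proof (intro allI impI sum.neutral ballI)
  fix p ms vs a
  assume zero_below: "list_all2 zero_below ms vs" and gt: "length vs * N < sum_list ms + Suc m"
    and "a \<in> {..<length vs}"
  then have a: "a < length vs" "a < length ms" using list_all2_lengthD[OF zero_below] by auto
  let ?ms = "ms[a := Suc (ms ! a)]" and ?vs = "vs[a := vert_endo i (vs ! a)]"
  have "list_all2 zero_below ?ms ?vs"
    using zero_below a by (intro list_all2_update_cong) (auto intro: zero_below_vert_endo simp: list_all2_conv_all_nth)
  moreover have "sum_list ?ms = Suc (sum_list ms)"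
    using a member_le_sum_list[of "ms ! a" ms] by (simp add: sum_list_update)
  ultimately show "\<phi> p ?vs = 0" using assms gt unfolding vanishes_by_weight_def by simp
qed

lemma vanishes_by_weight_funpow: "vanishes_by_weight N m \<phi> \<Longrightarrow> vanishes_by_weight N (n + m) ((vert_contract i ^^ n) \<phi>)"
  by (induction n) (auto intro: vanishes_by_weight_vert_contract)

lemma vert_contract_multi_eq_0:
  assumes "form N \<phi>" "of_degree r \<phi>" "r * N < mlen K"
  shows "iter_multi vert_contract K \<phi> = 0"
proof -
  let ?\<psi> = "iter_multi vert_contract K \<phi>"
  have deg: "of_degree r ((vert_contract i ^^ n) \<psi>)" if "of_degree r \<psi>" for i n and \<psi> :: "'n form"
    using that by (induction n) (auto intro: of_degree_vert_contract)
  have "vanishes_by_weight N (mlen K) ?\<psi>"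
    using vanishes_by_weight_funpow[OF vanishes_by_weight_funpow[OF vanishes_by_weight_form[OF assms(1)], of "K $ 2" 2], of "K $ 1" 1]
    by (simp add: iter_multi_def mlen_eq)
  then have "?\<psi> p vs = 0" if "length vs = r" for p vs
    using that assms(3) unfolding vanishes_by_weight_def
    by (auto simp: list_all2_conv_all_nth zero_below_def dest!: spec[of _ p] spec[of _ "replicate r 0"] spec[of _ vs])
  moreover have "of_degree r ?\<psi>" using assms(2) by (simp add: iter_multi_def deg)
  ultimately show ?thesis by (auto simp: fun_eq_iff fun_apply of_degree_def)
qed

end

section \<open>Sums over multi-indices\<close>

lemma mlen_pos_nth: "0 < I $ i \<Longrightarrow> 0 < mlen I"
  using exhaust_2[of i] by (auto simp: mlen_eq)

lemma mlen_eq_0: "mlen I = 0 \<longleftrightarrow> I = 0"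
  by (simp add: mlen_eq vec_eq_iff forall_2)

lemma mlen_diff_axis: "I $ i \<noteq> 0 \<Longrightarrow> mlen (I - axis i 1) = mlen I - 1"
  using mlen_add_axis[of "I - axis i 1" i] by (simp add: diff_add_axis)

lemma axis_one_nth: "(axis i 1 :: nat^2) $ j = (if j = i then 1 else 0)"
  by (simp add: axis_def)

lemma mfact_zero [simp]: "mfact 0 = 1"
  by (simp add: mfact_def)

lemma mfact_add_axis: "mfact (I + axis i 1) = Suc (I $ i) * mfact I"
proof -
  have "mfact J = fact (J $ 1) * fact (J $ 2)" for J by (simp add: mfact_def UNIV_2)
  then show ?thesis using exhaust_2[of i]
    by (auto simp: axis_one_nth Suc_eq_plus1[symmetric] distrib_left distrib_right)
qed

lemma multi_induct:
  assumes "P 0" "\<And>J j. P J \<Longrightarrow> P (J + axis j 1)"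
  shows "P (J :: nat^2)"
proof (induction "mlen J" arbitrary: J)
  case 0
  then have "J = 0" using mlen_eq_0[of J] by simp
  then show ?case using assms(1) by simp
next
  case (Suc n)
  then have "J \<noteq> 0" using mlen_eq_0[of J] by simp
  then obtain i where i: "J $ i \<noteq> 0" by (auto simp: vec_eq_iff)
  then have "P (J - axis i 1)" using Suc by (intro Suc.hyps) (simp add: mlen_diff_axis)
  then show ?case using assms(2)[of "J - axis i 1" i] diff_add_axis[OF i] by simp
qed

text \<open>The weight \<open>K(i)/K!\<close> is \<open>1/(K - 1\<^sub>i)!\<close> when \<open>K(i) > 0\<close> and zero otherwise. All telescoping
sums below rest on this change of index.\<close>

lemma sum_multi_shift:
  fixes g :: "nat^2 \<Rightarrow> 'a::real_vector"
  shows "(\<Sum>J | mlen J \<le> R. (h (mlen J) / real (mfact J)) *\<^sub>R g (J + axis i 1))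
    = (\<Sum>K | mlen K \<le> Suc R. (real (K $ i) * h (mlen K - 1) / real (mfact K)) *\<^sub>R g K)"
proof -
  have "(\<Sum>K | mlen K \<le> Suc R. (real (K $ i) * h (mlen K - 1) / real (mfact K)) *\<^sub>R g K)
      = (\<Sum>K | mlen K \<le> Suc R \<and> K $ i \<noteq> 0. (real (K $ i) * h (mlen K - 1) / real (mfact K)) *\<^sub>R g K)"
    by (rule sum.mono_neutral_right) auto
  also have "\<dots> = (\<Sum>J | mlen J \<le> R. (h (mlen J) / real (mfact J)) *\<^sub>R g (J + axis i 1))"
  proof (rule sum.reindex_bij_witness[of _ "\<lambda>J. J + axis i 1" "\<lambda>K. K - axis i 1"])
    fix K assume "K \<in> {K. mlen K \<le> Suc R \<and> K $ i \<noteq> 0}"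
    then have K: "mlen K \<le> Suc R" "K $ i \<noteq> 0" by auto
    show "K - axis i 1 + axis i 1 = K" using K(2) by (rule diff_add_axis)
    show "K - axis i 1 \<in> {J. mlen J \<le> R}" using K by (simp add: mlen_diff_axis)
    have "mfact K = K $ i * mfact (K - axis i 1)"
      using mfact_add_axis[of "K - axis i 1" i] K(2) by (simp add: diff_add_axis)
    then show "(h (mlen (K - axis i 1)) / real (mfact (K - axis i 1))) *\<^sub>R g (K - axis i 1 + axis i 1)
        = (real (K $ i) * h (mlen K - 1) / real (mfact K)) *\<^sub>R g K"
      using K(2) by (simp add: diff_add_axis mlen_diff_axis)
  next
    fix J assume "J \<in> {J. mlen J \<le> R}"
    then show "J + axis i 1 \<in> {K. mlen K \<le> Suc R \<and> K $ i \<noteq> 0}"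
      using mlen_add_axis[of J i] by (simp add: axis_one_nth)
  qed simp
  finally show ?thesis by simp
qed

lemma iter_multi_zero [simp]: "iter_multi D 0 x = x"
  by (simp add: iter_multi_def)

lemma iter_multi_in:
  assumes "\<And>j x. x \<in> V \<Longrightarrow> D j x \<in> V" "x \<in> V"
  shows "iter_multi D J x \<in> V"
proof -
  have "(D j ^^ n) x \<in> V" if "x \<in> V" for j n x using that by (induction n) (auto intro: assms)
  then show ?thesis using assms(2) by (simp add: iter_multi_def)
qed

lemma iter_multi_add_axis:
  assumes "\<And>j x. x \<in> V \<Longrightarrow> D j x \<in> V" "\<And>i j x. x \<in> V \<Longrightarrow> D i (D j x) = D j (D i x)" "x \<in> V"
  shows "iter_multi D (J + axis j 1) x = D j (iter_multi D J x)"
proof -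
  have pow: "(D j ^^ n) x \<in> V" if "x \<in> V" for j n x using that by (induction n) (auto intro: assms)
  have comm: "(D 1 ^^ n) (D 2 x) = D 2 ((D 1 ^^ n) x)" if "x \<in> V" for n x
  proof (induction n)
    case (Suc n)
    then show ?case using assms(2)[OF pow[OF that], of 1 2] by simp
  qed simp
  from exhaust_2[of j] show ?thesis
  proof
    assume "j = 1" then show ?thesis by (simp add: iter_multi_def axis_one_nth flip: Suc_eq_plus1)
  next
    assume "j = 2" then show ?thesis
      using comm[OF pow[OF assms(3)]] by (simp add: iter_multi_def axis_one_nth flip: Suc_eq_plus1)
  qed
qed

section \<open>Homotopy and Euler operators\<close>

definition vanishes_above :: "(2 \<Rightarrow> 'a \<Rightarrow> 'a) \<Rightarrow> nat \<Rightarrow> 'a::zero \<Rightarrow> bool" where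
  "vanishes_above S R x \<longleftrightarrow> (\<forall>K. R < mlen K \<longrightarrow> iter_multi S K x = 0)"

text \<open>The operators \<open>P\<^sup>i\<close>, the Hilbert forms and the intermediate operators of the proofs have this
shape and differ only in the coefficients, which depend on the length of the multi-index.\<close>

definition homotopy_sum ::
  "(2 \<Rightarrow> 'a \<Rightarrow> 'a) \<Rightarrow> (2 \<Rightarrow> 'a \<Rightarrow> 'a) \<Rightarrow> (nat \<Rightarrow> real) \<Rightarrow> nat \<Rightarrow> 2 \<Rightarrow> 'a \<Rightarrow> 'a::real_vector" where
  "homotopy_sum D S c R i x =
     (\<Sum>J | mlen J \<le> R. (c (mlen J) / real (mfact J)) *\<^sub>R iter_multi D J (iter_multi S (J + axis i 1) x))"

definition euler_sum ::
  "(2 \<Rightarrow> 'a \<Rightarrow> 'a) \<Rightarrow> (2 \<Rightarrow> 'a \<Rightarrow> 'a) \<Rightarrow> (nat \<Rightarrow> real) \<Rightarrow> nat \<Rightarrow> 'a \<Rightarrow> 'a::real_vector" where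
  "euler_sum D S c R x =
     (\<Sum>J | mlen J \<le> R. (c (mlen J) / real (mfact J)) *\<^sub>R iter_multi D J (iter_multi S J x))"

text \<open>The coefficients of \<open>P\<^sup>j\<^sub>(\<^sub>1\<^sub>)\<close> and \<open>P\<^sup>j\<^sub>(\<^sub>2\<^sub>)\<close> on \<open>r\<close>-forms, for two independent variables.\<close>

definition P1_coeff :: "real \<Rightarrow> nat \<Rightarrow> real" where
  "P1_coeff r n = (-1) ^ n * fact n / (r ^ (n + 1) * fact (n + 2))"

definition P2_coeff :: "real \<Rightarrow> nat \<Rightarrow> real" where
  "P2_coeff r n = (-1) ^ n / (r ^ (n + 1) * real (n + 1))"

definition euler_coeff :: "real \<Rightarrow> nat \<Rightarrow> real" where
  "euler_coeff r n = (-1) ^ n / r ^ n"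

text \<open>The relations between total derivatives and vertical contractions on the space \<open>V\<close> of smooth
forms of degree \<open>r > 0\<close>. They are restricted to \<open>V\<close> because derivatives of other forms need not
exist.\<close>

locale jet_algebra =
  fixes V :: "'a::real_vector set" and D S :: "2 \<Rightarrow> 'a \<Rightarrow> 'a" and r :: real
  assumes subspace_V: "subspace V"
    and D_in: "x \<in> V \<Longrightarrow> D j x \<in> V" and S_in: "x \<in> V \<Longrightarrow> S j x \<in> V"
    and D_add: "x \<in> V \<Longrightarrow> y \<in> V \<Longrightarrow> D j (x + y) = D j x + D j y"
    and D_scale: "x \<in> V \<Longrightarrow> D j (c *\<^sub>R x) = c *\<^sub>R D j x"
    and S_add: "x \<in> V \<Longrightarrow> y \<in> V \<Longrightarrow> S j (x + y) = S j x + S j y"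
    and S_scale: "x \<in> V \<Longrightarrow> S j (c *\<^sub>R x) = c *\<^sub>R S j x"
    and D_commute: "x \<in> V \<Longrightarrow> D i (D j x) = D j (D i x)"
    and S_commute: "x \<in> V \<Longrightarrow> S i (S j x) = S j (S i x)"
    and S_D: "x \<in> V \<Longrightarrow> S i (D j x) = D j (S i x) + (if i = j then r else 0) *\<^sub>R x"
    and r_pos: "r > 0"
begin

abbreviation "DI \<equiv> iter_multi D"
abbreviation "SI \<equiv> iter_multi S"
abbreviation "Q \<equiv> homotopy_sum D S"
abbreviation "E \<equiv> euler_sum D S"
abbreviation "vanish \<equiv> vanishes_above S"
abbreviation "p1 \<equiv> P1_coeff r"
abbreviation "p2 \<equiv> P2_coeff r"

lemmas V_simps = subspace_add[OF subspace_V] subspace_scale[OF subspace_V] subspace_0[OF subspace_V]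
  subspace_sum[OF subspace_V]

lemma DI_in: "x \<in> V \<Longrightarrow> DI J x \<in> V" by (rule iter_multi_in) (rule D_in)
lemma SI_in: "x \<in> V \<Longrightarrow> SI J x \<in> V" by (rule iter_multi_in) (rule S_in)
lemma DI_add_axis: "x \<in> V \<Longrightarrow> DI (J + axis j 1) x = D j (DI J x)"
  by (rule iter_multi_add_axis[where V = V]) (rule D_in D_commute; assumption)+
lemma SI_add_axis: "x \<in> V \<Longrightarrow> SI (J + axis j 1) x = S j (SI J x)"
  by (rule iter_multi_add_axis[where V = V]) (rule S_in S_commute; assumption)+

lemma D_zero: "D j 0 = 0"
  using D_scale[OF V_simps(3), of j 0] by simp

lemma D_sum: "(\<And>a. a \<in> X \<Longrightarrow> f a \<in> V) \<Longrightarrow> D j (\<Sum>a\<in>X. f a) = (\<Sum>a\<in>X. D j (f a))"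
proof (induction X rule: infinite_finite_induct)
  case (insert a X)
  then show ?case using D_add[of "f a" "sum f X" j] V_simps(4)[of X f] by simp
qed (simp_all add: D_zero)

lemma DI_lin:
  "x \<in> V \<Longrightarrow> y \<in> V \<Longrightarrow> DI J (x + c *\<^sub>R y) = DI J x + c *\<^sub>R DI J y"
  by (induction J rule: multi_induct) (simp_all add: DI_add_axis D_add D_scale DI_in V_simps)

lemma SI_lin:
  "x \<in> V \<Longrightarrow> y \<in> V \<Longrightarrow> SI J (x + c *\<^sub>R y) = SI J x + c *\<^sub>R SI J y"
  by (induction J rule: multi_induct) (simp_all add: SI_add_axis S_add S_scale SI_in V_simps)

lemma DI_zero: "DI J 0 = 0"
  by (induction J rule: multi_induct) (simp_all add: DI_add_axis D_zero V_simps)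

lemma DI_D: "x \<in> V \<Longrightarrow> DI J (D j x) = D j (DI J x)"
  by (induction J rule: multi_induct) (simp_all add: DI_add_axis D_in DI_in D_commute[of _ _ j])

lemma SI_D:
  assumes x: "x \<in> V"
  shows "SI K (D j x) = D j (SI K x) + (r * real (K $ j)) *\<^sub>R SI (K - axis j 1) x"
proof (induction K rule: multi_induct)
  case (2 K i)
  have "SI (K + axis i 1) (D j x) = S i (D j (SI K x) + (r * real (K $ j)) *\<^sub>R SI (K - axis j 1) x)"
    using 2 x by (simp add: SI_add_axis D_in)
  also have "\<dots> = D j (S i (SI K x)) + (if i = j then r else 0) *\<^sub>R SI K x
      + (r * real (K $ j)) *\<^sub>R SI (K - axis j 1 + axis i 1) x"
    using x by (simp add: S_add S_scale S_D D_in SI_in V_simps SI_add_axis)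
  also have "(r * real (K $ j)) *\<^sub>R SI (K - axis j 1 + axis i 1) x
      = (r * real (K $ j)) *\<^sub>R SI (if i = j then K else K + axis i 1 - axis j 1) x"
    by (cases "K $ j = 0") (auto simp: diff_add_axis diff_add_axis_other)
  finally show ?case
    using x by (cases "i = j") (simp_all add: SI_add_axis axis_one_nth scaleR_left_distrib distrib_left add_ac)
qed simp

lemma sum_vanish:
  assumes "vanish R x" "R \<le> M" and "\<And>J. f J 0 = 0"
  shows "(\<Sum>J | mlen J \<le> M. f J (SI J x)) = (\<Sum>J | mlen J \<le> R. f J (SI J x))"
  using assms by (intro sum.mono_neutral_right) (auto simp: vanishes_above_def)

lemma Q_stable:
  assumes "vanish (Suc R) x" "R \<le> M"
  shows "Q c M i x = Q c R i x"
  unfolding homotopy_sum_def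
proof (rule sum.mono_neutral_right)
  show "\<forall>J\<in>{J. mlen J \<le> M} - {J. mlen J \<le> R}. (c (mlen J) / real (mfact J)) *\<^sub>R DI J (SI (J + axis i 1) x) = 0"
    using assms(1) by (auto simp: vanishes_above_def DI_zero)
qed (use assms in auto)

lemma Q_in: "x \<in> V \<Longrightarrow> Q c R i x \<in> V"
  unfolding homotopy_sum_def by (intro V_simps(2,4) DI_in SI_in) simp

lemma Q_lin:
  assumes "x \<in> V" "y \<in> V"
  shows "Q c R i (x + a *\<^sub>R y) = Q c R i x + a *\<^sub>R Q c R i y"
  using assms by (simp add: homotopy_sum_def SI_lin DI_lin SI_in sum.distrib scaleR_sum_right scaleR_right_distrib mult.commute)

lemma Q_coeff_add: "Q (\<lambda>n. c n + a * c' n) R i x = Q c R i x + a *\<^sub>R Q c' R i x"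
  by (simp add: homotopy_sum_def add_divide_distrib scaleR_left_distrib sum.distrib scaleR_sum_right)

lemma E_stable: "vanish R x \<Longrightarrow> R \<le> M \<Longrightarrow> E c M x = E c R x"
  unfolding euler_sum_def by (rule sum_vanish) (auto simp: DI_zero)

lemma E_lin:
  assumes "x \<in> V" "y \<in> V"
  shows "E c R (x + a *\<^sub>R y) = E c R x + a *\<^sub>R E c R y"
  using assms by (simp add: euler_sum_def SI_lin DI_lin SI_in sum.distrib scaleR_sum_right scaleR_right_distrib mult.commute)

lemma E_coeff_add: "E (\<lambda>n. c n + a * c' n) R x = E c R x + a *\<^sub>R E c' R x"
  by (simp add: euler_sum_def add_divide_distrib scaleR_left_distrib sum.distrib scaleR_sum_right)

text \<open>The telescoping sums end here: all coefficients but the first cancel.\<close>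

lemma E_delta:
  assumes "\<And>n. n \<noteq> 0 \<Longrightarrow> c n = 0"
  shows "E c R x = c 0 *\<^sub>R x"
proof -
  have "E c R x = (\<Sum>J\<in>{0}. (c (mlen J) / real (mfact J)) *\<^sub>R DI J (SI J x))"
    unfolding euler_sum_def by (rule sum.mono_neutral_right) (auto simp: assms mlen_eq_0)
  then show ?thesis by simp
qed

lemma D_Q:
  assumes "x \<in> V"
  shows "D j (Q c R i x) = (\<Sum>J | mlen J \<le> R. (c (mlen J) / real (mfact J)) *\<^sub>R DI (J + axis j 1) (SI (J + axis i 1) x))"
  using assms by (simp add: homotopy_sum_def D_sum V_simps DI_in SI_in D_scale DI_add_axis)

lemma sum_D_Q:
  assumes "x \<in> V"
  shows "(\<Sum>i\<in>UNIV. D i (Q c R i x)) = E (\<lambda>n. real n * c (n - 1)) (Suc R) x"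
proof -
  have "(\<Sum>i\<in>UNIV. D i (Q c R i x))
      = (\<Sum>i\<in>UNIV. \<Sum>K | mlen K \<le> Suc R. (real (K $ i) * c (mlen K - 1) / real (mfact K)) *\<^sub>R DI K (SI K x))"
    using sum_multi_shift[where h = c and R = R and g = "\<lambda>K. DI K (SI K x)"] by (simp add: D_Q[OF assms])
  also have "\<dots> = E (\<lambda>n. real n * c (n - 1)) (Suc R) x"
    unfolding euler_sum_def by (subst sum.swap)
      (simp add: sum_2 mlen_eq add_divide_distrib distrib_right flip: scaleR_left_distrib)
  finally show ?thesis .
qed

text \<open>Moving \<open>d\<^sub>i\<close> to the left of \<open>S\<^sup>J\<^sup>+\<^sup>1\<^sup>i\<close> costs \<open>r (J(i) + 1) S\<^sup>J\<close>, and \<open>\<Sum>\<^sub>i (J(i) + 1) = |J| + 2\<close>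
for two independent variables.\<close>

lemma sum_Q_D:
  assumes "x \<in> V" "vanish R x"
  shows "(\<Sum>i\<in>UNIV. Q c R i (D i x)) = E (\<lambda>n. real n * c (n - 1) + r * real (n + 2) * c n) R x"
proof -
  have "Q c R i (D i x) = D i (Q c R i x)
      + (\<Sum>J | mlen J \<le> R. (c (mlen J) / real (mfact J)) *\<^sub>R (r * real (Suc (J $ i))) *\<^sub>R DI J (SI J x))" for i
  proof -
    have "DI J (SI (J + axis i 1) (D i x)) = DI (J + axis i 1) (SI (J + axis i 1) x)
        + (r * real (Suc (J $ i))) *\<^sub>R DI J (SI J x)" for J
      using assms(1) by (simp add: SI_D DI_lin D_in SI_in DI_D DI_add_axis axis_one_nth add.commute)
    then show ?thesis
      by (simp only: homotopy_sum_def[of D S c R i "D i x"] D_Q[OF assms(1)] scaleR_right_distrib sum.distrib)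
  qed
  then have "(\<Sum>i\<in>UNIV. Q c R i (D i x)) = E (\<lambda>n. real n * c (n - 1)) (Suc R) x
      + (\<Sum>i\<in>UNIV. \<Sum>J | mlen J \<le> R. (c (mlen J) / real (mfact J)) *\<^sub>R (r * real (Suc (J $ i))) *\<^sub>R DI J (SI J x))"
    by (simp only: sum.distrib sum_D_Q[OF assms(1)])
  also have "(\<Sum>i\<in>UNIV. \<Sum>J | mlen J \<le> R. (c (mlen J) / real (mfact J)) *\<^sub>R (r * real (Suc (J $ i))) *\<^sub>R DI J (SI J x))
      = r *\<^sub>R E (\<lambda>n. real (n + 2) * c n) R x"
    unfolding euler_sum_def scaleR_sum_right
    by (subst sum.swap, rule sum.cong)
       (simp_all add: sum_2 mlen_eq algebra_simps flip: scaleR_left_distrib add_divide_distrib)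
  also have "E (\<lambda>n. real n * c (n - 1)) (Suc R) x = E (\<lambda>n. real n * c (n - 1)) R x"
    using assms(2) by (rule E_stable) simp
  finally show ?thesis by (simp add: mult.assoc flip: E_coeff_add)
qed

text \<open>The commutator of \<open>d\<^sub>j\<close> with the homotopy sum. The terms with \<open>J(j) > 0\<close> form a
total derivative \<open>d\<^sub>j\<close> of a homotopy sum with shifted coefficients.\<close>

lemma Q_D:
  assumes x: "x \<in> V" "vanish R x"
  shows "Q c (Suc R) i (D j x) = D j (Q c (Suc R) i x)
    + (if i = j then r else 0) *\<^sub>R E c R x + r *\<^sub>R D j (Q (\<lambda>n. c (Suc n)) R i x)"
proof -
  let ?t = "\<lambda>J. c (mlen J) / real (mfact J)"
  have "DI J (SI (J + axis i 1) (D j x)) = DI (J + axis j 1) (SI (J + axis i 1) x)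
      + (if i = j then r else 0) *\<^sub>R DI J (SI J x)
      + (r * real (J $ j)) *\<^sub>R DI J (SI (J - axis j 1 + axis i 1) x)" for J
  proof -
    have "SI (J + axis i 1) (D j x) = D j (SI (J + axis i 1) x)
       + (if i = j then r else 0) *\<^sub>R SI J x + (r * real (J $ j)) *\<^sub>R SI (J - axis j 1 + axis i 1) x"
    proof (cases "i = j")
      case True
      have "(r * real (J $ j)) *\<^sub>R SI (J - axis j 1 + axis j 1) x = (r * real (J $ j)) *\<^sub>R SI J x"
        by (cases "J $ j = 0") (simp_all add: diff_add_axis)
      with True show ?thesis
        using x(1) by (simp add: SI_D axis_one_nth) (auto simp: algebra_simps)
    next
      case False
      then show ?thesis using x(1) by (simp add: SI_D diff_add_axis_other axis_one_nth)
    qed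
    then show ?thesis using x(1) by (simp add: DI_lin D_in SI_in V_simps DI_D DI_add_axis)
  qed
  then have "Q c (Suc R) i (D j x) = D j (Q c (Suc R) i x)
      + (if i = j then r else 0) *\<^sub>R E c (Suc R) x
      + r *\<^sub>R (\<Sum>J | mlen J \<le> Suc R. (real (J $ j) * c (mlen J) / real (mfact J)) *\<^sub>R DI J (SI (J - axis j 1 + axis i 1) x))"
    by (simp add: homotopy_sum_def[of D S c "Suc R" i "D j x"] D_Q[OF x(1)] euler_sum_def scaleR_right_distrib sum.distrib
       scaleR_sum_right mult_ac)
  also have "(\<Sum>J | mlen J \<le> Suc R. (real (J $ j) * c (mlen J) / real (mfact J)) *\<^sub>R DI J (SI (J - axis j 1 + axis i 1) x))
      = (\<Sum>J | mlen J \<le> Suc R. (real (J $ j) * c (Suc (mlen J - 1)) / real (mfact J)) *\<^sub>R DI J (SI (J - axis j 1 + axis i 1) x))"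
    \<comment> \<open>the factor \<open>J(j)\<close> vanishes at \<open>J = 0\<close>, so the index is a successor wherever it matters\<close>
    by (rule sum.cong) (auto dest: mlen_pos_nth)
  also have "\<dots> = (\<Sum>J | mlen J \<le> R. (c (Suc (mlen J)) / real (mfact J)) *\<^sub>R DI (J + axis j 1) (SI (J + axis i 1) x))"
    using sum_multi_shift[where h = "\<lambda>n. c (Suc n)" and R = R and i = j
        and g = "\<lambda>J. DI J (SI (J - axis j 1 + axis i 1) x)"] by simp
  also have "\<dots> = D j (Q (\<lambda>n. c (Suc n)) R i x)"
    using D_Q[OF x(1), of j "\<lambda>n. c (Suc n)" R i] by simp
  also have "E c (Suc R) x = E c R x" using x(2) by (rule E_stable) simp
  finally show ?thesis .
qed

lemma p1_eq: "p1 n = (-1) ^ n / (r ^ (n + 1) * (real (n + 1) * real (n + 2)))"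
proof -
  have "fact (n + 2) = (real (n + 1) * real (n + 2)) * (fact n :: real)"
    by (simp add: algebra_simps numeral_2_eq_2)
  then show ?thesis unfolding P1_coeff_def by simp
qed

lemma p1_rec: "r * real (n + 2) * p1 n + real n * p1 (n - 1) = (if n = 0 then 1 else 0)"
proof (cases n)
  case 0
  then show ?thesis using r_pos by (simp add: p1_eq)
next
  case (Suc m)
  define x R where "x = real m" and "R = r ^ (m + 1)"
  have nz: "x + 1 \<noteq> 0" "x + 2 \<noteq> 0" "x + 3 \<noteq> 0" "R \<noteq> 0" "r \<noteq> 0"
    using r_pos by (auto simp: x_def R_def)
  have eqs: "p1 n = - ((-1) ^ m) / (r * R * ((x + 2) * (x + 3)))" "p1 (n - 1) = (-1) ^ m / (R * ((x + 1) * (x + 2)))"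
    "real (n + 2) = x + 3" "real n = x + 1"
    unfolding p1_eq x_def R_def Suc by (simp_all add: add_ac)
  have "r * real (n + 2) * p1 n + real n * p1 (n - 1) = 0"
    unfolding eqs using nz by (simp add: divide_simps)
  then show ?thesis using Suc by simp
qed

text \<open>The two families of coefficients are linked by a discrete derivative; this is what makes the
operators \<open>P\<^sub>(\<^sub>1\<^sub>)\<close> and \<open>P\<^sub>(\<^sub>2\<^sub>)\<close> fit into one homotopy.\<close>

lemma p2_p1: "p2 n + r * p2 (Suc n) = p1 n"
proof -
  define x R where "x = real n" and "R = r ^ (n + 1)"
  have nz: "x + 1 \<noteq> 0" "x + 2 \<noteq> 0" "R \<noteq> 0" "r \<noteq> 0" using r_pos by (auto simp: x_def R_def)
  have eqs: "p2 n = (-1) ^ n / (R * (x + 1))" "p2 (Suc n) = - ((-1) ^ n) / (r * R * (x + 2))"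
    "p1 n = (-1) ^ n / (R * ((x + 1) * (x + 2)))"
    unfolding p1_eq P2_coeff_def x_def R_def by simp_all
  show ?thesis unfolding eqs using nz by (simp add: divide_simps) (simp add: algebra_simps)
qed

lemma p2_rec: "real n * p2 (n - 1) + r * real (n + 2) * p2 n - r * p2 n = (if n = 0 then 1 else 0)"
proof (cases n)
  case 0
  then show ?thesis using r_pos by (simp add: P2_coeff_def)
next
  case (Suc m)
  define x R where "x = real m" and "R = r ^ (m + 1)"
  have nz: "x + 1 \<noteq> 0" "x + 2 \<noteq> 0" "R \<noteq> 0" "r \<noteq> 0" using r_pos by (auto simp: x_def R_def)
  have eqs: "p2 n = - ((-1) ^ m) / (r * R * (x + 2))" "p2 (n - 1) = (-1) ^ m / (R * (x + 1))"
    "real (n + 2) = x + 3" "real n = x + 1"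
    unfolding P2_coeff_def x_def R_def Suc by simp_all
  have "real n * p2 (n - 1) + r * real (n + 2) * p2 n - r * p2 n = 0"
    unfolding eqs using nz by (simp add: divide_simps) (simp add: algebra_simps)
  then show ?thesis using Suc by simp
qed

text \<open>The homotopy identity \<open>d\<^sub>T P + P d\<^sub>T = id\<close> on scalar forms, where \<open>P\<close> itself vanishes.\<close>

theorem homotopy_0:
  assumes "x \<in> V" "vanish R x"
  shows "(\<Sum>i\<in>UNIV. Q p1 R i (D i x)) = x"
proof -
  have "(\<Sum>i\<in>UNIV. Q p1 R i (D i x)) = E (\<lambda>n. if n = 0 then 1 else 0) R x"
    unfolding sum_Q_D[OF assms] by (simp only: p1_rec[symmetric] add.commute)
  then show ?thesis by (simp add: E_delta)
qed

text \<open>The homotopy identity \<open>d\<^sub>T P + P d\<^sub>T = id\<close> in the middle of the complex, on the kernel of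
\<open>d\<^sub>T\<close>. The term \<open>P d\<^sub>T\<close> enters with its own coefficients: \<open>P\<^sup>i\<^sub>(\<^sub>2\<^sub>) d\<^sub>i \<phi>\<^sub>j = P\<^sup>i\<^sub>(\<^sub>2\<^sub>) d\<^sub>j \<phi>\<^sub>i\<close> is
expanded on the left by \<open>sum_Q_D\<close> and on the right by \<open>Q_D\<close>.\<close>

theorem homotopy_1:
  assumes x: "\<And>i. x i \<in> V" "\<And>i. vanish R (x i)" and closed: "\<And>i j. D i (x j) = D j (x i)"
  shows "D j (\<Sum>i\<in>UNIV. Q p1 R i (x i)) = x j"
proof -
  have van: "vanish (Suc R) (x i)" "vanish (Suc (Suc R)) (x i)" for i using x(2) by (auto simp: vanishes_above_def)
  have Q1: "Q c (Suc R) i (x i) = Q c R i (x i)" for c i using van by (intro Q_stable) auto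
  have p1_split: "p1 = (\<lambda>n. p2 n + r * p2 (Suc n))" by (rule ext) (simp add: p2_p1)
  have "(\<Sum>i\<in>UNIV. Q p2 (Suc R) i (D i (x j))) = (\<Sum>i\<in>UNIV. Q p2 (Suc R) i (D j (x i)))"
    by (simp only: closed[of _ j])
  also have "\<dots> = (\<Sum>i\<in>UNIV. D j (Q p2 R i (x i)) + r *\<^sub>R D j (Q (\<lambda>n. p2 (Suc n)) R i (x i))
      + (if i = j then r *\<^sub>R E p2 R (x j) else 0))"
    by (rule sum.cong) (auto simp: Q_D[OF x] Q1)
  also have "\<dots> = (\<Sum>i\<in>UNIV. D j (Q p1 R i (x i))) + r *\<^sub>R E p2 R (x j)"
  proof -
    have "D j (Q p2 R i (x i)) + r *\<^sub>R D j (Q (\<lambda>n. p2 (Suc n)) R i (x i)) = D j (Q p1 R i (x i))" for i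
      unfolding p1_split Q_coeff_add using x(1) by (simp add: D_add D_scale Q_in V_simps)
    then show ?thesis by (simp add: sum.distrib)
  qed
  also have "(\<Sum>i\<in>UNIV. D j (Q p1 R i (x i))) = D j (\<Sum>i\<in>UNIV. Q p1 R i (x i))"
    using x(1) by (simp add: D_sum Q_in)
  also have "(\<Sum>i\<in>UNIV. Q p2 (Suc R) i (D i (x j)))
      = E (\<lambda>n. real n * p2 (n - 1) + r * real (n + 2) * p2 n) R (x j)"
    unfolding sum_Q_D[OF x(1) van(1)] by (rule E_stable[OF x(2)]) simp
  finally have "D j (\<Sum>i\<in>UNIV. Q p1 R i (x i))
      = E (\<lambda>n. (real n * p2 (n - 1) + r * real (n + 2) * p2 n) + (- r) * p2 n) R (x j)"
    unfolding E_coeff_add by (simp add: algebra_simps)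
  also have "\<dots> = E (\<lambda>n. if n = 0 then 1 else 0) R (x j)"
    by (simp only: p2_rec[symmetric] mult_minus_left add_uminus_conv_diff)
  finally show ?thesis by (simp add: E_delta)
qed

text \<open>The Euler operator kills total derivatives, because moving \<open>d\<^sub>j\<close> to the left produces a
second sum that cancels the first after a change of index.\<close>

theorem euler_D:
  assumes x: "x \<in> V" "vanish R x"
  shows "E (euler_coeff r) (Suc R) (D j x) = 0"
proof -
  let ?e = "euler_coeff r"
  have "DI J (SI J (D j x)) = DI (J + axis j 1) (SI J x)
      + (r * real (J $ j)) *\<^sub>R DI J (SI (J - axis j 1) x)" for J
    using x(1) by (simp add: SI_D DI_lin D_in SI_in DI_D DI_add_axis)
  then have "E ?e (Suc R) (D j x)
      = (\<Sum>J | mlen J \<le> Suc R. (?e (mlen J) / real (mfact J)) *\<^sub>R DI (J + axis j 1) (SI J x))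
       + (\<Sum>J | mlen J \<le> Suc R. (real (J $ j) * (r * ?e (mlen J)) / real (mfact J)) *\<^sub>R DI J (SI (J - axis j 1) x))"
    by (simp add: euler_sum_def scaleR_right_distrib sum.distrib mult_ac)
  also have "(\<Sum>J | mlen J \<le> Suc R. (real (J $ j) * (r * ?e (mlen J)) / real (mfact J)) *\<^sub>R DI J (SI (J - axis j 1) x))
      = (\<Sum>J | mlen J \<le> Suc R. (real (J $ j) * (r * ?e (Suc (mlen J - 1))) / real (mfact J)) *\<^sub>R DI J (SI (J - axis j 1) x))"
    \<comment> \<open>as above, \<open>J = 0\<close> is excluded by the factor \<open>J(j)\<close>\<close>
    by (rule sum.cong) (auto dest: mlen_pos_nth)
  also have "\<dots> = (\<Sum>J | mlen J \<le> R. (r * ?e (Suc (mlen J)) / real (mfact J)) *\<^sub>R DI (J + axis j 1) (SI J x))"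
    using sum_multi_shift[where h = "\<lambda>n. r * ?e (Suc n)" and R = R and i = j
        and g = "\<lambda>J. DI J (SI (J - axis j 1) x)"] by simp
  also have "\<dots> = (\<Sum>J | mlen J \<le> R. - (?e (mlen J) / real (mfact J)) *\<^sub>R DI (J + axis j 1) (SI J x))"
    using r_pos by (simp add: euler_coeff_def)
  also have "(\<Sum>J | mlen J \<le> Suc R. (?e (mlen J) / real (mfact J)) *\<^sub>R DI (J + axis j 1) (SI J x))
      = (\<Sum>J | mlen J \<le> R. (?e (mlen J) / real (mfact J)) *\<^sub>R DI (J + axis j 1) (SI J x))"
    using x(2) by (rule sum_vanish) (auto simp: DI_zero)
  finally show ?thesis by (simp add: sum_negf)
qed

end

section \<open>Fundamental vector fields\<close>

lemma contract_zero: "contract A 0 = 0"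
  by (simp add: fun_eq_iff fun_apply contract_def)

lemma contract_sum: "contract A (\<Sum>a\<in>X. f a) = (\<Sum>a\<in>X. contract A (f a))"
  by (induction X rule: infinite_finite_induct) (simp_all add: contract_zero contract_add)

lemma contract_minus: "contract A (- \<phi>) = - contract A \<phi>"
  using contract_scale[of A "-1" \<phi>] by simp

lemma iter_multi_cong_hom:
  assumes "\<And>j x. h (D j x) = D' j (h x)"
  shows "h (iter_multi D J x) = iter_multi D' J (h x)"
proof -
  have "h ((D j ^^ n) x) = (D' j ^^ n) (h x)" for j n x
    by (induction n) (simp_all add: assms)
  then show ?thesis by (simp add: iter_multi_def)
qed

lemma vert_multi_add_axis:
  "iter_multi vert_endo (J + axis i 1) v = vert_endo i (iter_multi vert_endo J v)"
  by (rule iter_multi_add_axis[where V = UNIV]) (auto intro: vert_endo_commute)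

lemma vert_contract_multi_add_axis:
  "iter_multi vert_contract (J + axis i 1) \<phi> = vert_contract i (iter_multi vert_contract J \<phi>)"
  by (rule iter_multi_add_axis[where V = UNIV]) (auto intro: vert_contract_commute)

lemma vert_multi_add:
  "iter_multi vert_endo (J + K) v = iter_multi vert_endo J (iter_multi vert_endo K v)"
proof (induction J rule: multi_induct)
  case (2 J j)
  have "J + axis j 1 + K = (J + K) + axis j 1" by (simp add: add_ac)
  then show ?case using 2 by (simp only: vert_multi_add_axis)
qed simp

lemma jet_map_vert_multi: "jet_map 0 (iter_multi vert_endo K)"
proof (induction K rule: multi_induct)
  case 1
  have "iter_multi vert_endo 0 = (\<lambda>v::'a point. v)" by (simp add: fun_eq_iff)
  then show ?case using linear_id by (simp add: jet_map_def id_def continuous_on_id)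
next
  case (2 K i)
  have *: "iter_multi vert_endo (K + axis i 1) = (vert_endo i \<circ> iter_multi vert_endo K :: 'a point \<Rightarrow> _)"
    by (simp add: fun_eq_iff vert_multi_add_axis)
  show ?case unfolding * using jet_map_comp[OF jet_map_vert_endo[of i] 2] by (simp only: add_0)
qed

lemma linear_vert_multi: "linear (iter_multi vert_endo K)"
  by (rule jet_map_linear[OF jet_map_vert_multi])

text \<open>Commuting \<open>T\<^sub>l\<close> past \<open>S\<^sup>K\<close> removes one of the \<open>K(l)\<close> factors \<open>S\<^sup>l\<close> at a time.\<close>

lemma total_vert_multi:
  "total l (iter_multi vert_endo K v)
    = iter_multi vert_endo K (total l v) + real (K $ l) *\<^sub>R iter_multi vert_endo (K - axis l 1) v"
proof (induction K rule: multi_induct)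
  case (2 K i)
  note lin = jet_map_linear[OF jet_map_vert_endo[of i]]
  have "real (K $ l) *\<^sub>R iter_multi vert_endo (K - axis l 1 + axis i 1) v
      = real (K $ l) *\<^sub>R iter_multi vert_endo (if i = l then K else K + axis i 1 - axis l 1) v"
    by (cases "K $ l = 0") (auto simp: diff_add_axis diff_add_axis_other)
  moreover have "total l (iter_multi vert_endo (K + axis i 1) v)
      = iter_multi vert_endo (K + axis i 1) (total l v)
       + real (K $ l) *\<^sub>R iter_multi vert_endo (K - axis l 1 + axis i 1) v
       + (if i = l then iter_multi vert_endo K v else 0)"
    using 2 by (simp add: vert_multi_add_axis total_vert_endo linear_add[OF lin] linear_scale[OF lin])
  ultimately show ?case
    by (cases "i = l") (simp_all add: axis_one_nth scaleR_left_distrib)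
qed simp

lemma jet_map_fundamental: "jet_map 1 (fundamental_vf K j)"
proof -
  have "fundamental_vf K j = (iter_multi vert_endo K \<circ> total j :: 'a point \<Rightarrow> _)"
    by (simp add: fun_eq_iff fundamental_vf_def)
  then show ?thesis using jet_map_comp[OF jet_map_vert_multi[of K] jet_map_total[of j]] by simp
qed

lemma fundamental_vf_zero: "fundamental_vf 0 j = total j"
  by (simp add: fun_eq_iff fundamental_vf_def)

lemma vert_endo_fundamental: "vert_endo i \<circ> fundamental_vf K j = fundamental_vf (K + axis i 1) j"
  by (simp add: fun_eq_iff fundamental_vf_def vert_multi_add_axis)

text \<open>The first term is symmetric under exchange of the two fields, so the second one governs
the bracket of two fundamental fields.\<close>

lemma fundamental_vf_comp:
  "fundamental_vf M i (fundamental_vf N j p)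
    = iter_multi vert_endo (M + N) (total i (total j p)) + real (N $ i) *\<^sub>R fundamental_vf (M + (N - axis i 1)) j p"
  by (simp add: fundamental_vf_def total_vert_multi vert_multi_add linear_add[OF linear_vert_multi]
      linear_scale[OF linear_vert_multi])

lemma contract_fundamental_vert_contract:
  assumes "of_degree 1 \<phi>"
  shows "contract (fundamental_vf K j) (vert_contract i \<phi>) = contract (fundamental_vf (K + axis i 1) j) \<phi>"
  using of_degree_contract[of 0 \<phi>] assms
  by (simp add: contract_vert_contract vert_endo_fundamental vert_contract_degree_0 One_nat_def)

lemma of_degree_vert_multi: "of_degree r \<phi> \<Longrightarrow> of_degree r (iter_multi vert_contract K \<phi>)"
  by (induction K rule: multi_induct) (simp_all add: vert_contract_multi_add_axis of_degree_vert_contract)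

lemma contract_fundamental_vert_multi:
  assumes "of_degree 1 \<phi>"
  shows "contract (fundamental_vf K j) (iter_multi vert_contract I \<phi>) = contract (fundamental_vf (K + I) j) \<phi>"
proof (induction I arbitrary: K rule: multi_induct)
  case (2 I i)
  have "K + axis i 1 + I = K + (I + axis i 1)" by (simp add: add_ac)
  then show ?case
    using 2[of "K + axis i 1"] of_degree_vert_multi[OF assms, of I]
    by (simp only: vert_contract_multi_add_axis contract_fundamental_vert_contract)
qed simp

text \<open>The value of a 2-form on the pair \<open>(\<Delta>\<^sup>M\<^sub>1, \<Delta>\<^sup>N\<^sub>2)\<close>.\<close>

definition contract2 :: "nat^2 \<Rightarrow> nat^2 \<Rightarrow> 'n::finite form \<Rightarrow> 'n form" where
  "contract2 M N \<phi> = contract (fundamental_vf N 2) (contract (fundamental_vf M 1) \<phi>)"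

lemma contract2_vert_contract:
  assumes "of_degree 2 \<phi>"
  shows "contract2 M N (vert_contract i \<phi>) = contract2 (M + axis i 1) N \<phi> + contract2 M (N + axis i 1) \<phi>"
proof -
  have "of_degree 1 (contract (fundamental_vf M 1) \<phi>)"
    using assms by (intro of_degree_contract) (simp add: numeral_2_eq_2 One_nat_def)
  then show ?thesis
    by (simp add: contract2_def contract_vert_contract[of _ i \<phi>] vert_endo_fundamental contract_add
        contract_fundamental_vert_contract)
qed

text \<open>Each vertical contraction raises \<open>M\<close> or \<open>N\<close>, so a 2-form that vanishes on all pairs of
total weight at least 2 keeps doing so, and the weight of the contractions counts.\<close>

lemma contract2_vert_multi_eq_0:
  assumes "of_degree 2 \<phi>" and "\<And>M N. 2 \<le> mlen M + mlen N \<Longrightarrow> contract2 M N \<phi> = 0"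
    and "2 \<le> mlen M + mlen N + mlen K"
  shows "contract2 M N (iter_multi vert_contract K \<phi>) = 0"
  using assms(3)
proof (induction K arbitrary: M N rule: multi_induct)
  case 1
  then show ?case using assms(2)[of M N] by simp
next
  case (2 K i)
  then show ?case
    using 2(1)[of "M + axis i 1" N] 2(1)[of M "N + axis i 1"]
    by (simp add: vert_contract_multi_add_axis contract2_vert_contract of_degree_vert_multi[OF assms(1)])
qed

section \<open>Total derivatives and vertical contractions on smooth forms\<close>

context jet_domain
begin

abbreviation "LD \<equiv> \<lambda>j. Lie (total j)"

definition forms :: "nat \<Rightarrow> 'n form set" where
  "forms r = {\<phi>. of_degree r \<phi> \<and> (\<exists>N. form N \<phi>)}"

lemma formsI: "of_degree r \<phi> \<Longrightarrow> form N \<phi> \<Longrightarrow> \<phi> \<in> forms r"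
  by (auto simp: forms_def)

lemma formsE:
  assumes "\<phi> \<in> forms r" obtains N where "of_degree r \<phi>" "form N \<phi>"
  using assms by (auto simp: forms_def)

lemma subspace_forms: "subspace (forms r)"
proof (rule subspaceI)
  show "0 \<in> forms r" by (rule formsI[OF of_degree_zero form_zero])
  show "x + y \<in> forms r" if "x \<in> forms r" "y \<in> forms r" for x y
  proof -
    obtain M N where "of_degree r x" "form M x" "of_degree r y" "form N y"
      using \<open>x \<in> forms r\<close> \<open>y \<in> forms r\<close> by (auto simp: forms_def)
    then show ?thesis
      by (intro formsI[of _ _ "max M N"] of_degree_add form_add) (auto intro: form_mono)
  qed
  show "c *\<^sub>R x \<in> forms r" if "x \<in> forms r" for c x
    using that by (auto simp: forms_def intro: of_degree_scale form_scale)
qed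

lemma jet_algebra_forms: "r > 0 \<Longrightarrow> jet_algebra (forms r) LD vert_contract (real r)"
proof (unfold_locales, goal_cases)
  case 1 show ?case by (rule subspace_forms)
next
  case (2 x j) then show ?case by (auto simp: forms_def intro: of_degree_Lie form_Lie jet_map_total)
next
  case (3 x j) then show ?case by (auto simp: forms_def intro: of_degree_vert_contract form_vert_contract)
next
  case (4 x y j) then show ?case by (auto simp: forms_def intro: Lie_add jet_map_total)
next
  case (5 x j c) then show ?case by (auto simp: forms_def intro: Lie_scale jet_map_total)
next
  case (6 x y j) show ?case by (rule vert_contract_add)
next
  case (7 x j c) show ?case by (rule vert_contract_scale)
next
  case (8 x i j) then show ?case
    by (auto simp: forms_def intro!: Lie_commute jet_map_total total_commute)
next
  case (9 x i j) show ?case by (rule vert_contract_commute)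
next
  case (10 x i j) then show ?case by (auto simp: forms_def vert_contract_Lie_total)
qed simp

lemma ext_deriv_forms: "\<phi> \<in> forms r \<Longrightarrow> ext_deriv \<phi> \<in> forms (Suc r)"
  by (auto simp: forms_def intro: of_degree_ext_deriv form_ext_deriv)

lemma forms_0_eqI:
  assumes "of_degree 0 \<phi>" "of_degree 0 \<psi>" "\<And>p. \<phi> p [] = \<psi> p []"
  shows "\<phi> = \<psi>"
proof (intro ext)
  fix p vs show "\<phi> p vs = \<psi> p vs"
    using assms by (cases "vs = []") (simp_all add: of_degree_def)
qed

lemma Lie_zero: "jet_map e A \<Longrightarrow> Lie A 0 = 0"
  using Lie_scale[OF form_zero[of 0], of e A 0] by simp

lemma contract_fundamental_Lie:
  assumes "form N \<phi>"
  shows "contract (fundamental_vf K j) (LD l \<phi>)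
    = LD l (contract (fundamental_vf K j) \<phi>) + real (K $ l) *\<^sub>R contract (fundamental_vf (K - axis l 1) j) \<phi>"
proof (intro ext)
  fix p :: "'n point" and vs
  let ?X = "fundamental_vf K j"
  have "total l (?X p) = ?X (total l p) + real (K $ l) *\<^sub>R fundamental_vf (K - axis l 1) j p"
    by (simp add: fundamental_vf_def total_vert_multi total_commute[of l j])
  then have "\<phi> p (total l (?X p) # vs) = \<phi> p (?X (total l p) # vs)
      + real (K $ l) * \<phi> p (fundamental_vf (K - axis l 1) j p # vs)"
    by (simp add: form_slot1[OF assms])
  then show "contract ?X (LD l \<phi>) p vs
    = (LD l (contract ?X \<phi>) + real (K $ l) *\<^sub>R contract (fundamental_vf (K - axis l 1) j) \<phi>) p vs"
    unfolding contract_Lie[OF assms jet_map_fundamental[of K j] jet_map_total[of l]]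
    by (simp add: fun_apply contract_def[of "fundamental_vf (K - axis l 1) j"])
qed

lemma form_LD_multi: "form N \<phi> \<Longrightarrow> form (N + mlen J) (iter_multi LD J \<phi>)"
proof -
  assume f: "form N \<phi>"
  have "form (M + n) ((LD j ^^ n) \<psi>)" if "form M \<psi>" for M n j \<psi>
  proof (induction n)
    case (Suc n)
    from form_Lie[OF Suc jet_map_total[of j]] show ?case by (simp add: One_nat_def)
  qed (use that in simp)
  from this[OF this[OF f, where j = 2 and n = "J $ 2"], where j = 1 and n = "J $ 1"] show ?thesis
    by (simp add: iter_multi_def mlen_eq add_ac)
qed

lemma form_vert_multi: "form N \<phi> \<Longrightarrow> form N (iter_multi vert_contract K \<phi>)"
  by (induction K rule: multi_induct) (simp_all add: vert_contract_multi_add_axis form_vert_contract)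

lemma contract_total_LD_multi:
  assumes "form N \<phi>"
  shows "contract (total j) (iter_multi LD J \<phi>) = iter_multi LD J (contract (total j) \<phi>)"
proof -
  have step: "contract (total j) (LD l \<psi>) = LD l (contract (total j) \<psi>)" if "form M \<psi>" for M l \<psi>
    using contract_fundamental_Lie[OF that, of 0 j l] by (simp add: fundamental_vf_zero)
  have "(\<exists>M. form M ((LD l ^^ n) \<psi>)) \<and> contract (total j) ((LD l ^^ n) \<psi>) = (LD l ^^ n) (contract (total j) \<psi>)"
    if "\<exists>M. form M \<psi>" for l n \<psi>
    using that by (induction n) (auto simp: step dest: form_Lie[OF _ jet_map_total])
  then show ?thesis using assms unfolding iter_multi_def comp_def by (metis (no_types, lifting))
qed

text \<open>By the commutation rule, the contractions with all fundamental fields and total derivatives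
vanish together along the iteration.\<close>

lemma contract_fundamental_LD_multi_eq_0:
  assumes "form N \<phi>" "\<And>K j. contract (fundamental_vf K j) \<phi> = 0"
  shows "contract (fundamental_vf K j) (iter_multi LD J \<phi>) = 0"
proof -
  let ?P = "\<lambda>\<psi>. (\<exists>N. form N \<psi>) \<and> (\<forall>K j. contract (fundamental_vf K j) \<psi> = 0)"
  have "?P (LD l \<psi>)" if P: "?P \<psi>" for l \<psi>
  proof -
    obtain N where N: "form N \<psi>" using P by blast
    then have "form (N + 1) (LD l \<psi>)" by (rule form_Lie) (rule jet_map_total)
    moreover have "contract (fundamental_vf K j) (LD l \<psi>) = 0" for K j
      using P by (simp add: contract_fundamental_Lie[OF N] Lie_zero[OF jet_map_total])
    ultimately show ?thesis by blast
  qed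
  then have pow: "?P ((LD l ^^ n) \<psi>)" if "?P \<psi>" for l n \<psi>
    using that by (induction n) simp_all
  have "?P \<phi>" using assms by blast
  from pow[OF pow[OF this]] show ?thesis unfolding iter_multi_def comp_def by blast
qed

text \<open>Values outside \<open>W\<close> carry no information; setting them to zero makes the operators act on
honest elements of the space of smooth forms.\<close>

definition cut :: "'n form \<Rightarrow> 'n form" where
  "cut \<phi> = (\<lambda>p vs. if p \<in> W then \<phi> p vs else 0)"

lemma ext_d_cong:
  assumes "\<And>q vs. q \<in> W \<Longrightarrow> \<phi> q vs = \<psi> q vs" "p \<in> W"
  shows "ext_d \<phi> p vs = ext_d \<psi> p vs"
  unfolding ext_d_def using assms by (intro sum.cong refl arg_cong[where f = "(*) _"] dir_deriv_cong) auto

lemma cut_ext_deriv: "cut (ext_d \<phi>) = ext_deriv (cut \<phi>)"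
  using ext_d_cong[of \<phi> "cut \<phi>"] by (auto simp: fun_eq_iff cut_def ext_deriv_def)

lemma cut_lie: "cut (lie (total j) \<phi>) = LD j (cut \<phi>)"
proof -
  have "lie (total j) \<phi> p vs = lie (total j) (cut \<phi>) p vs" if "p \<in> W" for p vs
    unfolding lie_def contract_def using that
    by (intro arg_cong2[where f = "(+)"] ext_d_cong) (auto simp: cut_def)
  then show ?thesis by (auto simp: fun_eq_iff cut_def[of "lie _ _"] Lie_eq_lie)
qed

lemma cut_vert_contract: "cut (vert_contract i \<phi>) = vert_contract i (cut \<phi>)"
  by (auto simp: fun_eq_iff cut_def vert_contract_def)

lemma cut_d_multi: "cut (d_multi J \<phi>) = iter_multi LD J (cut \<phi>)"
  unfolding d_multi_def by (rule iter_multi_cong_hom[where h = cut]) (rule cut_lie)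

lemma cut_vert_contract_multi: "cut (vert_contract_multi J \<phi>) = iter_multi vert_contract J (cut \<phi>)"
  unfolding vert_contract_multi_def by (rule iter_multi_cong_hom[where h = cut]) (rule cut_vert_contract)

end

section \<open>The Hilbert forms and the fundamental form\<close>

text \<open>The local representative of a Lagrangian of order \<open>k\<close> in one chart.\<close>

locale jet_lagrangian = jet_domain W for W :: "'n::finite point set" +
  fixes F :: "'n point \<Rightarrow> real" and k :: nat
  assumes smooth_F: "smooth_fun W F"
    and order_F: "p \<in> W \<Longrightarrow> q \<in> W \<Longrightarrow> agree k p q \<Longrightarrow> F p = F q"
    and k_pos: "1 \<le> k"
begin

definition L :: "'n form" where "L = cut (fun_form F)"

lemma L_deg: "of_degree 0 L"
  by (simp add: L_def cut_def of_degree_def fun_form_def)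

lemma L_form: "form k L"
proof (rule formI)
  show "smooth_fun W (\<lambda>p. L p vs)" for vs
    by (cases "vs = []") (simp_all add: L_def cut_def fun_form_def smooth_cut smooth_F smooth_fun_const)
  show "L p vs = L q ws" if "p \<in> W" "q \<in> W" "agree k p q" "list_all2 (agree k) vs ws" for p q vs ws
    using order_F[OF that(1-3)] that(4) by (cases vs; cases ws) (auto simp: L_def cut_def fun_form_def that(1,2))
qed (simp_all add: L_def cut_def fun_form_def)

definition dL :: "'n form" where "dL = ext_deriv L"

lemma dL_deg: "of_degree 1 dL"
  using of_degree_ext_deriv[OF L_deg] by (simp add: dL_def One_nat_def)

lemma dL_form: "form k dL"
  unfolding dL_def by (rule form_ext_deriv[OF L_form])

lemma dL_forms: "dL \<in> forms 1"
  by (rule formsI[OF dL_deg dL_form])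

lemma cut_dF: "cut (ext_d (fun_form F)) = dL"
  by (simp add: cut_ext_deriv dL_def L_def)

sublocale J1: jet_algebra "forms 1" LD vert_contract 1
  using jet_algebra_forms[of 1] by simp

sublocale J2: jet_algebra "forms 2" LD vert_contract 2
  using jet_algebra_forms[of 2] by simp_all

sublocale J3: jet_algebra "forms 3" LD vert_contract 3
  using jet_algebra_forms[of 3] by simp_all

lemma vanish_form: "form N \<phi> \<Longrightarrow> of_degree r \<phi> \<Longrightarrow> r * N \<le> R \<Longrightarrow> J1.vanish R \<phi>"
  unfolding vanishes_above_def using vert_contract_multi_eq_0[of N \<phi> r] by auto

lemma form_sum: "(\<And>a. a \<in> X \<Longrightarrow> form N (f a)) \<Longrightarrow> form N (\<Sum>a\<in>X. f a)"
  by (induction X rule: infinite_finite_induct) (auto intro: form_zero form_add)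

text \<open>The coefficients of \<open>P\<^sup>j\<^sub>(\<^sub>2\<^sub>)\<close> on 1-forms, since the Hilbert forms are the components of
\<open>P dL\<close>.\<close>

definition hilbert_coeff :: "nat \<Rightarrow> real" where
  "hilbert_coeff n = (-1) ^ n / real (n + 1)"

definition \<theta> :: "2 \<Rightarrow> 'n form" where
  "\<theta> i = J1.Q hilbert_coeff (k - 1) i dL"

lemma \<theta>_forms: "\<theta> i \<in> forms 1"
  unfolding \<theta>_def by (rule J1.Q_in[OF dL_forms])

lemma \<theta>_deg: "of_degree 1 (\<theta> i)"
  using \<theta>_forms by (simp add: forms_def)

lemma \<theta>_form: "form (2 * k - 1) (\<theta> i)"
  unfolding \<theta>_def homotopy_sum_def
proof (intro form_sum form_scale)
  fix J assume "J \<in> {J. mlen J \<le> k - 1}"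
  then have "k + mlen J \<le> 2 * k - 1" using k_pos by simp
  with form_LD_multi[OF form_vert_multi[OF dL_form]]
  show "form (2 * k - 1) (iter_multi LD J (iter_multi vert_contract (J + axis i 1) dL))"
    by (rule form_mono)
qed

text \<open>The term with \<open>|I| = k\<close> in the definition of the Hilbert forms contains \<open>k + 1\<close> vertical
contractions of a 1-form of order \<open>k\<close>.\<close>

lemma \<theta>_eq: "J1.Q hilbert_coeff k i dL = \<theta> i"
  unfolding \<theta>_def
  by (rule J1.Q_stable) (use vanish_form[OF dL_form dL_deg, of "Suc (k - 1)"] k_pos in auto)

lemma cut_sum_scale:
  "cut (\<lambda>p vs. \<Sum>J\<in>X. c J * f J p vs) = (\<Sum>J\<in>X. c J *\<^sub>R cut (f J))"
  by (simp add: fun_eq_iff cut_def sum_fun_apply scaleR_fun_apply)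

lemma cut_hilbert: "cut (hilbert_form k F i) = \<theta> i"
proof -
  have "cut (hilbert_form k F i)
      = (\<Sum>I | mlen I \<le> k. ((-1) ^ mlen I / (real (mfact I) * (real (mlen I) + 1)))
          *\<^sub>R cut (d_multi I (vert_contract_multi (I + axis i 1) (ext_d (fun_form F)))))"
    unfolding hilbert_form_def cut_sum_scale ..
  also have "\<dots> = J1.Q hilbert_coeff k i dL"
    unfolding homotopy_sum_def cut_d_multi cut_vert_contract_multi cut_dF hilbert_coeff_def
    by (simp add: mult.commute)
  finally show ?thesis by (simp only: \<theta>_eq)
qed

lemma cut_euler_lagrange: "cut (euler_lagrange_form k F) = dL - (\<Sum>i\<in>UNIV. LD i (\<theta> i))"
proof -
  have "cut (euler_lagrange_form k F) = cut (ext_d (fun_form F)) - (\<Sum>i\<in>UNIV. cut (lie (total i) (hilbert_form k F i)))"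
    by (auto simp: fun_eq_iff cut_def euler_lagrange_form_def sum_fun_apply minus_apply)
  then show ?thesis by (simp only: cut_dF cut_lie cut_hilbert)
qed

lemma cut_P_scalar:
  "cut (P_scalar K r s j \<phi>) = J1.Q (\<lambda>n. (-1) ^ n * fact (2 - s) * fact n
      / (real r ^ (n + 1) * fact (2 - s + n + 1))) (r * K - 1) j (cut \<phi>)"
proof -
  have "cut (P_scalar K r s j \<phi>) = (\<Sum>J | mlen J \<le> r * K - 1.
     ((-1) ^ mlen J * fact (2 - s) * fact (mlen J)
       / (real r ^ (mlen J + 1) * fact (2 - s + mlen J + 1) * real (mfact J)))
       *\<^sub>R cut (d_multi J (vert_contract_multi (J + axis j 1) \<phi>)))"
    unfolding P_scalar_def cut_sum_scale ..
  then show ?thesis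
    by (simp add: homotopy_sum_def cut_d_multi cut_vert_contract_multi)
qed

lemma cut_Theta1: "cut (Theta1 k F ws) = (\<Sum>j\<in>UNIV. d2t (axis j 1 # ws) *\<^sub>R \<theta> j)"
proof -
  have "cut (fun_form (\<lambda>p. F p * c)) = c *\<^sub>R L" for c
    by (simp add: fun_eq_iff cut_def fun_form_def L_def scaleR_fun_apply)
  then have d: "cut (ext_d (fun_form (\<lambda>p. F p * c))) = c *\<^sub>R dL" for c
    by (simp add: cut_ext_deriv ext_deriv_scale[OF L_form] dL_def)
  have coeff: "(\<lambda>n. (-1) ^ n * fact (2 - 2) * fact n / (real 1 ^ (n + 1) * fact (2 - 2 + n + 1)))
      = hilbert_coeff"
    by (rule ext) (simp add: hilbert_coeff_def Suc_eq_plus1[symmetric])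
  have Q_scale: "J1.Q c R j (a *\<^sub>R dL) = a *\<^sub>R J1.Q c R j dL" for a c R j
    \<comment> \<open>linearity at \<open>0 + a dL\<close>; the second instance gives the value 0 at 0\<close>
    using J1.Q_lin[OF J1.V_simps(3) dL_forms, of c R j a] J1.Q_lin[OF J1.V_simps(3) J1.V_simps(3), of c R j "-1"]
    by simp
  have "cut (Theta1 k F ws)
     = (\<Sum>j\<in>UNIV. cut (P_scalar k 1 2 j (ext_d (fun_form (\<lambda>p. F p * d2t (axis j 1 # ws))))))"
    by (simp add: fun_eq_iff cut_def Theta1_def P_op_def d_class_Theta0 vext_d_def sum_fun_apply)
  also have "\<dots> = (\<Sum>j\<in>UNIV. d2t (axis j 1 # ws) *\<^sub>R \<theta> j)"
    unfolding cut_P_scalar coeff d Q_scale by (simp add: \<theta>_def)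
  finally show ?thesis .
qed

text \<open>The components of \<open>d\<Theta>\<^sub>1\<close>. The signs come from contracting the area element with the basis
vectors.\<close>

definition \<omega> :: "2 \<Rightarrow> 'n form" where
  "\<omega> i = (if i = 1 then - ext_deriv (\<theta> 2) else ext_deriv (\<theta> 1))"

lemma \<omega>_simps: "\<omega> 1 = - ext_deriv (\<theta> 2)" "\<omega> 2 = ext_deriv (\<theta> 1)"
  by (simp_all add: \<omega>_def)

lemma \<omega>_form: "form (2 * k - 1) (\<omega> i)"
  unfolding \<omega>_def using form_scale[OF form_ext_deriv[OF \<theta>_form], of "-1"] form_ext_deriv[OF \<theta>_form] by auto

lemma ext_deriv_\<theta>_deg: "of_degree 2 (ext_deriv (\<theta> i))"
  using of_degree_ext_deriv[OF \<theta>_deg] by (simp add: numeral_2_eq_2 One_nat_def)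

lemma \<omega>_deg: "of_degree 2 (\<omega> i)"
  unfolding \<omega>_def using of_degree_scale[OF ext_deriv_\<theta>_deg, of "-1"] ext_deriv_\<theta>_deg by auto

lemma \<omega>_forms: "\<omega> i \<in> forms 2"
  by (rule formsI[OF \<omega>_deg \<omega>_form])

definition \<Theta> :: "'n form" where
  "\<Theta> = (\<Sum>i\<in>UNIV. J1.Q (P1_coeff 2) (2 * (2 * k - 1) - 1) i (\<omega> i))"

lemma \<Theta>_forms: "\<Theta> \<in> forms 2"
  unfolding \<Theta>_def by (intro J2.V_simps(4) J2.Q_in \<omega>_forms)

lemma cut_Theta2: "cut (Theta2 k F []) = \<Theta>"
proof -
  have coeff: "(\<lambda>n. (-1) ^ n * fact (2 - 1) * fact n / (real 2 ^ (n + 1) * fact (2 - 1 + n + 1))) = P1_coeff 2"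
  proof
    fix n :: nat
    have "2 - 1 + n + 1 = n + 2" by simp
    then show "(-1) ^ n * fact (2 - 1) * fact n / (real 2 ^ (n + 1) * fact (2 - 1 + n + 1)) = P1_coeff 2 n"
      by (simp only: P1_coeff_def) simp
  qed
  have t1: "cut (Theta1 k F [axis 1 1]) = - \<theta> 2" and t2: "cut (Theta1 k F [axis 2 1]) = \<theta> 1"
    by (simp_all add: cut_Theta1 sum_2 d2t_def axis_def)
  have \<omega>: "cut (ext_d (Theta1 k F [axis i 1])) = \<omega> i" for i
    using exhaust_2[of i]
    by (elim disjE) (simp_all add: cut_ext_deriv t1 t2 \<omega>_def ext_deriv_minus[OF \<theta>_form])
  have "cut (Theta2 k F []) = (\<Sum>i\<in>UNIV. cut (P_scalar (2 * k - 1) 2 1 i (ext_d (Theta1 k F [axis i 1]))))"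
    by (simp add: fun_eq_iff cut_def Theta2_def P_op_def vext_d_def sum_fun_apply)
  also have "\<dots> = \<Theta>"
    unfolding cut_P_scalar coeff \<omega> \<Theta>_def ..
  finally show ?thesis .
qed

text \<open>Both homotopy identities are needed: the second recovers \<open>d\<Theta>\<^sub>1\<close> from \<open>\<Theta>\<^sub>2\<close>, the first turns
\<open>d\<^sub>j d\<Theta>\<^sub>2 = 0\<close> into \<open>d\<Theta>\<^sub>2 = 0\<close>.\<close>

theorem closed_if_null:
  assumes "dL = (\<Sum>i\<in>UNIV. LD i (\<theta> i))"
  shows "ext_deriv \<Theta> = 0"
proof -
  have "ext_deriv dL = 0" unfolding dL_def by (rule ext_deriv_ext_deriv[OF L_form])
  then have "LD 1 (ext_deriv (\<theta> 1)) + LD 2 (ext_deriv (\<theta> 2)) = 0"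
    by (simp add: assms sum_2 ext_deriv_add[OF form_Lie form_Lie, OF \<theta>_form jet_map_total \<theta>_form jet_map_total]
      ext_deriv_Lie[OF \<theta>_form jet_map_total])
  then have "LD 1 (\<omega> 2) = LD 2 (\<omega> 1)"
    by (simp add: \<omega>_simps Lie_minus[OF form_ext_deriv[OF \<theta>_form] jet_map_total] add_eq_0_iff)
  then have closed: "LD i (\<omega> j) = LD j (\<omega> i)" for i j
    using exhaust_2[of i] exhaust_2[of j] by auto
  have van: "J1.vanish (2 * (2 * k - 1)) (\<omega> i)" for i
    by (rule vanish_form[OF \<omega>_form \<omega>_deg]) simp
  have "\<Theta> = (\<Sum>i\<in>UNIV. J1.Q (P1_coeff 2) (2 * (2 * k - 1)) i (\<omega> i))"
    unfolding \<Theta>_def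
    by (intro sum.cong refl J2.Q_stable[symmetric]) (use van k_pos in simp_all)
  then have "LD j \<Theta> = \<omega> j" for j
    using J2.homotopy_1[OF \<omega>_forms van closed, of j] by simp
  moreover obtain N where N: "form N \<Theta>" "of_degree 2 \<Theta>" using \<Theta>_forms by (rule formsE)
  moreover have "ext_deriv (\<omega> j) = 0" for j
    unfolding \<omega>_def by (simp add: ext_deriv_minus[OF form_ext_deriv[OF \<theta>_form]] ext_deriv_ext_deriv[OF \<theta>_form])
  ultimately have "LD j (ext_deriv \<Theta>) = 0" for j
    using ext_deriv_Lie[OF N(1) jet_map_total[of j]] by simp
  moreover have d\<Theta>: "ext_deriv \<Theta> \<in> forms 3" using ext_deriv_forms[OF \<Theta>_forms] by (simp add: numeral_eq_Suc)
  moreover have "J1.vanish (3 * N) (ext_deriv \<Theta>)"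
    using d\<Theta> by (intro vanish_form[OF form_ext_deriv[OF N(1)], of 3]) (simp_all add: forms_def)
  moreover have "J1.Q c R i 0 = 0" for c R i
    using J1.Q_lin[OF J1.V_simps(3) J1.V_simps(3), of c R i "-1"] by simp
  ultimately show ?thesis using J3.homotopy_0[of "ext_deriv \<Theta>" "3 * N"] by simp
qed

end

section \<open>Homogeneous Lagrangians\<close>

locale homogeneous_lagrangian = jet_lagrangian +
  assumes homogeneous_1: "p \<in> W \<Longrightarrow> dir_deriv (fundamental_vf (axis i 1) j p) F p = (if i = j then F p else 0)"
    and homogeneous_2: "p \<in> W \<Longrightarrow> 2 \<le> mlen I \<Longrightarrow> dir_deriv (fundamental_vf I j p) F p = 0"
begin

lemma dirD_L: "dirD v L p [] = (if p \<in> W then dir_deriv v F p else 0)"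
proof -
  have "dir_deriv v (\<lambda>q. L q []) p = dir_deriv v F p" if "p \<in> W"
    by (rule dir_deriv_cong[OF _ that]) (simp add: L_def cut_def fun_form_def)
  then show ?thesis by (simp add: dirD_def)
qed

text \<open>Homogeneity, read as a statement about \<open>dL\<close>.\<close>

lemma contract_dL:
  assumes "1 \<le> mlen K"
  shows "contract (fundamental_vf K j) dL = (if K = axis j 1 then L else 0)"
proof (rule forms_0_eqI)
  show "of_degree 0 (contract (fundamental_vf K j) dL)"
    using dL_deg by (intro of_degree_contract) (simp add: One_nat_def)
  show "of_degree 0 (if K = axis j 1 then L else 0)" by (simp add: L_deg of_degree_zero)
  fix p
  have c: "contract (fundamental_vf K j) dL p [] = dirD (fundamental_vf K j p) L p []"
    by (simp add: contract_def dL_def ext_deriv_Cons)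
  show "contract (fundamental_vf K j) dL p [] = (if K = axis j 1 then L else 0) p []"
  proof (cases "mlen K = 1")
    case True
    then obtain i where K: "K = axis i 1"
    proof -
      obtain i where "K $ i \<noteq> 0" using True mlen_eq_0[of K] by (auto simp: vec_eq_iff)
      then have "mlen (K - axis i 1) = 0" "K - axis i 1 + axis i 1 = K"
        using True by (simp_all add: mlen_diff_axis diff_add_axis)
      then have "K = axis i 1" by (simp add: mlen_eq_0)
      then show thesis by (rule that)
    qed
    have "(axis i 1 :: nat^2) = axis j 1 \<longleftrightarrow> i = j" by (simp add: axis_eq_axis)
    then show ?thesis unfolding c unfolding K dirD_L
      by (auto simp: homogeneous_1 L_def cut_def fun_form_def fun_apply)
  next
    case False
    then have "2 \<le> mlen K" using assms by simp
    moreover have "K \<noteq> axis j 1" using False by auto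
    ultimately show ?thesis unfolding c dirD_L by (simp add: homogeneous_2 fun_apply)
  qed
qed

text \<open>In \<open>\<theta>\<^sup>i\<close> only the term without total derivatives contributes: the others contain at least two
vertical contractions, so by homogeneity they vanish on all total derivatives and fundamental
fields, and total derivatives preserve this.\<close>

lemma contract_\<theta>: "contract (fundamental_vf K j) (\<theta> i) = (if K = 0 \<and> i = j then L else 0)"
proof -
  let ?X = "fundamental_vf K j"
  have "contract ?X (iter_multi LD J (iter_multi vert_contract (J + axis i 1) dL)) = 0" if "J \<noteq> 0" for J
  proof (rule contract_fundamental_LD_multi_eq_0[OF form_vert_multi[OF dL_form]])
    fix M l
    have "mlen M + mlen J + 1 = mlen (M + (J + axis i 1))" by (simp add: mlen_add)
    moreover have "1 \<le> mlen J" using that mlen_eq_0[of J] by simp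
    ultimately have "2 \<le> mlen (M + (J + axis i 1))" by simp
    then have "M + (J + axis i 1) \<noteq> axis l 1" "1 \<le> mlen (M + (J + axis i 1))" by (auto simp del: mlen_add_axis dest: arg_cong[where f = mlen])
    then show "contract (fundamental_vf M l) (iter_multi vert_contract (J + axis i 1) dL) = 0"
      unfolding contract_fundamental_vert_multi[OF dL_deg] by (simp add: contract_dL)
  qed
  then have "contract ?X (\<theta> i) = (\<Sum>J\<in>{0}. (hilbert_coeff (mlen J) / real (mfact J)) *\<^sub>R
      contract ?X (iter_multi LD J (iter_multi vert_contract (J + axis i 1) dL)))"
    unfolding \<theta>_def homotopy_sum_def contract_sum contract_scale
    by (intro sum.mono_neutral_right) auto
  also have "\<dots> = contract (fundamental_vf (K + axis i 1) j) dL"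
    using contract_fundamental_vert_multi[OF dL_deg, of K j "axis i 1"] by (simp add: hilbert_coeff_def)
  also have "\<dots> = (if K = 0 \<and> i = j then L else 0)"
  proof -
    have "K + axis i 1 = axis j 1 \<longleftrightarrow> K = 0 \<and> i = j"
    proof
      assume eq: "K + axis i 1 = axis j 1"
      have "mlen (K + axis i 1) = 1" unfolding eq by simp
      then have "K = 0" using mlen_eq_0[of K] by simp
      with eq show "K = 0 \<and> i = j" by (simp add: axis_eq_axis)
    qed simp
    then show ?thesis by (simp add: contract_dL)
  qed
  finally show ?thesis .
qed

text \<open>The invariant formula for the exterior derivative of a 1-form, evaluated on two linear fields,
together with the bracket of the fundamental fields.\<close>

lemma contract2_ext_deriv:
  assumes "form N \<phi>" "of_degree 1 \<phi>"
  shows "contract2 M N' (ext_deriv \<phi>) p []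
    = dirD (fundamental_vf M 1 p) (contract (fundamental_vf N' 2) \<phi>) p []
     - dirD (fundamental_vf N' 2 p) (contract (fundamental_vf M 1) \<phi>) p []
     + real (N' $ 1) * contract (fundamental_vf (M + (N' - axis 1 1)) 2) \<phi> p []
     - real (M $ 2) * contract (fundamental_vf (N' + (M - axis 2 1)) 1) \<phi> p []"
proof -
  let ?A = "fundamental_vf M 1" and ?B = "fundamental_vf N' 2"
  have "contract ?A (ext_deriv \<phi>) = Lie ?A \<phi> - ext_deriv (contract ?A \<phi>)" by (simp add: Lie_def)
  then have "contract2 M N' (ext_deriv \<phi>) p []
      = contract ?B (Lie ?A \<phi>) p [] - ext_deriv (contract ?A \<phi>) p [?B p]"
    by (simp add: contract2_def contract_def[of ?B] minus_apply)
  also have "ext_deriv (contract ?A \<phi>) p [?B p] = dirD (?B p) (contract ?A \<phi>) p []"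
    by (simp add: ext_deriv_Cons)
  also have "contract ?B (Lie ?A \<phi>) p [] = dirD (?A p) (contract ?B \<phi>) p [] + (\<phi> p [?A (?B p)] - \<phi> p [?B (?A p)])"
    unfolding contract_Lie[OF assms(1) jet_map_fundamental jet_map_fundamental] Lie_Nil by simp
  also have "\<phi> p [?A (?B p)] - \<phi> p [?B (?A p)]
      = real (N' $ 1) * contract (fundamental_vf (M + (N' - axis 1 1)) 2) \<phi> p []
       - real (M $ 2) * contract (fundamental_vf (N' + (M - axis 2 1)) 1) \<phi> p []"
    unfolding fundamental_vf_comp form_slot1[OF assms(1)]
    by (simp add: contract_def add.commute[of M N'] total_commute[of 1 2])
  finally show ?thesis by simp
qed

lemma of_degree_contract2: "of_degree 2 \<phi> \<Longrightarrow> of_degree 0 (contract2 M N \<phi>)"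
  unfolding contract2_def by (intro of_degree_contract) (simp add: numeral_2_eq_2)

text \<open>Every term of the invariant formula contains either a derivative of \<open>L\<close> of weight at least
2 or a contraction of \<open>\<theta>\<^sup>i\<close> with a fundamental field.\<close>

lemma contract2_ext_deriv_\<theta>:
  assumes "2 \<le> mlen M + mlen N"
  shows "contract2 M N (ext_deriv (\<theta> i)) = 0"
proof (rule forms_0_eqI[OF of_degree_contract2[OF ext_deriv_\<theta>_deg] of_degree_zero])
  fix p
  have 0: "dirD v 0 p [] = 0" for v by (simp add: dirD_def dir_deriv_def fun_apply)
  have z: "real (J $ l) * contract (fundamental_vf (K + (J - axis l 1)) j) (\<theta> i) p [] = 0"
    if "2 \<le> mlen K + mlen J" for J K l j
  proof (cases "J $ l = 0")
    case False
    then have "mlen (K + (J - axis l 1)) = mlen K + mlen J - 1" 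
      using mlen_diff_axis[OF False] mlen_pos_nth[of J l] False by (simp add: mlen_add)
    then have "K + (J - axis l 1) \<noteq> 0" using that by auto
    then show ?thesis by (simp add: contract_\<theta> fun_apply)
  qed simp
  have d: "dirD (fundamental_vf K l p) (contract (fundamental_vf J j) (\<theta> i)) p [] = 0"
    if "2 \<le> mlen K + mlen J" for J K l j
  proof (cases "J = 0")
    case True
    with that have "2 \<le> mlen K" by simp
    then show ?thesis using True by (simp add: contract_\<theta> dirD_L homogeneous_2 0)
  qed (simp add: contract_\<theta> 0)
  have swap: "2 \<le> mlen N + mlen M" using assms by simp
  show "contract2 M N (ext_deriv (\<theta> i)) p [] = 0 p []"
    unfolding contract2_ext_deriv[OF \<theta>_form \<theta>_deg]
    using z[OF assms, of 1 2] z[OF swap, of 2 1] d[OF assms, of 1 2] d[OF swap, of 2 1]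
    by (simp only: zero_fun_apply diff_self add_0_right)
qed

text \<open>For \<open>i \<noteq> l\<close> one of the two pairs of weight 1 contributes through the derivative of \<open>L\<close>
along \<open>\<Delta>\<^sup>l\<^sub>l\<close>, the other through the bracket with a total derivative.\<close>

lemma contract2_vert_ext_deriv_\<theta>:
  "contract2 0 0 (vert_contract l (ext_deriv (\<theta> i)))
    = (if l = 1 \<and> i = 2 then 2 else if l = 2 \<and> i = 1 then -2 else 0) *\<^sub>R L"
proof (rule forms_0_eqI)
  show "of_degree 0 (contract2 0 0 (vert_contract l (ext_deriv (\<theta> i))))"
    by (intro of_degree_contract2 of_degree_vert_contract ext_deriv_\<theta>_deg)
  fix p
  have 0: "dirD v 0 p [] = 0" for v by (simp add: dirD_def dir_deriv_def fun_apply)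
  have ax: "(axis l 1 :: nat^2) \<noteq> 0" for l :: 2
    using mlen_axis[of l] by (auto simp del: mlen_axis)
  have dL': "dirD (fundamental_vf (axis i 1) j p) L p [] = (if i = j then L p [] else 0)" for i j
    unfolding dirD_L by (simp add: homogeneous_1) (simp add: L_def cut_def fun_form_def)
  show "contract2 0 0 (vert_contract l (ext_deriv (\<theta> i))) p []
      = ((if l = 1 \<and> i = 2 then 2 else if l = 2 \<and> i = 1 then -2 else 0) *\<^sub>R L) p []"
    unfolding contract2_vert_contract[OF ext_deriv_\<theta>_deg]
    using exhaust_2[of l] exhaust_2[of i] ax[of 1] ax[of 2]
    by (auto simp: contract2_ext_deriv[OF \<theta>_form \<theta>_deg] contract_\<theta> 0 dL' fun_apply axis_one_nth)
qed (rule of_degree_scale[OF L_deg])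

text \<open>The Lagrangian is recovered from its fundamental form. The factor \<open>1/4\<close> is the coefficient of
\<open>S\<^sup>i\<close> in \<open>P\<^sup>i\<close>, and each of the two summands of \<open>\<Theta>\<^sub>2\<close> contributes \<open>- 2 L\<close>.\<close>

lemma contract2_\<Theta>: "contract (total 2) (contract (total 1) \<Theta>) = - L"
proof -
  let ?c = "contract2 0 0"
  have c: "?c \<phi> = contract (total 2) (contract (total 1) \<phi>)" for \<phi> :: "'a form"
    by (simp add: contract2_def fundamental_vf_zero)
  have c_sum: "?c (\<Sum>a\<in>X. f a) = (\<Sum>a\<in>X. ?c (f a))" for f :: "'b \<Rightarrow> 'a form" and X
    by (simp add: contract2_def contract_sum)
  have c_scale: "?c (a *\<^sub>R \<phi>) = a *\<^sub>R ?c \<phi>" for a and \<phi> :: "'a form"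
    by (simp add: contract2_def contract_scale)
  have c_minus: "?c (- \<phi>) = - ?c \<phi>" for \<phi> :: "'a form"
    by (simp add: contract2_def contract_minus)
  have \<omega>0: "contract2 M N (\<omega> i) = 0" if "2 \<le> mlen M + mlen N" for M N i
    using contract2_ext_deriv_\<theta>[OF that] by (simp add: \<omega>_def contract2_def contract_minus)
  have "?c (iter_multi LD J (iter_multi vert_contract (J + axis i 1) (\<omega> i))) = 0" if "J \<noteq> 0" for i J
  proof -
    have f: "form (2 * k - 1) (iter_multi vert_contract (J + axis i 1) (\<omega> i))"
      by (rule form_vert_multi[OF \<omega>_form])
    have "1 \<le> mlen J" using that mlen_eq_0[of J] by simp
    then have "?c (iter_multi vert_contract (J + axis i 1) (\<omega> i)) = 0"
      by (intro contract2_vert_multi_eq_0[OF \<omega>_deg]) (simp_all add: \<omega>0)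
    moreover have "iter_multi LD J 0 = 0"
      using J1.DI_zero .
    ultimately show ?thesis
      using contract_total_LD_multi[OF form_contract[OF f jet_map_total[of 1]], of 2 J]
        contract_total_LD_multi[OF f, of 1 J]
      by (simp add: c)
  qed
  then have "?c (J1.Q (P1_coeff 2) R i (\<omega> i)) = (\<Sum>J\<in>{0}. (P1_coeff 2 (mlen J) / real (mfact J)) *\<^sub>R
      ?c (iter_multi LD J (iter_multi vert_contract (J + axis i 1) (\<omega> i))))" for R i
    unfolding homotopy_sum_def c_sum c_scale
    by (intro sum.mono_neutral_right) auto
  then have "?c (J1.Q (P1_coeff 2) R i (\<omega> i)) = (1 / 4) *\<^sub>R ?c (vert_contract i (\<omega> i))" for R i
    using vert_contract_multi_add_axis[of 0 i "\<omega> i"] by (simp add: P1_coeff_def)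
  then have "?c \<Theta> = (1 / 4) *\<^sub>R (?c (vert_contract 1 (\<omega> 1)) + ?c (vert_contract 2 (\<omega> 2)))"
    unfolding \<Theta>_def c_sum by (simp add: sum_2 scaleR_right_distrib)
  also have "vert_contract 1 (\<omega> 1) = - vert_contract 1 (ext_deriv (\<theta> 2))"
    using vert_contract_scale[of 1 "-1" "ext_deriv (\<theta> 2)"] by (simp add: \<omega>_simps)
  also have "?c (- vert_contract 1 (ext_deriv (\<theta> 2))) = (-2) *\<^sub>R L"
    unfolding c_minus contract2_vert_ext_deriv_\<theta> by simp
  also have "?c (vert_contract 2 (\<omega> 2)) = (-2) *\<^sub>R L"
    unfolding \<omega>_simps contract2_vert_ext_deriv_\<theta> by simp
  also have "(1 / 4) *\<^sub>R ((-2) *\<^sub>R L + (-2) *\<^sub>R L) = - L"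
    unfolding scaleR_left_distrib[symmetric] scaleR_scaleR by simp
  finally show ?thesis unfolding c .
qed

text \<open>If \<open>\<Theta>\<^sub>2\<close> is closed, its Lie derivative along \<open>T\<^sub>1\<close> is exact. Contraction with \<open>T\<^sub>2\<close> writes
\<open>dL\<close> as a sum of total derivatives of 1-forms, on which the Euler operator vanishes.\<close>

theorem null_if_closed:
  assumes "ext_deriv \<Theta> = 0"
  shows "dL = (\<Sum>i\<in>UNIV. LD i (\<theta> i))"
proof -
  define \<zeta> where "\<zeta> = (\<lambda>j. contract (total j) \<Theta>)"
  obtain N where N: "form N \<Theta>" "of_degree 2 \<Theta>" using \<Theta>_forms by (rule formsE)
  have \<zeta>_form: "form (N + 1) (\<zeta> j)" for j unfolding \<zeta>_def by (rule form_contract[OF N(1) jet_map_total])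
  have \<zeta>_deg: "of_degree 1 (\<zeta> j)" for j
    unfolding \<zeta>_def using N(2) by (intro of_degree_contract) (simp add: numeral_2_eq_2 One_nat_def)
  note \<zeta> = formsI[OF \<zeta>_deg \<zeta>_form]
  \<comment> \<open>the Cartan formula for the closed form \<open>\<Theta>\<close>\<close>
  have "LD 1 \<Theta> = ext_deriv (\<zeta> 1)" by (simp add: Lie_def assms contract_zero \<zeta>_def)
  then have "LD 1 (\<zeta> 2) = contract (total 2) (ext_deriv (\<zeta> 1))"
    using contract_fundamental_Lie[OF N(1), of 0 2 1] by (simp add: fundamental_vf_zero \<zeta>_def)
  also have "\<dots> = LD 2 (\<zeta> 1) - ext_deriv (contract (total 2) (\<zeta> 1))" by (simp add: Lie_def)
  also have "ext_deriv (contract (total 2) (\<zeta> 1)) = - dL"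
    unfolding \<zeta>_def contract2_\<Theta> dL_def by (rule ext_deriv_minus[OF L_form])
  finally have dL_eq: "dL = LD 1 (\<zeta> 2) + (-1) *\<^sub>R LD 2 (\<zeta> 1)" by simp
  let ?E = "J1.E (euler_coeff 1)"
  have van: "J1.vanish M dL" if "k \<le> M" for M
    using that by (intro vanish_form[OF dL_form dL_deg]) simp
  \<comment> \<open>the bound on the multi-indices is raised until it also covers the order of \<open>\<zeta>\<^sub>j\<close>\<close>
  have "?E (Suc k) dL = ?E (Suc (k + N + 1)) dL"
    using J1.E_stable[OF van[of "Suc k"], of "Suc (k + N + 1)"] by simp
  also have "\<dots> = ?E (Suc (k + N + 1)) (LD 1 (\<zeta> 2)) + (-1) *\<^sub>R ?E (Suc (k + N + 1)) (LD 2 (\<zeta> 1))"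
    by (subst dL_eq) (rule J1.E_lin; rule J1.D_in[OF \<zeta>])
  also have "\<dots> = 0"
  proof -
    have "J1.vanish (k + N + 1) (\<zeta> j)" for j by (rule vanish_form[OF \<zeta>_form \<zeta>_deg]) simp
    then show ?thesis by (simp add: J1.euler_D[OF \<zeta>])
  qed
  finally have "?E (Suc k) dL = 0" .
  moreover have "euler_coeff 1 = (\<lambda>n. (if n = 0 then 1 else 0) + (-1) * (real n * hilbert_coeff (n - 1)))"
  proof
    fix n show "euler_coeff 1 n = (if n = 0 then 1 else 0) + (-1) * (real n * hilbert_coeff (n - 1))"
      by (cases n) (simp_all add: euler_coeff_def hilbert_coeff_def field_simps)
  qed
  ultimately have "(\<Sum>i\<in>UNIV. LD i (J1.Q hilbert_coeff k i dL)) = dL"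
    unfolding J1.sum_D_Q[OF dL_forms]
    by (simp only: J1.E_coeff_add) (simp add: J1.E_delta)
  then show ?thesis by (simp only: \<theta>_eq)
qed

end

section \<open>Charts of the frame bundle\<close>

text \<open>Expresses linear independence by a strict inequality between continuous functions, which shows
that it is an open condition. Cauchy-Schwarz is strict exactly for independent vectors; the
witness is the component of \<open>u\<close> orthogonal to \<open>v\<close>.\<close>

lemma independent_iff_gram:
  fixes u v :: "'a::real_inner"
  shows "(\<forall>a b. a *\<^sub>R u + b *\<^sub>R v = 0 \<longrightarrow> a = 0 \<and> b = 0) \<longleftrightarrow> (u \<bullet> v)\<^sup>2 < (u \<bullet> u) * (v \<bullet> v)"
proof
  assume indep: "\<forall>a b. a *\<^sub>R u + b *\<^sub>R v = 0 \<longrightarrow> a = 0 \<and> b = 0"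
  \<comment> \<open>\<open>v \<bullet> v\<close> times the component of \<open>u\<close> orthogonal to \<open>v\<close>\<close>
  let ?w = "(v \<bullet> v) *\<^sub>R u + (- (u \<bullet> v)) *\<^sub>R v"
  have "v \<noteq> 0" using indep[rule_format, of 0 1] by auto
  then have vv: "v \<bullet> v > 0" by simp
  then have "?w \<noteq> 0" using indep[rule_format, of "v \<bullet> v" "- (u \<bullet> v)"] by auto
  then have "0 < ?w \<bullet> ?w" by simp
  also have "?w \<bullet> ?w = (v \<bullet> v) * ((u \<bullet> u) * (v \<bullet> v) - (u \<bullet> v)\<^sup>2)"
    by (simp add: inner_add_left inner_add_right inner_commute[of v u] algebra_simps power2_eq_square)
  finally show "(u \<bullet> v)\<^sup>2 < (u \<bullet> u) * (v \<bullet> v)" using vv by (simp add: zero_less_mult_iff)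
next
  assume gram: "(u \<bullet> v)\<^sup>2 < (u \<bullet> u) * (v \<bullet> v)"
  show "\<forall>a b. a *\<^sub>R u + b *\<^sub>R v = 0 \<longrightarrow> a = 0 \<and> b = 0"
  proof (intro allI impI)
    fix a b assume ab: "a *\<^sub>R u + b *\<^sub>R v = 0"
    have "(a *\<^sub>R u + b *\<^sub>R v) \<bullet> u = 0" "(a *\<^sub>R u + b *\<^sub>R v) \<bullet> v = 0" using ab by simp_all
    then have 1: "a * (u \<bullet> u) + b * (u \<bullet> v) = 0" "a * (u \<bullet> v) + b * (v \<bullet> v) = 0"
      by (simp_all add: inner_add_left inner_commute[of v u])
    have "a * ((u \<bullet> u) * (v \<bullet> v) - (u \<bullet> v)\<^sup>2) = 0" "b * ((u \<bullet> u) * (v \<bullet> v) - (u \<bullet> v)\<^sup>2) = 0"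
      using 1 by algebra+
    then show "a = 0 \<and> b = 0" using gram by simp
  qed
qed

lemma open_frame_chart_dom:
  assumes "is_chart c"
  shows "open (frame_chart_dom c)"
proof -
  have ev: "continuous_on UNIV (\<lambda>p :: 'b point. p I)" for I
    by (rule continuous_on_product_then_coordinatewise[OF continuous_on_id])
  have "open (snd c ` fst c)" using assms by (auto simp: is_chart_def split: prod.splits)
  then have "open ((\<lambda>p :: 'b point. p 0) -` (snd c ` fst c))" by (rule open_vimage[OF _ ev])
  moreover have "open {p :: 'b point. (p (axis 1 1) \<bullet> p (axis 2 1))\<^sup>2
      < (p (axis 1 1) \<bullet> p (axis 1 1)) * (p (axis 2 1) \<bullet> p (axis 2 1))}"
    by (intro open_Collect_less continuous_intros ev)
  ultimately have "open ((\<lambda>p :: 'b point. p 0) -` (snd c ` fst c) \<inter> {p. (p (axis 1 1) \<bullet> p (axis 2 1))\<^sup>2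
      < (p (axis 1 1) \<bullet> p (axis 1 1)) * (p (axis 2 1) \<bullet> p (axis 2 1))})" by (rule open_Int)
  also have "\<dots> = frame_chart_dom c"
    unfolding frame_chart_dom_def independent_iff_gram by blast
  finally show ?thesis .
qed

lemma local_rep_agree: "agree k p q \<Longrightarrow> local_rep A k L c p = local_rep A k L c q"
  unfolding local_rep_def agree_def by (intro arg_cong[where f = L]) (metis (no_types, lifting))

lemma lie_fun_form: "lie X (fun_form F) p [] = dir_deriv (X p) F p"
  by (simp add: lie_def contract_def ext_d_Cons fun_form_def)

theorem corollary5p4:
  fixes A :: "('e::{t2_space,second_countable_topology}, 'n::finite) chart set"
    and L :: "(real^2 \<Rightarrow> 'e) set \<Rightarrow> real"
    and k :: nat
  assumes "smooth_atlas A"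
    and "k \<ge> 1"
    and "lagrangian A k L"
    and "homogeneous A k L"
  shows "form_eq_zero A (\<lambda>c. ext_d (fundamental_form A k L c)) \<longleftrightarrow> null_lagrangian A k L"
proof -
  have "(\<forall>p\<in>frame_chart_dom c. \<forall>vs. ext_d (fundamental_form A k L c) p vs = 0)
      \<longleftrightarrow> (\<forall>p\<in>frame_chart_dom c. \<forall>vs. euler_lagrange_form k (local_rep A k L c) p vs = 0)" if c: "c \<in> A" for c
  proof -
    let ?W = "frame_chart_dom c" and ?F = "local_rep A k L c"
    have chart: "is_chart c" using assms(1) c by (simp add: smooth_atlas_def)
    have hom: "(\<forall>i j. lie (fundamental_vf (axis i 1) j) (fun_form ?F) p [] = (if i = j then ?F p else 0)) \<and>
        (\<forall>I j. mlen I \<ge> 2 \<longrightarrow> lie (fundamental_vf I j) (fun_form ?F) p [] = 0)" if "p \<in> ?W" for p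
      using assms(4) c that unfolding homogeneous_def by blast
    interpret homogeneous_lagrangian ?W ?F k
    proof
      show "open ?W" by (rule open_frame_chart_dom[OF chart])
      show "smooth_fun ?W ?F"
        using assms(3) c by (intro smooth_fun_point_smooth) (simp add: lagrangian_def)
      show "?F p = ?F q" if "agree k p q" for p q by (rule local_rep_agree[OF that])
      show "1 \<le> k" by (rule assms(2))
      show "dir_deriv (fundamental_vf (axis i 1) j p) ?F p = (if i = j then ?F p else 0)" if "p \<in> ?W" for p i j
        using hom[OF that] unfolding lie_fun_form by blast
      show "dir_deriv (fundamental_vf I j p) ?F p = 0" if "p \<in> ?W" "2 \<le> mlen I" for p I j
        using hom[OF that(1)] that(2) unfolding lie_fun_form by blast
    qed
    have zero: "(\<forall>p\<in>?W. \<forall>vs. \<phi> p vs = 0) \<longleftrightarrow> cut \<phi> = 0" for \<phi>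
      by (auto simp: fun_eq_iff cut_def fun_apply)
    have "cut (ext_d (fundamental_form A k L c)) = ext_deriv \<Theta>"
      unfolding cut_ext_deriv fundamental_form_def cut_Theta2 ..
    moreover have "cut (euler_lagrange_form k ?F) = 0 \<longleftrightarrow> dL = (\<Sum>i\<in>UNIV. LD i (\<theta> i))"
      unfolding cut_euler_lagrange by simp
    ultimately show ?thesis
      unfolding zero using closed_if_null null_if_closed by auto
  qed
  then show ?thesis
    unfolding null_lagrangian_def form_eq_zero_def by blast
qed

end
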